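(* Let $n\ge 1$, $k=\lfloor n/2\rfloor$, $\ell=\lceil n/2\rceil$, and $C=[\ell]\times[k]$. Consider the following description of $P^{\mathrm{core}}_{\mathrm{QTSASM}}\subseteq\mathbb R^{C}$ (the notation $\widetilde C$, $\mathcal S$, $z_{i,j}(Y)$ is given in the context): $$0\le z_{i,j}(Y)\le 1\quad\forall (i,j)\in\widetilde C\setminus([k]\times\{n\}),\qquad z_{i,n}(Y)=1\quad\forall i\in[k],$$ $$\frac{\sum_{(i,j)\in\widetilde C}s_{i,j}\,z_{i,j}(Y)}{2}\le\left\lfloor\frac{|\{(i,j)\in\widetilde C: s_{i,j}=1\}|-|\{i\in[k]: s_{i,n}=-1\}|}{2}\right\rfloor\quad\forall S\in\mathcal S.$$ This description contains at most $5^{\lfloor n^2/4\rfloor}+n(n-1)$ linear inequalities, where the lower and upper bounds on the $z_{i,j}(Y)$ are counted separately (and the equations are not counted), that is, $2\,|\widetilde C\setminus([k]\times\{n\})|+|\mathcal S|\le 5^{\lfloor n^2/4\rfloor}+n(n-1)$. In particular, both $P^{\mathrm{core}}_{\mathrm{QTSASM}}$ and $P_{\mathrm{QTSASM}}$ have at most $5^{\lfloor n^2/4\rfloor}+n(n-1)$ facets.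
   Context: $[n]=\{1,\dots,n\}$; empty sums are $0$. An $n\times n$ alternating sign matrix (ASM) is an $n\times n$ matrix with entries in $\{0,1,-1\}$ such that in each row and each column the non-zero entries alternate in sign and the first and last non-zero entries are $1$ (so every row and column sums to $1$). A QTSASM is an $n\times n$ ASM $X$ with $x_{i,j}=x_{j,n+1-i}$ for all $i,j\in[n]$. $P_{\mathrm{QTSASM}}\subseteq\mathbb R^{n\times n}$ is the convex hull of all $n\times n$ QTSASMs. The core of a QTSASM $X$ is its upper-left $\ell\times k$ block $(x_{i,j})_{(i,j)\in C}$, and $P^{\mathrm{core}}_{\mathrm{QTSASM}}\subseteq\mathbb R^C$ is the convex hull of the cores of all $n\times n$ QTSASMs. Define $\widetilde C=[k]\times[n]$ if $n$ is even and $\widetilde C=([k]\times[n])\cup\{(k+1,j): j\in[k]\}$ if $n$ is odd. Put $n_i=n$ for $i\in[k]$ and, when $n$ is odd, $n_{k+1}=k$. Define $$\mathcal S=\Bigl\{S=(s_{i,j})\in\{0,1,-1\}^{\widetilde C}\ :\ \sum_{j'=j}^{n_i}s_{i,j'}+\sum_{i'=n+1-i}^{n}s_{j,i'}\ \text{is even for all }(i,j)\in C\Bigr\}.$$ For $Y=(y_{i,j})\in\mathbb R^C$ and $(i,j)\in\widetilde C$ set $z_{i,j}(Y)=\sum_{j'=1}^{\min\{j,k\}}y_{i,j'}+\sum_{j'=k+1}^{j}y_{n+1-j',i}$. *)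

theory Defs
  imports "HOL-Analysis.Analysis" "HOL-Library.FuncSet"
begin

text \<open>
  Matrices are functions on pairs of indices, with rows and columns numbered from 1; only the
  values on the relevant index set matter. They are transported to the Euclidean space
  \<open>real^'n^'n\<close>, where \<open>CARD('n) = n\<close>, to form polytopes.
\<close>

definition asm_line :: "nat \<Rightarrow> (nat \<Rightarrow> int) \<Rightarrow> bool" where
  "asm_line n a \<longleftrightarrow>
     (\<forall>i\<in>{1..n}. a i \<in> {0, 1, -1}) \<and>
     (\<exists>i\<in>{1..n}. a i \<noteq> 0) \<and>
     (\<forall>i\<in>{1..n}. a i \<noteq> 0 \<and> (\<forall>m\<in>{1..<i}. a m = 0) \<longrightarrow> a i = 1) \<and>
     (\<forall>i\<in>{1..n}. a i \<noteq> 0 \<and> (\<forall>m\<in>{i<..n}. a m = 0) \<longrightarrow> a i = 1) \<and>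
     (\<forall>i\<in>{1..n}. \<forall>j\<in>{1..n}. i < j \<and> a i \<noteq> 0 \<and> a j \<noteq> 0 \<and> (\<forall>m\<in>{i<..<j}. a m = 0)
        \<longrightarrow> a j = - a i)"

definition is_ASM :: "nat \<Rightarrow> (nat \<times> nat \<Rightarrow> int) \<Rightarrow> bool" where
  "is_ASM n x \<longleftrightarrow>
     (\<forall>i\<in>{1..n}. asm_line n (\<lambda>j. x (i, j))) \<and> (\<forall>j\<in>{1..n}. asm_line n (\<lambda>i. x (i, j)))"

definition is_QTSASM :: "nat \<Rightarrow> (nat \<times> nat \<Rightarrow> int) \<Rightarrow> bool" where
  "is_QTSASM n x \<longleftrightarrow>
     is_ASM n x \<and> (\<forall>i\<in>{1..n}. \<forall>j\<in>{1..n}. x (i, j) = x (j, n + 1 - i))"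

text \<open>The set \<open>C\<close>: rows up to \<open>\<lceil>n/2\<rceil>\<close>, columns up to \<open>\<lfloor>n/2\<rfloor>\<close>.\<close>

definition core_idx :: "nat \<Rightarrow> (nat \<times> nat) set" where
  "core_idx n = {1..(n + 1) div 2} \<times> {1..n div 2}"

text \<open>The position in \<open>{1..CARD('n)}\<close> of an element of the finite linearly ordered type \<open>'n\<close>.\<close>

definition pos :: "'n::{finite,linorder} \<Rightarrow> nat" where
  "pos a = card {..a}"

definition embed :: "(nat \<times> nat \<Rightarrow> real) \<Rightarrow> real^'n::{finite,linorder}^'n::{finite,linorder}" where
  "embed x = (\<chi> a b. x (pos a, pos b))"

text \<open>
  Since \<open>C\<close> is empty for \<open>n = 1\<close>, the space of real vectors indexed by \<open>C\<close> is in general not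
  of the form \<open>real^'c\<close>. It is identified with the coordinate subspace of \<open>real^'n^'n\<close>
  consisting of the matrices that vanish outside \<open>C\<close>.
\<close>

definition embed_core :: "(nat \<times> nat \<Rightarrow> real) \<Rightarrow> real^'n::{finite,linorder}^'n::{finite,linorder}" where
  "embed_core y = embed (\<lambda>p. if p \<in> core_idx CARD('n) then y p else 0)"

definition P_QTSASM :: "(real^'n::{finite,linorder}^'n::{finite,linorder}) set" where
  "P_QTSASM = convex hull {embed (\<lambda>p. real_of_int (x p)) | x. is_QTSASM CARD('n) x}"

definition P_core_QTSASM :: "(real^'n::{finite,linorder}^'n::{finite,linorder}) set" where
  "P_core_QTSASM = convex hull {embed_core (\<lambda>p. real_of_int (x p)) | x. is_QTSASM CARD('n) x}"

definition Ctilde :: "nat \<Rightarrow> (nat \<times> nat) set" where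
  "Ctilde n = {1..n div 2} \<times> {1..n} \<union> (if odd n then {n div 2 + 1} \<times> {1..n div 2} else {})"

definition row_len :: "nat \<Rightarrow> nat \<Rightarrow> nat" where
  "row_len n i = (if i \<le> n div 2 then n else n div 2)"

definition parity_signs :: "nat \<Rightarrow> (nat \<times> nat \<Rightarrow> int) set" where
  "parity_signs n = {s \<in> Ctilde n \<rightarrow>\<^sub>E {0, 1, -1}.
     \<forall>(i, j) \<in> core_idx n.
       even ((\<Sum>j' = j..row_len n i. s (i, j')) + (\<Sum>i' = n + 1 - i..n. s (j, i')))}"

definition z :: "nat \<Rightarrow> (nat \<times> nat \<Rightarrow> real) \<Rightarrow> nat \<times> nat \<Rightarrow> real" where
  "z n y = (\<lambda>(i, j). (\<Sum>j' = 1..min j (n div 2). y (i, j'))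
                    + (\<Sum>j' = n div 2 + 1..j. y (n + 1 - j', i)))"

definition bounded_idx :: "nat \<Rightarrow> (nat \<times> nat) set" where
  "bounded_idx n = Ctilde n - {1..n div 2} \<times> {n}"

definition satisfies_description :: "nat \<Rightarrow> (nat \<times> nat \<Rightarrow> real) \<Rightarrow> bool" where
  "satisfies_description n y \<longleftrightarrow>
     (\<forall>p \<in> bounded_idx n. 0 \<le> z n y p \<and> z n y p \<le> 1) \<and>
     (\<forall>i \<in> {1..n div 2}. z n y (i, n) = 1) \<and>
     (\<forall>s \<in> parity_signs n.
        (\<Sum>p \<in> Ctilde n. real_of_int (s p) * z n y p) / 2
        \<le> real_of_int \<lfloor>(real (card {p \<in> Ctilde n. s p = 1})
                          - real (card {i \<in> {1..n div 2}. s (i, n) = -1})) / 2\<rfloor>)"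

end

theory Submission
  imports Defs
begin

text \<open>
  The prefix sums $z_{i,j}(Y)$ turn the cores into the $0/1$ solutions of a system with one equation
  per cell of \<open>C\<close>: the cell is visited by two lines (a row, and a column read as a row), and its
  entry is the increment of the prefix sum on both. Hence the coefficients of every unknown have
  absolute sum at most 2, and the parity inequalities are exactly the odd cut inequalities of
  Edmonds and Johnson. Their theorem is proved in the form: for every cost function, a point of the
  polytope can be rounded to a $0/1$ solution of no larger cost. A minimal counterexample is
  fractional and has no tight nontrivial cut, since contracting the two sides of such a cut gives
  smaller instances whose solutions can be glued along the unique deviating edge of the cut.
  Counting equations then yields a direction along which the point moves until a bound or a
  nontrivial cut becomes tight.

  The parity sign vectors correspond to sets \<open>U\<close> of cells together with a sign on each edge of the
  cut of \<open>U\<close>. Deciding membership in \<open>U\<close> cell by cell, from the bottom row upwards and from right to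
  left, multiplies the count by at most 3 in the bottom row and by at most 5 in the middle rows;
  the surplus of the top row, where each cell has a third decided neighbour, is compensated by the
  bottom row.
\<close>

section \<open>Rounding points of the Edmonds--Johnson polytope\<close>

text \<open>Gluing works because a 0/1 solution of a contracted system differs from the prescribed
  pattern \<open>F\<close> at exactly one edge of the cut. The cheapest completion on the other side
  is therefore a function of that single edge, and every such function is represented exactly, up to
  a constant, by linear costs on the cut. So rounding with costs avoids matching two convex
  combinations. The obstacle is that the system is not quite a graph: the last position of a line
  has only one end. At the ends of full lines the equations fix the value 1, and at the end of the
  half line (odd \<open>n\<close>) the parity inequalities themselves force an integral value; hence
  the condition on columns is imposed at fractional values only.\<close>

lemma homogeneous_system_solution:
  fixes a :: "'v \<Rightarrow> 'e \<Rightarrow> real"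
  assumes "finite V" "finite E" "card V < card E"
  shows "\<exists>d. (\<exists>e\<in>E. d e \<noteq> 0) \<and> (\<forall>v\<in>V. (\<Sum>e\<in>E. a v e * d e) = 0)"
  using assms
proof (induction V arbitrary: E a rule: finite_induct)
  case empty
  then show ?case by (intro exI[of _ "\<lambda>_. 1"]) (use card_gt_0_iff in fastforce)
next
  case (insert v V)
  show ?case
  proof (cases "\<exists>e\<in>E. a v e \<noteq> 0")
    case False
    obtain d where "\<exists>e\<in>E. d e \<noteq> 0" "\<forall>v\<in>V. (\<Sum>e\<in>E. a v e * d e) = 0"
      using insert.IH[of E a] insert.prems insert.hyps by auto
    with False show ?thesis by (intro exI[of _ d]) auto
  next
    case True
    then obtain e0 where e0: "e0 \<in> E" "a v e0 \<noteq> 0" by blast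
    \<comment> \<open>Gaussian elimination with pivot \<open>a v e0\<close>: the unknown
      \<open>e0\<close> is removed from the other equations and recovered at the end from equation
      \<open>v\<close>.\<close>
    define a' where "a' = (\<lambda>w e. a w e - a w e0 * a v e / a v e0)"
    have "card V < card (E - {e0})"
      using insert.prems insert.hyps e0 by (simp add: card_Diff_singleton)
    then obtain d where d: "\<exists>e\<in>E - {e0}. d e \<noteq> 0"
      "\<forall>w\<in>V. (\<Sum>e\<in>E - {e0}. a' w e * d e) = 0"
      using insert.IH[of "E - {e0}" a'] insert.prems by auto
    define T where "T = (\<Sum>e\<in>E - {e0}. a v e * d e)"
    define d' where "d' = d(e0 := - T / a v e0)"
    have split: "(\<Sum>e\<in>E. a w e * d' e) = a w e0 * (- T / a v e0) + (\<Sum>e\<in>E - {e0}. a w e * d e)" for w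
    proof -
      have "(\<Sum>e\<in>E. a w e * d' e) = a w e0 * d' e0 + (\<Sum>e\<in>E - {e0}. a w e * d' e)"
        using e0 insert.prems by (simp add: sum.remove)
      also have "(\<Sum>e\<in>E - {e0}. a w e * d' e) = (\<Sum>e\<in>E - {e0}. a w e * d e)"
        by (rule sum.cong) (auto simp: d'_def)
      finally show ?thesis by (simp add: d'_def)
    qed
    have "(\<Sum>e\<in>E. a w e * d' e) = 0" if "w \<in> V" for w
    proof -
      have "0 = (\<Sum>e\<in>E - {e0}. a w e * d e - a w e0 / a v e0 * (a v e * d e))"
        using d(2) that by (simp add: a'_def left_diff_distrib mult.assoc)
      also have "\<dots> = (\<Sum>e\<in>E - {e0}. a w e * d e) - a w e0 / a v e0 * T"
        unfolding T_def sum_subtractf sum_distrib_left ..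
      finally show ?thesis unfolding split by (simp add: algebra_simps)
    qed
    moreover have "(\<Sum>e\<in>E. a v e * d' e) = 0"
      unfolding split using e0 by (simp add: T_def)
    moreover have "\<exists>e\<in>E. d' e \<noteq> 0" using d(1) by (auto simp: d'_def)
    ultimately show ?thesis by blast
  qed
qed

text \<open>The ratio test of the simplex method: the step is the least ratio of slack to rate of
  decrease. The conclusion records \<open>h i < 0\<close> for the constraint that becomes tight;
  later this excludes trivial cuts, which cannot become tight at a nonzero rate.\<close>

lemma move_until_tight:
  fixes g h :: "'i \<Rightarrow> real"
  assumes "finite I" "\<forall>i\<in>I. 0 \<le> g i" "\<exists>i\<in>I. h i < 0"
  shows "\<exists>t\<ge>0. (\<forall>i\<in>I. 0 \<le> g i + t * h i) \<and> (\<exists>i\<in>I. h i < 0 \<and> g i + t * h i = 0)"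
proof -
  define N where "N = {i \<in> I. h i < 0}"
  have N: "finite N" "N \<noteq> {}" using assms by (auto simp: N_def)
  define t where "t = Min ((\<lambda>i. g i / - h i) ` N)"
  have "t \<in> (\<lambda>i. g i / - h i) ` N" unfolding t_def using N by (intro Min_in) auto
  then obtain i where i: "i \<in> N" "t = g i / - h i" by auto
  have le: "t \<le> g j / - h j" if "j \<in> N" for j
    unfolding t_def using N that by (intro Min_le) auto
  have t0: "t \<ge> 0" using i assms(2) by (auto simp: N_def divide_nonneg_neg)
  have "0 \<le> g j + t * h j" if "j \<in> I" for j
  proof (cases "h j < 0")
    case True
    then have "t \<le> g j / - h j" using le that by (auto simp: N_def)
    then show ?thesis using True by (simp add: field_simps)
  next
    case False
    then show ?thesis using t0 assms(2) that by simp
  qed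
  moreover have "g i + t * h i = 0" "h i < 0" "i \<in> I" using i by (auto simp: N_def field_simps)
  ultimately show ?thesis using t0 by blast
qed

text \<open>A column of absolute sum 2 is an edge of a bidirected graph, and the parity of its sum
  over \<open>U\<close> tells whether exactly one end lies in \<open>U\<close>. The parity form
  ignores signs and makes sense for all columns; a loop never lies in a cut.\<close>

definition odd_cut :: "('v \<Rightarrow> 'e \<Rightarrow> int) \<Rightarrow> 'e set \<Rightarrow> 'v set \<Rightarrow> 'e set" where
  "odd_cut a E U = {e \<in> E. odd (\<Sum>v\<in>U. a v e)}"

text \<open>
  The distance of \<open>x\<close>, on the edges of a cut \<open>D\<close>, to the $0/1$ vector that is 1 exactly on \<open>F\<close>.
  For the wrong parity of \<open>F\<close> every solution differs from that vector, so the deviation is at least 1.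
\<close>

definition deviation :: "('e \<Rightarrow> real) \<Rightarrow> 'e set \<Rightarrow> 'e set \<Rightarrow> real" where
  "deviation x D F = (\<Sum>e\<in>D. if e \<in> F then 1 - x e else x e)"

text \<open>Adding the equations of \<open>U\<close> modulo 2 shows that every solution meets the
  cut in a set of the parity of \<open>sum b U\<close>, so \<open>F\<close> of the other parity is
  never its trace. For an empty cut the deviation is 0, and the constraint says that
  \<open>sum b U\<close> is even.\<close>

definition cut_constraints ::
  "'v set \<Rightarrow> 'e set \<Rightarrow> ('v \<Rightarrow> 'e \<Rightarrow> int) \<Rightarrow> ('v \<Rightarrow> int) \<Rightarrow> ('e \<Rightarrow> real) \<Rightarrow> bool" where
  "cut_constraints V E a b x \<longleftrightarrow>
     (\<forall>U F. U \<subseteq> V \<longrightarrow> F \<subseteq> odd_cut a E U \<longrightarrow> odd (int (card F) + sum b U) \<longrightarrow>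
        1 \<le> deviation x (odd_cut a E U) F)"

definition ej_point ::
  "'v set \<Rightarrow> 'e set \<Rightarrow> ('v \<Rightarrow> 'e \<Rightarrow> int) \<Rightarrow> ('v \<Rightarrow> int) \<Rightarrow> ('e \<Rightarrow> real) \<Rightarrow> bool" where
  "ej_point V E a b x \<longleftrightarrow> finite V \<and> finite E \<and> (\<forall>v e. \<bar>a v e\<bar> \<le> 1) \<and>
     (\<forall>e\<in>E. 0 \<le> x e \<and> x e \<le> 1) \<and>
     (\<forall>e\<in>E. x e \<noteq> 0 \<and> x e \<noteq> 1 \<longrightarrow> (\<Sum>v\<in>V. \<bar>a v e\<bar>) = 2) \<and>
     (\<forall>v\<in>V. (\<Sum>e\<in>E. of_int (a v e) * x e) = of_int (b v)) \<and>
     cut_constraints V E a b x"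

definition fractional :: "'e set \<Rightarrow> ('e \<Rightarrow> real) \<Rightarrow> bool" where
  "fractional E x \<longleftrightarrow> (\<forall>e\<in>E. 0 < x e \<and> x e < 1)"

definition solution ::
  "'v set \<Rightarrow> 'e set \<Rightarrow> ('v \<Rightarrow> 'e \<Rightarrow> int) \<Rightarrow> ('v \<Rightarrow> int) \<Rightarrow> 'e set \<Rightarrow> bool" where
  "solution V E a b J \<longleftrightarrow> J \<subseteq> E \<and> (\<forall>v\<in>V. (\<Sum>e\<in>J. a v e) = b v)"

section \<open>Parity facts and the restriction to fractional edges\<close>

lemma abs_le_1_int: "\<bar>i::int\<bar> \<le> 1 \<longleftrightarrow> i = -1 \<or> i = 0 \<or> i = 1" by arith

lemma even_sum_abs: "even (\<Sum>v\<in>U. \<bar>f v :: int\<bar>) \<longleftrightarrow> even (\<Sum>v\<in>U. f v)"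
  by (induction U rule: infinite_finite_induct) auto

lemma odd_cut_subset: "odd_cut a E U \<subseteq> E" by (auto simp: odd_cut_def)

lemma card_filter_parity:
  assumes "finite A"
  shows "even ((\<Sum>e\<in>A. f e) - int (card {e \<in> A. odd (f e)}))"
  using assms
proof (induction A rule: finite_induct)
  case (insert y A)
  have "{e \<in> insert y A. odd (f e)} = (if odd (f y) then insert y {e \<in> A. odd (f e)} else {e \<in> A. odd (f e)})"
    by auto
  then show ?case using insert by auto
qed auto

text \<open>Edges of value 0 are dropped, those of value 1 move into \<open>b'\<close>. A cut of the
  smaller system extends to the larger one by adding to \<open>F\<close> the edges of value 1 in the
  cut; then all fixed edges contribute 0 to the deviation.\<close>

lemma ej_point_restrict_fractional:
  assumes "ej_point V E a b x"
  defines "E0 \<equiv> {e \<in> E. 0 < x e \<and> x e < 1}" and "O1 \<equiv> {e \<in> E. x e = 1}"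
  defines "b' \<equiv> \<lambda>v. b v - (\<Sum>e\<in>O1. a v e)"
  shows "ej_point V E0 a b' x"
proof -
  have fin: "finite V" "finite E" using assms by (auto simp: ej_point_def)
  have bnd: "0 \<le> x e" "x e \<le> 1" if "e \<in> E" for e using assms that by (auto simp: ej_point_def)
  have sub: "E0 \<subseteq> E" "O1 \<subseteq> E" "E0 \<inter> O1 = {}" by (auto simp: E0_def O1_def)
  have fin': "finite E0" "finite O1" using fin by (auto simp: E0_def O1_def)
  have eq: "(\<Sum>e\<in>E0. of_int (a v e) * x e) = of_int (b' v)" if "v \<in> V" for v
  proof -
    have "of_int (b v) = (\<Sum>e\<in>E. of_int (a v e) * x e)" using assms that by (auto simp: ej_point_def)
    also have "\<dots> = (\<Sum>e\<in>E0 \<union> O1. of_int (a v e) * x e)"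
    proof (rule sum.mono_neutral_right)
      show "\<forall>i\<in>E - (E0 \<union> O1). of_int (a v i) * x i = 0"
        using bnd unfolding E0_def O1_def by (metis (mono_tags, lifting) DiffE UnCI less_eq_real_def mem_Collect_eq mult_zero_right)
    qed (use fin sub in auto)
    also have "\<dots> = (\<Sum>e\<in>E0. of_int (a v e) * x e) + (\<Sum>e\<in>O1. of_int (a v e) * x e)"
      using fin' sub by (simp add: sum.union_disjoint)
    also have "(\<Sum>e\<in>O1. of_int (a v e) * x e) = of_int (\<Sum>e\<in>O1. a v e)"
      by (simp add: O1_def)
    finally show ?thesis by (simp add: b'_def)
  qed
  have "1 \<le> deviation x (odd_cut a E0 U) F"
    if U: "U \<subseteq> V" and F: "F \<subseteq> odd_cut a E0 U" and odd: "odd (int (card F) + sum b' U)" for U F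
  proof -
    define O2 where "O2 = {e \<in> O1. odd (\<Sum>v\<in>U. a v e)}"
    have finU: "finite U" using U fin finite_subset by auto
    have FO: "F \<union> O2 \<subseteq> odd_cut a E U" using F sub by (auto simp: O2_def odd_cut_def)
    have disj: "F \<inter> O2 = {}" using F by (auto simp: odd_cut_def E0_def O2_def O1_def)
    have "finite F" using F fin' by (auto simp: odd_cut_def intro: finite_subset)
    then have card: "card (F \<union> O2) = card F + card O2"
      using disj fin' by (intro card_Un_disjoint) (auto simp: O2_def)
    have "sum b' U = sum b U - (\<Sum>v\<in>U. \<Sum>e\<in>O1. a v e)" by (simp add: b'_def sum_subtractf)
    also have "(\<Sum>v\<in>U. \<Sum>e\<in>O1. a v e) = (\<Sum>e\<in>O1. \<Sum>v\<in>U. a v e)" by (rule sum.swap)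
    finally have sb: "sum b' U = sum b U - (\<Sum>e\<in>O1. \<Sum>v\<in>U. a v e)" .
    \<comment> \<open>The odd columns among the edges of value 1 are counted by \<open>O2\<close>,
      so enlarging \<open>F\<close> compensates the passage between \<open>b'\<close> and
      \<open>b\<close>.\<close>
    from card_filter_parity[of O1 "\<lambda>e. \<Sum>v\<in>U. a v e"] have "even ((\<Sum>e\<in>O1. \<Sum>v\<in>U. a v e) - int (card O2))"
      using fin' by (simp add: O2_def)
    then have "odd (int (card (F \<union> O2)) + sum b U)" using odd sb card by auto
    then have "1 \<le> deviation x (odd_cut a E U) (F \<union> O2)"
      using assms(1) U FO by (auto simp: ej_point_def cut_constraints_def)
    also have "deviation x (odd_cut a E U) (F \<union> O2) = deviation x (odd_cut a E0 U) F"
      unfolding deviation_def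
    proof (rule sum.mono_neutral_cong_right)
      show "finite (odd_cut a E U)" using fin by (auto simp: odd_cut_def)
      show "odd_cut a E0 U \<subseteq> odd_cut a E U" using sub by (auto simp: odd_cut_def)
      show "\<forall>i\<in>odd_cut a E U - odd_cut a E0 U. (if i \<in> F \<union> O2 then 1 - x i else x i) = 0"
        using bnd F by (fastforce simp: odd_cut_def E0_def O2_def O1_def not_less)
      show "\<And>i. i \<in> odd_cut a E0 U \<Longrightarrow> (if i \<in> F \<union> O2 then 1 - x i else x i) = (if i \<in> F then 1 - x i else x i)"
        by (auto simp: O2_def O1_def odd_cut_def E0_def)
    qed
    finally show ?thesis .
  qed
  then show ?thesis
    using assms(1) eq fin' unfolding ej_point_def cut_constraints_def by (auto simp: E0_def)
qed

lemma solution_extend: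
  fixes x :: "'e \<Rightarrow> real"
  assumes "finite E" and "solution V {e \<in> E. 0 < x e \<and> x e < 1} a (\<lambda>v. b v - (\<Sum>e\<in>{e \<in> E. x e = 1}. a v e)) J"
  shows "solution V E a b (J \<union> {e \<in> E. x e = 1})"
proof -
  let ?O = "{e \<in> E. x e = 1}"
  have J: "J \<subseteq> {e \<in> E. 0 < x e \<and> x e < 1}" using assms by (simp add: solution_def)
  then have "finite J" "J \<inter> ?O = {}" using assms(1) by (auto intro: finite_subset)
  then have "(\<Sum>e\<in>J \<union> ?O. a v e) = (\<Sum>e\<in>J. a v e) + (\<Sum>e\<in>?O. a v e)" for v
    using assms(1) by (intro sum.union_disjoint) auto
  then show ?thesis using assms J by (auto simp: solution_def)
qed

lemma fractional_column_sum:
  assumes "ej_point V E a b x" "fractional E x" "e \<in> E"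
  shows "(\<Sum>v\<in>V. \<bar>a v e\<bar>) = 2"
  using assms unfolding ej_point_def fractional_def by (metis less_irrefl)

text \<open>Every column has absolute sum 2 over \<open>V\<close>, so the cut of \<open>V\<close> is
  empty and its constraint is a pure parity condition.\<close>

lemma ej_point_even_total:
  assumes "ej_point V E a b x"
  assumes "fractional E x"
  shows "even (sum b V)" "e \<in> E \<Longrightarrow> even (\<Sum>v\<in>V. a v e)"
proof -
  have *: "even (\<Sum>v\<in>V. a v e)" if "e \<in> E" for e
  proof -
    have "(\<Sum>v\<in>V. \<bar>a v e\<bar>) = 2" by (rule fractional_column_sum[OF assms that])
    then show ?thesis by (metis even_sum_abs even_numeral)
  qed
  then have "odd_cut a E V = {}" by (auto simp: odd_cut_def)
  then have "odd (sum b V) \<longrightarrow> 1 \<le> deviation x {} {}"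
    using assms(1) by (auto simp: ej_point_def cut_constraints_def dest: spec[of _ V] spec[of _ "{}"])
  then show "even (sum b V)" by (auto simp: deviation_def)
  show "e \<in> E \<Longrightarrow> even (\<Sum>v\<in>V. a v e)" by (rule *)
qed

section \<open>Contracting and gluing along a tight cut\<close>

text \<open>
  Contracting \<open>U\<close> along a tight cut \<open>(U, F)\<close> keeps the edges with at most one end in \<open>U\<close>. An element
  \<open>u \<in> U\<close> serves as the new vertex; its equation states that the deviation on the cut equals 1.
\<close>

definition contract_edges :: "('v \<Rightarrow> 'e \<Rightarrow> int) \<Rightarrow> 'e set \<Rightarrow> 'v set \<Rightarrow> 'e set" where
  "contract_edges a E U = {e \<in> E. (\<Sum>v\<in>U. \<bar>a v e\<bar>) \<le> 1}"

definition contract_coeff ::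
  "('v \<Rightarrow> 'e \<Rightarrow> int) \<Rightarrow> 'v \<Rightarrow> 'e set \<Rightarrow> 'e set \<Rightarrow> 'v \<Rightarrow> 'e \<Rightarrow> int" where
  "contract_coeff a u D F =
     (\<lambda>v e. if v = u then (if e \<in> D then if e \<in> F then -1 else 1 else 0) else a v e)"

abbreviation contraction_point where
  "contraction_point V E a b U u F x \<equiv> ej_point (insert u (V - U)) (contract_edges a E U)
     (contract_coeff a u (odd_cut a E U) F) (b(u := 1 - int (card F))) x"

abbreviation contraction_solution where
  "contraction_solution V E a b U u F J \<equiv> solution (insert u (V - U)) (contract_edges a E U)
     (contract_coeff a u (odd_cut a E U) F) (b(u := 1 - int (card F))) J"

lemma odd_cut_iff_sum_abs:
  assumes "(\<Sum>v\<in>V. \<bar>a v e\<bar>) = (2::int)" "finite V" "U \<subseteq> V"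
  shows "odd (\<Sum>v\<in>U. a v e) \<longleftrightarrow> (\<Sum>v\<in>U. \<bar>a v e\<bar>) = 1"
    and "(\<Sum>v\<in>V - U. \<bar>a v e\<bar>) = 2 - (\<Sum>v\<in>U. \<bar>a v e\<bar>)"
proof -
  have "(\<Sum>v\<in>V. \<bar>a v e\<bar>) = (\<Sum>v\<in>V - U. \<bar>a v e\<bar>) + (\<Sum>v\<in>U. \<bar>a v e\<bar>)"
    using assms sum.subset_diff by blast
  then show eq: "(\<Sum>v\<in>V - U. \<bar>a v e\<bar>) = 2 - (\<Sum>v\<in>U. \<bar>a v e\<bar>)" using assms by simp
  define s where "s = (\<Sum>v\<in>U. \<bar>a v e\<bar>)"
  have "0 \<le> (\<Sum>v\<in>V - U. \<bar>a v e\<bar>)" "0 \<le> s" unfolding s_def by (auto intro: sum_nonneg)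
  then have "0 \<le> s" "s \<le> 2" using eq unfolding s_def by linarith+
  then have "s = 0 \<or> s = 1 \<or> s = 2" by arith
  then have "odd s \<longleftrightarrow> s = 1" by auto
  then show "odd (\<Sum>v\<in>U. a v e) \<longleftrightarrow> (\<Sum>v\<in>U. \<bar>a v e\<bar>) = 1"
    using even_sum_abs[of "\<lambda>v. a v e" U] unfolding s_def by simp
qed

lemma contract_edges_zero:
  assumes P: "ej_point V E a b x" and fr: "fractional E x" and U: "U \<subseteq> V"
    and e: "e \<in> E" "e \<notin> contract_edges a E U" and v: "v \<in> V - U"
  shows "a v e = 0"
proof -
  have fin: "finite V" using P by (simp add: ej_point_def)
  have col: "(\<Sum>v\<in>V. \<bar>a v e\<bar>) = 2"
    using P fr e unfolding ej_point_def fractional_def by (metis less_irrefl)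
  have "\<not> (\<Sum>v\<in>U. \<bar>a v e\<bar>) \<le> 1" using e by (simp add: contract_edges_def)
  then have "(\<Sum>v\<in>V - U. \<bar>a v e\<bar>) \<le> 0"
    using odd_cut_iff_sum_abs(2)[where a = a and e = e, OF col fin U] by linarith
  moreover have "0 \<le> (\<Sum>v\<in>V - U. \<bar>a v e\<bar>)" by (auto intro: sum_nonneg)
  ultimately have "(\<Sum>v\<in>V - U. \<bar>a v e\<bar>) = 0" by linarith
  then have "\<forall>v\<in>V - U. \<bar>a v e\<bar> = 0" using fin by (subst (asm) sum_nonneg_eq_0_iff) auto
  then show ?thesis using v by simp
qed

text \<open>Edges inside \<open>U\<close> survive when \<open>V - U\<close> is contracted and vice
  versa, while the edges of the cut survive in both contractions. The last identity, combined with
  \<open>even (sum b V)\<close>, makes \<open>(U, F)\<close> and \<open>(V - U, F)\<close> odd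
  together.\<close>

lemma contract_edges_cover:
  assumes P: "ej_point V E a b x" and fr: "fractional E x" and U: "U \<subseteq> V"
  shows "contract_edges a E U \<union> contract_edges a E (V - U) = E"
    and "contract_edges a E U \<inter> contract_edges a E (V - U) = odd_cut a E U"
    and "odd_cut a E (V - U) = odd_cut a E U"
    and "int (card F) + sum b (V - U) = int (card F) + sum b V - sum b U"
proof -
  have fin: "finite V" using P by (simp add: ej_point_def)
  note col = fractional_column_sum[OF P fr]
  have 2: "(\<Sum>v\<in>V - U. \<bar>a v e\<bar>) = 2 - (\<Sum>v\<in>U. \<bar>a v e\<bar>)" if "e \<in> E" for e
    using odd_cut_iff_sum_abs(2)[where a = a and e = e, OF col[OF that] fin U] .
  have 1: "odd (\<Sum>v\<in>U. a v e) \<longleftrightarrow> (\<Sum>v\<in>U. \<bar>a v e\<bar>) = 1" if "e \<in> E" for e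
    using odd_cut_iff_sum_abs(1)[where a = a and e = e, OF col[OF that] fin U] .
  have VU: "V - U \<subseteq> V" by auto
  have 3: "odd (\<Sum>v\<in>V - U. a v e) \<longleftrightarrow> (\<Sum>v\<in>V - U. \<bar>a v e\<bar>) = 1" if "e \<in> E" for e
    using odd_cut_iff_sum_abs(1)[where a = a and e = e, OF col[OF that] fin VU] .
  have "e \<in> contract_edges a E U \<or> e \<in> contract_edges a E (V - U)" if "e \<in> E" for e
    using 2[OF that] that by (simp add: contract_edges_def) linarith
  then show "contract_edges a E U \<union> contract_edges a E (V - U) = E"
    by (auto simp: contract_edges_def)
  have "e \<in> contract_edges a E U \<and> e \<in> contract_edges a E (V - U) \<longleftrightarrow> e \<in> odd_cut a E U" if "e \<in> E" for e
    using 2[OF that] 1[OF that] that by (simp add: contract_edges_def odd_cut_def) linarith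
  then show "contract_edges a E U \<inter> contract_edges a E (V - U) = odd_cut a E U"
    by (auto simp: contract_edges_def odd_cut_def)
  have "odd (\<Sum>v\<in>V - U. a v e) \<longleftrightarrow> odd (\<Sum>v\<in>U. a v e)" if "e \<in> E" for e
    using 2[OF that] 1[OF that] 3[OF that] by linarith
  then show "odd_cut a E (V - U) = odd_cut a E U" by (auto simp: odd_cut_def)
  show "int (card F) + sum b (V - U) = int (card F) + sum b V - sum b U"
    using sum.subset_diff[OF U fin, of b] by simp
qed

text \<open>Tightness is the equation of the new vertex. The cut constraints of the contraction are
  among the original ones: a vertex set containing \<open>u\<close> is read with \<open>u\<close>
  replaced by all of \<open>U\<close>.\<close>

lemma contract_ej_point:
  assumes P: "ej_point V E a b x" and fr: "fractional E x"
    and U: "U \<subseteq> V" "u \<in> U"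
    and F: "F \<subseteq> odd_cut a E U" "odd (int (card F) + sum b U)"
    and tight: "deviation x (odd_cut a E U) F = 1"
  shows "contraction_point V E a b U u F x"
proof -
  define D where "D = odd_cut a E U"
  define E1 where "E1 = contract_edges a E U"
  define V1 where "V1 = insert u (V - U)"
  define a1 where "a1 = contract_coeff a u D F"
  define b1 where "b1 = b(u := 1 - int (card F))"
  have fin: "finite V" "finite E" using P by (auto simp: ej_point_def)
  have finU: "finite U" using fin U finite_subset by auto
  note col = fractional_column_sum[OF P fr]
  have D: "e \<in> D \<longleftrightarrow> e \<in> E \<and> (\<Sum>v\<in>U. \<bar>a v e\<bar>) = 1" for e
    using odd_cut_iff_sum_abs(1)[where a = a and e = e, OF _ fin(1) U(1)] col unfolding D_def odd_cut_def by blast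
  have E1: "e \<in> E1 \<longleftrightarrow> e \<in> E \<and> (\<Sum>v\<in>U. \<bar>a v e\<bar>) \<le> 1" for e
    by (auto simp: E1_def contract_edges_def)
  have DE1: "D \<subseteq> E1" using D E1 by auto
  have finE1: "finite E1" "finite D" using fin D E1 by (auto intro: finite_subset[OF _ fin(2)])
  have FD: "F \<subseteq> D" using F D_def by simp
  have finF: "finite F" using FD finE1 finite_subset by auto
  have a1u: "a1 u e = (if e \<in> D then if e \<in> F then -1 else 1 else 0)" for e
    by (simp add: a1_def contract_coeff_def)
  have a1v: "v \<noteq> u \<Longrightarrow> a1 v e = a v e" for v e by (simp add: a1_def contract_coeff_def)
  have a1w: "v \<in> V - U \<Longrightarrow> a1 v e = a v e" for v e using U by (cases "v = u") (simp_all add: a1v)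
  have zero: "a v e = 0" if "e \<in> E - E1" "v \<in> V - U" for v e
    using contract_edges_zero[OF P fr U(1), of e v] that by (simp add: E1_def)
  have col1: "(\<Sum>v\<in>V1. \<bar>a1 v e\<bar>) = 2" if "e \<in> E1" for e
  proof -
    have "0 \<le> (\<Sum>v\<in>U. \<bar>a v e\<bar>)" by (auto intro: sum_nonneg)
    then have sU: "(\<Sum>v\<in>U. \<bar>a v e\<bar>) = (if e \<in> D then 1 else 0)"
      using that D[of e] E1[of e] by (cases "e \<in> D"; simp; arith)
    have "(\<Sum>v\<in>V - U. \<bar>a1 v e\<bar>) = (\<Sum>v\<in>V - U. \<bar>a v e\<bar>)"
      by (rule sum.cong) (simp_all add: a1w)
    moreover have "(\<Sum>v\<in>V1. \<bar>a1 v e\<bar>) = \<bar>a1 u e\<bar> + (\<Sum>v\<in>V - U. \<bar>a1 v e\<bar>)"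
      using fin U by (simp add: V1_def)
    ultimately show ?thesis
      using odd_cut_iff_sum_abs(2)[where a = a and e = e, OF col fin(1) U(1)] that E1[of e] sU
      by (simp add: a1u)
  qed
  have equ: "(\<Sum>e\<in>E1. of_int (a1 u e) * x e) = of_int (b1 u)"
  proof -
    have "(\<Sum>e\<in>E1. of_int (a1 u e) * x e) = (\<Sum>e\<in>D. of_int (a1 u e) * x e)"
      by (rule sum.mono_neutral_right) (use finE1 DE1 in \<open>auto simp: a1u\<close>)
    also have "\<dots> = (\<Sum>e\<in>D. (if e \<in> F then 1 - x e else x e) - (if e \<in> F then 1 else 0))"
      by (rule sum.cong) (auto simp: a1u)
    also have "\<dots> = deviation x D F - (\<Sum>e\<in>D. if e \<in> F then 1 else 0)"
      by (simp add: sum_subtractf deviation_def)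
    also have "(\<Sum>e\<in>D. if e \<in> F then 1 else 0) = real (card F)"
      using finE1 FD by (simp add: sum.If_cases Int_absorb1)
    finally show ?thesis using tight by (simp add: b1_def D_def)
  qed
  have eqv: "(\<Sum>e\<in>E1. of_int (a1 v e) * x e) = of_int (b1 v)" if "v \<in> V - U" for v
  proof -
    have "v \<noteq> u" using that U by auto
    then have "(\<Sum>e\<in>E1. of_int (a1 v e) * x e) = (\<Sum>e\<in>E1. of_int (a v e) * x e)"
      by (simp add: a1v)
    also have "\<dots> = (\<Sum>e\<in>E. of_int (a v e) * x e)"
    proof (rule sum.mono_neutral_left[OF fin(2)])
      show "E1 \<subseteq> E" using E1 by blast
      show "\<forall>e\<in>E - E1. real_of_int (a v e) * x e = 0" using zero that by simp
    qed
    finally show ?thesis using P that \<open>v \<noteq> u\<close> by (simp add: ej_point_def b1_def)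
  qed
  have "1 \<le> deviation x (odd_cut a1 E1 U1) F1"
    if U1: "U1 \<subseteq> V1" and F1: "F1 \<subseteq> odd_cut a1 E1 U1" and odd1: "odd (int (card F1) + sum b1 U1)"
    for U1 F1
  proof -
    define W where "W = U1 - {u}"
    have W: "W \<subseteq> V - U" "finite W" "u \<notin> W" using U1 fin by (auto simp: W_def V1_def intro: finite_subset)
    have par: "even (\<Sum>v\<in>W. a v e)" if "e \<in> E - E1" for e
    proof -
      have "\<forall>v\<in>W. a v e = 0" using zero[OF that] W(1) by blast
      then show ?thesis by (simp add: sum.neutral)
    qed
    have aW: "(\<Sum>v\<in>W. a1 v e) = (\<Sum>v\<in>W. a v e)" for e
      by (rule sum.cong) (use W a1w in auto)
    have bW: "sum b1 W = sum b W"
      by (rule sum.cong) (use W in \<open>auto simp: b1_def\<close>)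
    define U' where "U' = (if u \<in> U1 then W \<union> U else W)"
    have U': "U' \<subseteq> V" using W U by (auto simp: U'_def)
    have cut_eq: "odd_cut a1 E1 U1 = odd_cut a E U'"
    proof (cases "u \<in> U1")
      case False
      then have "U1 = W" "U' = W" by (auto simp: W_def U'_def)
      then show ?thesis using par E1 by (auto simp: odd_cut_def aW)
    next
      case True
      have s1: "(\<Sum>v\<in>U1. a1 v e) = a1 u e + (\<Sum>v\<in>W. a v e)" for e
        using True W aW by (metis W_def finite_insert insert_Diff sum.remove insertI1)
      have s2: "(\<Sum>v\<in>U'. a v e) = (\<Sum>v\<in>W. a v e) + (\<Sum>v\<in>U. a v e)" for e
        using W U finU True by (auto simp: U'_def intro!: sum.union_disjoint)
      have pD: "odd (\<Sum>v\<in>U. a v e) \<longleftrightarrow> e \<in> D" if "e \<in> E" for e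
        using that by (simp add: D_def odd_cut_def)
      have p1: "odd (a1 u e) \<longleftrightarrow> e \<in> D" for e by (simp add: a1u)
      show ?thesis
      proof (rule set_eqI)
        fix e
        show "e \<in> odd_cut a1 E1 U1 \<longleftrightarrow> e \<in> odd_cut a E U'"
        proof (cases "e \<in> E1")
          case True
          then show ?thesis using pD[of e] p1[of e] E1 by (auto simp: odd_cut_def s1 s2)
        next
          case False
          then show ?thesis using pD[of e] par[of e] DE1 by (auto simp: odd_cut_def s2)
        qed
      qed
    qed
    have "even (sum b1 U1 - sum b U')"
    proof (cases "u \<in> U1")
      case False
      then have "U1 = W" "U' = W" by (auto simp: W_def U'_def)
      then show ?thesis using bW by simp
    next
      case True
      have "sum b1 U1 = b1 u + sum b W"
        using True W bW by (metis W_def finite_insert insert_Diff sum.remove insertI1)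
      moreover have "sum b U' = sum b W + sum b U"
        using W U finU True by (auto simp: U'_def intro!: sum.union_disjoint)
      \<comment> \<open>Because \<open>(U, F)\<close> is odd, \<open>1 - card F\<close> has the
        parity of \<open>sum b U\<close>, so the right-hand sides agree modulo 2.\<close>
      ultimately show ?thesis using F(2) by (simp add: b1_def)
    qed
    then have "odd (int (card F1) + sum b U')" using odd1 by auto
    then show ?thesis
      using P U' F1 unfolding cut_eq ej_point_def cut_constraints_def by blast
  qed
  then have "ej_point V1 E1 a1 b1 x"
    using P fin finE1 col1 equ eqv E1 unfolding ej_point_def cut_constraints_def
    by (auto simp: V1_def a1_def contract_coeff_def)
  then show ?thesis unfolding V1_def E1_def a1_def b1_def D_def .
qed

text \<open>For a 0/1 vector the equation of \<open>u\<close> counts the cut edges on which it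
  disagrees with \<open>F\<close>, and this number is 1.\<close>

lemma contract_solution:
  assumes "finite E" "F \<subseteq> odd_cut a E U" "u \<in> U"
    and J: "contraction_solution V E a b U u F J"
  shows "\<exists>e0\<in>odd_cut a E U. J \<inter> odd_cut a E U = (if e0 \<in> F then F - {e0} else insert e0 F)"
    and "v \<in> V - U \<Longrightarrow> (\<Sum>e\<in>J. a v e) = b v"
proof -
  define D where "D = odd_cut a E U"
  have fin: "finite D" "finite F" "finite J"
  proof -
    show "finite D" using assms(1) by (simp add: D_def odd_cut_def)
    then show "finite F" using assms(2) finite_subset unfolding D_def by blast
    have "J \<subseteq> E" using J by (auto simp: solution_def contract_edges_def)
    then show "finite J" using assms(1) finite_subset by blast
  qed
  have "1 - int (card F) = (\<Sum>e\<in>J. if e \<in> D then if e \<in> F then -1 else 1 else 0)"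
    using J by (simp add: solution_def contract_coeff_def D_def)
  also have "\<dots> = (\<Sum>e\<in>J \<inter> D. if e \<in> F then -1 else 1)"
    using fin by (simp add: sum.inter_restrict)
  also have "\<dots> = int (card (J \<inter> D - F)) - int (card (J \<inter> D \<inter> F))"
    using fin by (simp add: sum.If_cases Diff_eq)
  also have "J \<inter> D \<inter> F = F - (F - J)" using assms D_def by auto
  also have "int (card (F - (F - J))) = int (card F) - int (card (F - J))"
    using fin by (subst card_Diff_subset) (auto simp: card_mono of_nat_diff)
  finally have "card (J \<inter> D - F) + card (F - J) = 1" by simp
  also have "card (J \<inter> D - F) + card (F - J) = card ((J \<inter> D - F) \<union> (F - J))"
    using fin by (subst card_Un_disjoint) auto
  finally obtain e0 where e0: "(J \<inter> D - F) \<union> (F - J) = {e0}" using card_1_singletonE by blast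
  have FD: "F \<subseteq> D" using assms D_def by auto
  have pt: "(z \<in> J \<and> z \<in> D \<and> z \<notin> F) \<or> (z \<in> F \<and> z \<notin> J) \<longleftrightarrow> z = e0" for z
    using arg_cong[OF e0, of "\<lambda>S. z \<in> S"] by simp
  have "e0 \<in> D" using e0 FD by blast
  moreover have "J \<inter> D = (if e0 \<in> F then F - {e0} else insert e0 F)"
  proof (cases "e0 \<in> F")
    case True
    have "z \<in> J \<inter> D \<longleftrightarrow> z \<in> F - {e0}" for z
      using pt[of z] FD True by (cases "z = e0") auto
    then have "J \<inter> D = F - {e0}" by (rule set_eqI)
    then show ?thesis using True by simp
  next
    case False
    have "z \<in> J \<inter> D \<longleftrightarrow> z \<in> insert e0 F" for z
      using pt[of z] FD False by (cases "z = e0") auto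
    then have "J \<inter> D = insert e0 F" by (rule set_eqI)
    then show ?thesis using False by simp
  qed
  ultimately show "\<exists>e0\<in>odd_cut a E U. J \<inter> odd_cut a E U = (if e0 \<in> F then F - {e0} else insert e0 F)"
    unfolding D_def by blast
  show "(\<Sum>e\<in>J. a v e) = b v" if "v \<in> V - U"
  proof -
    have "v \<noteq> u" using that assms by auto
    moreover have "(\<Sum>e\<in>J. contract_coeff a u (odd_cut a E U) F v e) = (b(u := 1 - int (card F))) v"
      using J that by (auto simp: solution_def)
    ultimately show ?thesis by (simp add: contract_coeff_def)
  qed
qed

text \<open>
  Each edge of the cut is charged with the least cost of completing it on the second side, which
  reduces the rounding to the first side.
\<close>

lemma glue_solutions:
  fixes c :: "'e \<Rightarrow> real"
  assumes P: "ej_point V E a b x" and fr: "fractional E x"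
    and U: "U \<subseteq> V" "u \<in> U" "w \<in> V - U"
    and F: "F \<subseteq> odd_cut a E U"
    and sol1: "\<And>c::'e \<Rightarrow> real. \<exists>J. contraction_solution V E a b U u F J \<and>
         sum c J \<le> (\<Sum>e\<in>contract_edges a E U. c e * x e)"
    and sol2: "\<And>c::'e \<Rightarrow> real. \<exists>J. contraction_solution V E a b (V - U) w F J \<and>
         sum c J \<le> (\<Sum>e\<in>contract_edges a E (V - U). c e * x e)"
  shows "\<exists>J. solution V E a b J \<and> sum c J \<le> (\<Sum>e\<in>E. c e * x e)"
proof -
  define D where "D = odd_cut a E U"
  define E1 where "E1 = contract_edges a E U"
  define E2 where "E2 = contract_edges a E (V - U)"
  note cov = contract_edges_cover[OF P fr U(1)]
  have D2: "odd_cut a E (V - U) = D" using cov by (simp add: D_def)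
  have fin: "finite V" "finite E" using P by (auto simp: ej_point_def)
  have EE: "E1 \<union> E2 = E" "E1 \<inter> E2 = D" using cov by (auto simp: D_def E1_def E2_def)
  have finE: "finite E1" "finite E2" "finite D" using fin EE(1) unfolding EE(2)[symmetric]
    by (metis finite_Un, metis finite_Un, metis finite_Int finite_Un)
  have FD: "F \<subseteq> D" using F by (simp add: D_def)
  have finF: "finite F" using FD finE finite_subset by blast
  define S1 where "S1 = {J. solution (insert u (V - U)) E1
           (contract_coeff a u D F) (b(u := 1 - int (card F))) J}"
  define S2 where "S2 = {J. solution (insert w (V - (V - U))) E2
           (contract_coeff a w D F) (b(w := 1 - int (card F))) J}"
  \<comment> \<open>The trace on the cut that disagrees with \<open>F\<close> exactly at
    \<open>e0\<close>; by \<open>contract_solution\<close> no other traces occur.\<close>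
  define X where "X = (\<lambda>e0. if e0 \<in> F then F - {e0} else insert e0 F)"
  have S1: "J \<subseteq> E1" "\<exists>e0\<in>D. J \<inter> D = X e0" "\<And>v. v \<in> V - U \<Longrightarrow> (\<Sum>e\<in>J. a v e) = b v" if "J \<in> S1" for J
  proof -
    have z: "contraction_solution V E a b U u F J"
      using that by (simp add: S1_def E1_def D_def)
    show "J \<subseteq> E1" using z by (simp add: solution_def E1_def)
    show "\<exists>e0\<in>D. J \<inter> D = X e0" using contract_solution(1)[OF fin(2) F U(2) z] by (simp add: D_def X_def)
    show "\<And>v. v \<in> V - U \<Longrightarrow> (\<Sum>e\<in>J. a v e) = b v" using contract_solution(2)[OF fin(2) F U(2) z] by blast
  qed
  have S2: "J \<subseteq> E2" "\<exists>e0\<in>D. J \<inter> D = X e0" "\<And>v. v \<in> U \<Longrightarrow> (\<Sum>e\<in>J. a v e) = b v" if "J \<in> S2" for J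
  proof -
    have z: "contraction_solution V E a b (V - U) w F J"
      using that by (simp add: S2_def E2_def D2)
    have F2: "F \<subseteq> odd_cut a E (V - U)" using FD D2 by simp
    show "J \<subseteq> E2" using z by (simp add: solution_def E2_def)
    show "\<exists>e0\<in>D. J \<inter> D = X e0" using contract_solution(1)[OF fin(2) F2 U(3) z] by (simp add: D2 X_def)
    show "\<And>v. v \<in> U \<Longrightarrow> (\<Sum>e\<in>J. a v e) = b v"
      using contract_solution(2)[OF fin(2) F2 U(3) z] U(1) by blast
  qed
  have min1: "\<exists>J\<in>S1. sum c J \<le> (\<Sum>e\<in>E1. c e * x e)" for c :: "'e \<Rightarrow> real"
    using sol1[of c] by (auto simp: S1_def E1_def D_def)
  have min2: "\<exists>J\<in>S2. sum c J \<le> (\<Sum>e\<in>E2. c e * x e)" for c :: "'e \<Rightarrow> real"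
    using sol2[of c] by (auto simp: S2_def E2_def D2)
  have "S2 \<subseteq> Pow E2" using S2(1) by blast
  then have finS2: "finite S2" using finE finite_subset by blast
  \<comment> \<open>Every trace occurs on the second side: with a cost supported on
    \<open>e0\<close> alone, \<open>0 < x e0 < 1\<close> forces a rounding of no larger cost to
    disagree with \<open>F\<close> at \<open>e0\<close>.\<close>
  have ex2: "\<exists>J\<in>S2. J \<inter> D = X e0" if e0: "e0 \<in> D" for e0
  proof -
    define s where "s = (if e0 \<in> F then 1 else -1 :: real)"
    obtain J where J: "J \<in> S2" "(\<Sum>e\<in>J. if e = e0 then s else 0) \<le> (\<Sum>e\<in>E2. (if e = e0 then s else 0) * x e)"
      using min2 by blast
    have "finite J" using S2(1)[OF J(1)] finE finite_subset by blast
    then have l: "(\<Sum>e\<in>J. if e = e0 then s else 0) = (if e0 \<in> J then s else 0)" by simp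
    have "(\<Sum>e\<in>E2. (if e = e0 then s else 0) * x e) = (\<Sum>e\<in>E2. (if e = e0 then s * x e else 0))"
      by (rule sum.cong) auto
    also have "\<dots> = s * x e0" using finE e0 EE by auto
    finally have "(if e0 \<in> J then s else 0) \<le> s * x e0" using J(2) l by simp
    moreover have "0 < x e0" "x e0 < 1" using fr e0 EE by (auto simp: fractional_def)
    ultimately have "e0 \<in> J \<longleftrightarrow> e0 \<notin> F" by (auto simp: s_def split: if_splits)
    moreover obtain e1 where e1: "e1 \<in> D" "J \<inter> D = X e1" using S2(2)[OF J(1)] by blast
    ultimately have "e1 = e0" using e0 by (auto simp: X_def split: if_splits)
    then show ?thesis using J(1) e1(2) by blast
  qed
  \<comment> \<open>Its minimum \<open>m e0\<close> is the least cost, outside the cut, of a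
    second-side solution with trace \<open>X e0\<close>.\<close>
  define A where "A = (\<lambda>e0. (\<lambda>J. sum c (J - D)) ` {J \<in> S2. J \<inter> D = X e0})"
  define m where "m = (\<lambda>e0. Min (A e0))"
  have finA: "finite (A e0)" for e0 using finS2 by (simp add: A_def)
  have m_le: "m e0 \<le> sum c (J - D)" if "J \<in> S2" "J \<inter> D = X e0" for J e0
    unfolding m_def by (rule Min_le[OF finA]) (use that in \<open>auto simp: A_def\<close>)
  have m_ex: "\<exists>J\<in>S2. J \<inter> D = X e0 \<and> sum c (J - D) = m e0" if "e0 \<in> D" for e0
  proof -
    have "A e0 \<noteq> {}" using ex2[OF that] by (auto simp: A_def)
    then have "m e0 \<in> A e0" unfolding m_def by (rule Min_in[OF finA])
    then obtain J where "J \<in> {J \<in> S2. J \<inter> D = X e0}" "m e0 = sum c (J - D)"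
      unfolding A_def by (elim imageE)
    then show ?thesis by (intro bexI[of _ J]) simp_all
  qed
  define sg where "sg = (\<lambda>e. if e \<in> F then -1 else 1 :: real)"
  define K where "K = sum m F"
  \<comment> \<open>\<open>F\<close> and \<open>X e0\<close> differ only in \<open>e0\<close>, so
    the linear cost \<open>sg e * m e\<close> of the trace is \<open>m e0\<close> up to the constant
    \<open>K\<close>: the completion cost is linear on traces.\<close>
  have sum_X: "(\<Sum>e\<in>X e0. sg e * m e) = m e0 - K" if "e0 \<in> D" for e0
  proof (cases "e0 \<in> F")
    case True
    have "(\<Sum>e\<in>X e0. sg e * m e) = (\<Sum>e\<in>F - {e0}. - m e)"
      using True by (intro sum.cong) (auto simp: X_def sg_def)
    then show ?thesis using True finF by (simp add: sum_negf sum_diff1 K_def)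
  next
    case False
    have "(\<Sum>e\<in>X e0. sg e * m e) = m e0 + (\<Sum>e\<in>F. sg e * m e)"
      using False finF by (simp add: X_def sg_def)
    also have "(\<Sum>e\<in>F. sg e * m e) = (\<Sum>e\<in>F. - m e)" by (rule sum.cong) (auto simp: sg_def)
    finally show ?thesis by (simp add: sum_negf K_def)
  qed
  have split: "(\<Sum>e\<in>A. f e) = (\<Sum>e\<in>A - D. f e) + (\<Sum>e\<in>A \<inter> D. f e)" if "finite A" for A and f :: "'e \<Rightarrow> real"
    using that by (metis Int_Diff_Un Int_Diff_disjoint add.commute finite_Diff finite_Int sum.union_disjoint)
  \<comment> \<open>With costs \<open>- (sg e * m e)\<close> on the cut every second-side solution
    costs at least \<open>K\<close>; rounding \<open>x\<close> with these costs carries the bound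
    over to \<open>x\<close>.\<close>
  have "K + (\<Sum>e\<in>D. sg e * m e * x e) \<le> (\<Sum>e\<in>E2 - D. c e * x e)"
  proof -
    define c2 where "c2 = (\<lambda>e. if e \<in> D then - (sg e * m e) else c e)"
    obtain J where J: "J \<in> S2" "sum c2 J \<le> (\<Sum>e\<in>E2. c2 e * x e)" using min2 by blast
    obtain e0 where e0: "e0 \<in> D" "J \<inter> D = X e0" using S2(2)[OF J(1)] by blast
    have finJ: "finite J" using S2(1)[OF J(1)] finE finite_subset by blast
    have "sum c2 J = sum c2 (J - D) + sum c2 (J \<inter> D)" by (rule split[OF finJ])
    also have "sum c2 (J - D) = sum c (J - D)" by (rule sum.cong) (auto simp: c2_def)
    also have "sum c2 (J \<inter> D) = - (\<Sum>e\<in>J \<inter> D. sg e * m e)"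
      unfolding sum_negf[symmetric] by (rule sum.cong) (auto simp: c2_def)
    also have "\<dots> = K - m e0" unfolding e0(2) sum_X[OF e0(1)] by simp
    finally have l: "sum c2 J = sum c (J - D) + (K - m e0)" .
    have "(\<Sum>e\<in>E2. c2 e * x e) = (\<Sum>e\<in>E2 - D. c2 e * x e) + (\<Sum>e\<in>E2 \<inter> D. c2 e * x e)"
      by (rule split[OF finE(2)])
    also have "(\<Sum>e\<in>E2 - D. c2 e * x e) = (\<Sum>e\<in>E2 - D. c e * x e)"
      by (rule sum.cong) (auto simp: c2_def)
    also have "E2 \<inter> D = D" using EE by auto
    also have "(\<Sum>e\<in>D. c2 e * x e) = - (\<Sum>e\<in>D. sg e * m e * x e)"
      unfolding sum_negf[symmetric] by (rule sum.cong) (auto simp: c2_def)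
    finally show ?thesis using J(2) l m_le[OF J(1) e0(2)] by linarith
  qed
  moreover
  define c1 where "c1 = (\<lambda>e. if e \<in> D then c e + sg e * m e else c e)"
  obtain J1 where J1: "J1 \<in> S1" "sum c1 J1 \<le> (\<Sum>e\<in>E1. c1 e * x e)" using min1 by blast
  obtain e0 where e0: "e0 \<in> D" "J1 \<inter> D = X e0" using S1(2)[OF J1(1)] by blast
  have finJ1: "finite J1" using S1(1)[OF J1(1)] finE finite_subset by blast
  have "sum c1 J1 = sum c J1 + m e0 - K"
  proof -
    have "sum c1 J1 = sum c1 (J1 - D) + sum c1 (J1 \<inter> D)" by (rule split[OF finJ1])
    also have "sum c1 (J1 - D) = sum c (J1 - D)" by (rule sum.cong) (auto simp: c1_def)
    also have "sum c1 (J1 \<inter> D) = sum c (J1 \<inter> D) + (\<Sum>e\<in>J1 \<inter> D. sg e * m e)"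
      unfolding sum.distrib[symmetric] by (rule sum.cong) (auto simp: c1_def)
    also have "(\<Sum>e\<in>J1 \<inter> D. sg e * m e) = m e0 - K" unfolding e0(2) sum_X[OF e0(1)] by simp
    finally show ?thesis using split[OF finJ1, of c] by linarith
  qed
  moreover have "(\<Sum>e\<in>E1. c1 e * x e) = (\<Sum>e\<in>E1. c e * x e) + (\<Sum>e\<in>D. sg e * m e * x e)"
  proof -
    have "(\<Sum>e\<in>E1. c1 e * x e) = (\<Sum>e\<in>E1. c e * x e + (if e \<in> D then sg e * m e * x e else 0))"
      by (rule sum.cong) (auto simp: c1_def algebra_simps)
    also have "\<dots> = (\<Sum>e\<in>E1. c e * x e) + (\<Sum>e\<in>E1 \<inter> D. sg e * m e * x e)"
      using finE by (simp add: sum.distrib sum.inter_restrict)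
    also have "E1 \<inter> D = D" using EE by auto
    finally show ?thesis .
  qed
  moreover have "(\<Sum>e\<in>E. c e * x e) = (\<Sum>e\<in>E1. c e * x e) + (\<Sum>e\<in>E2 - D. c e * x e)"
  proof -
    have "E = E1 \<union> (E2 - D)" "E1 \<inter> (E2 - D) = {}" using EE by auto
    then show ?thesis using finE by (simp add: sum.union_disjoint)
  qed
  ultimately have le: "sum c J1 + m e0 \<le> (\<Sum>e\<in>E. c e * x e)" using J1(2) by linarith
  obtain J2 where J2: "J2 \<in> S2" "J2 \<inter> D = X e0" "sum c (J2 - D) = m e0" using m_ex[OF e0(1)] by blast
  have finJ2: "finite J2" using S2(1)[OF J2(1)] finE finite_subset by blast
  have same: "J1 \<inter> D = J2 \<inter> D" using e0 J2 by simp
  define J where "J = J1 \<union> J2"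
  have J_eq: "J = J1 \<union> (J2 - D)" "J = J2 \<union> (J1 - D)" using same by (auto simp: J_def)
  have disj: "J1 \<inter> (J2 - D) = {}" "J2 \<inter> (J1 - D) = {}"
    using S1(1)[OF J1(1)] S2(1)[OF J2(1)] EE by auto
  have "sum c J = sum c J1 + sum c (J2 - D)"
    unfolding J_eq(1) using finJ1 finJ2 disj by (simp add: sum.union_disjoint)
  then have "sum c J \<le> (\<Sum>e\<in>E. c e * x e)" using le J2(3) by simp
  moreover have "solution V E a b J"
    unfolding solution_def
  proof (intro conjI ballI)
    show "J \<subseteq> E" using S1(1)[OF J1(1)] S2(1)[OF J2(1)] EE by (auto simp: J_def)
    show "(\<Sum>e\<in>J. a v e) = b v" if "v \<in> V" for v
    proof (cases "v \<in> U")
      case False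
      have "(\<Sum>e\<in>J. a v e) = (\<Sum>e\<in>J1. a v e) + (\<Sum>e\<in>J2 - D. a v e)"
        unfolding J_eq(1) using finJ1 finJ2 disj by (simp add: sum.union_disjoint)
      also have "(\<Sum>e\<in>J2 - D. a v e) = 0"
      proof (intro sum.neutral ballI)
        fix e assume "e \<in> J2 - D"
        then have "e \<in> E" "e \<notin> contract_edges a E U"
          using S2(1)[OF J2(1)] EE by (auto simp: E1_def[symmetric])
        then show "a v e = 0" using contract_edges_zero[OF P fr U(1)] that False by blast
      qed
      finally show ?thesis using S1(3)[OF J1(1)] that False by simp
    next
      case True
      have "(\<Sum>e\<in>J. a v e) = (\<Sum>e\<in>J2. a v e) + (\<Sum>e\<in>J1 - D. a v e)"
        unfolding J_eq(2) using finJ1 finJ2 disj by (simp add: sum.union_disjoint)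
      also have "(\<Sum>e\<in>J1 - D. a v e) = 0"
      proof (intro sum.neutral ballI)
        fix e assume "e \<in> J1 - D"
        then have "e \<in> E" "e \<notin> contract_edges a E (V - U)"
          using S1(1)[OF J1(1)] EE by (auto simp: E2_def[symmetric])
        moreover have "V - U \<subseteq> V" by auto
        ultimately show "a v e = 0" using contract_edges_zero[OF P fr, of "V - U" e v] True U(1) by blast
      qed
      finally show ?thesis using S2(3)[OF J2(1)] True by simp
    qed
  qed
  ultimately show ?thesis by blast
qed

section \<open>Kernel directions and motion to a bound or a tight cut\<close>

lemma integer_nonneg_sum_eq_1:
  fixes s t :: real
  assumes "s + t = 1" "0 \<le> s" "0 \<le> t" "s \<in> \<int>"
  shows "s = 0 \<or> t = 0"
proof -
  obtain k where k: "s = of_int k" using assms(4) by (auto elim: Ints_cases)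
  have "0 \<le> k" "k \<le> 1" using assms k by linarith+
  then have "k = 0 \<or> k = 1" by arith
  then show ?thesis using k assms(1) by auto
qed

text \<open>
  For fractional \<open>x\<close>, a tight cut of a single vertex is its equation up to sign: splitting the
  deviation according to the signs of the equation gives two integers with sum 1.
\<close>

lemma tight_vertex_cut:
  fixes d :: "'e \<Rightarrow> real"
  assumes P: "ej_point V E a b x" and fr: "fractional E x" and v: "v \<in> V"
    and F: "F \<subseteq> odd_cut a E {v}" "odd (int (card F) + b v)"
    and tight: "deviation x (odd_cut a E {v}) F = 1"
    and d: "(\<Sum>e\<in>E. of_int (a v e) * d e) = 0"
  shows "(\<Sum>e\<in>odd_cut a E {v}. if e \<in> F then - d e else d e) = 0"
proof -
  define D where "D = odd_cut a E {v}"
  define p where "p = (\<lambda>e. if e \<in> F then 1 - x e else x e)"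
  define sg where "sg = (\<lambda>e. if e \<in> F then -1 else 1 :: int)"
  have fin: "finite E" using P by (simp add: ej_point_def)
  have a1: "\<bar>a v e\<bar> \<le> 1" for e using P by (simp add: ej_point_def)
  have ac: "a v e = -1 \<or> a v e = 0 \<or> a v e = 1" for e using a1[of e] abs_le_1_int by blast
  have D: "e \<in> D \<longleftrightarrow> e \<in> E \<and> a v e \<noteq> 0" for e using ac[of e] by (auto simp: D_def odd_cut_def)
  have finD: "finite D" using fin D by (metis finite_subset subsetI)
  have p_pos: "0 < p e" if "e \<in> D" for e using fr that D by (auto simp: p_def fractional_def)
  define A where "A = {e \<in> D. a v e = sg e}"
  define B where "B = {e \<in> D. a v e = - sg e}"
  have AB: "D = A \<union> B" "A \<inter> B = {}" using ac D by (auto simp: A_def B_def sg_def)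
  have finAB: "finite A" "finite B" using finD by (auto simp: A_def B_def)
  have sum_AB: "sum f D = sum f A + sum f B" for f :: "'e \<Rightarrow> real"
    using AB finAB by (simp add: sum.union_disjoint)
  have sAB: "(\<Sum>e\<in>E. of_int (a v e) * y e) = (\<Sum>e\<in>A. of_int (sg e) * y e) - (\<Sum>e\<in>B. of_int (sg e) * y e)"
    for y :: "'e \<Rightarrow> real"
  proof -
    have "(\<Sum>e\<in>E. of_int (a v e) * y e) = (\<Sum>e\<in>D. of_int (a v e) * y e)"
      by (rule sum.mono_neutral_right) (use fin D in auto)
    also have "\<dots> = (\<Sum>e\<in>A. of_int (a v e) * y e) + (\<Sum>e\<in>B. of_int (a v e) * y e)" by (rule sum_AB)
    also have "(\<Sum>e\<in>A. of_int (a v e) * y e) = (\<Sum>e\<in>A. of_int (sg e) * y e)"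
      by (rule sum.cong) (auto simp: A_def)
    also have "(\<Sum>e\<in>B. of_int (a v e) * y e) = - (\<Sum>e\<in>B. of_int (sg e) * y e)"
      unfolding sum_negf[symmetric] by (rule sum.cong) (auto simp: B_def)
    finally show ?thesis by simp
  qed
  have pS: "sum p S = (\<Sum>e\<in>S. of_int (sg e) * x e) + real (card (S \<inter> F))" if "finite S" for S
  proof -
    have "sum p S = (\<Sum>e\<in>S. of_int (sg e) * x e + (if e \<in> F then 1 else 0))"
      by (rule sum.cong) (auto simp: p_def sg_def)
    then show ?thesis using that by (simp add: sum.distrib sum.If_cases)
  qed
  have p1: "sum p D = 1" using tight by (simp add: deviation_def p_def D_def)
  have "D \<inter> F = F" using F D_def by auto
  then have "(\<Sum>e\<in>D. of_int (sg e) * x e) = 1 - real (card F)" using pS[OF finD] p1 by simp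
  moreover have "of_int (b v) = (\<Sum>e\<in>A. of_int (sg e) * x e) - (\<Sum>e\<in>B. of_int (sg e) * x e)"
    using P v sAB[of x] by (simp add: ej_point_def)
  ultimately have "2 * (\<Sum>e\<in>A. of_int (sg e) * x e) = of_int (1 - int (card F) + b v)"
    using sum_AB[of "\<lambda>e. of_int (sg e) * x e"] by simp
  moreover have "even (1 - int (card F) + b v)" using F(2) by simp
  then obtain k where "1 - int (card F) + b v = 2 * k" by (rule evenE)
  ultimately have "(\<Sum>e\<in>A. of_int (sg e) * x e) = of_int k" by simp
  then have "sum p A \<in> \<int>" using pS[OF finAB(1)] by simp
  moreover have "0 \<le> sum p A" "0 \<le> sum p B" using p_pos AB(1) by (auto intro!: sum_nonneg simp: less_imp_le)
  ultimately have "sum p A = 0 \<or> sum p B = 0"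
    using integer_nonneg_sum_eq_1[of "sum p A" "sum p B"] sum_AB[of p] p1 by simp
  \<comment> \<open>Fractional values make every term positive, so a class of deviation 0 is
    empty.\<close>
  moreover have "sum p S \<noteq> 0" if "S \<noteq> {}" "S \<subseteq> D" for S
  proof -
    have "0 < sum p S" using p_pos that finite_subset[OF that(2) finD] by (intro sum_pos) auto
    then show ?thesis by simp
  qed
  ultimately have "A = {} \<or> B = {}" using AB(1) by blast
  moreover have "(\<Sum>e\<in>A. of_int (sg e) * d e) - (\<Sum>e\<in>B. of_int (sg e) * d e) = 0"
    using d sAB[of d] by simp
  ultimately have "(\<Sum>e\<in>D. of_int (sg e) * d e) = 0"
    using sum_AB[of "\<lambda>e. of_int (sg e) * d e"] by auto
  moreover have "(\<Sum>e\<in>D. if e \<in> F then - d e else d e) = (\<Sum>e\<in>D. of_int (sg e) * d e)"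
    by (rule sum.cong) (auto simp: sg_def)
  ultimately show ?thesis by (simp add: D_def)
qed

text \<open>Two vertices on each side make both contractions strictly smaller than the system
  itself.\<close>

definition tight_cut ::
  "'v set \<Rightarrow> 'e set \<Rightarrow> ('v \<Rightarrow> 'e \<Rightarrow> int) \<Rightarrow> ('v \<Rightarrow> int) \<Rightarrow> ('e \<Rightarrow> real) \<Rightarrow> 'v set \<Rightarrow> 'e set \<Rightarrow> bool" where
  "tight_cut V E a b x U F \<longleftrightarrow> U \<subseteq> V \<and> F \<subseteq> odd_cut a E U \<and> odd (int (card F) + sum b U) \<and>
     deviation x (odd_cut a E U) F = 1 \<and> 2 \<le> card U \<and> 2 \<le> card (V - U)"

text \<open>The constraint that stops the motion has a negative rate along \<open>d\<close>. Cuts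
  with an empty side have rate 0, and so do tight cuts with a single vertex on one side: there the
  cut function is a vertex equation up to sign, which \<open>d\<close> annihilates. Only bounds and
  nontrivial cuts remain.\<close>

lemma move_to_tight_cut:
  fixes c d :: "'e \<Rightarrow> real"
  assumes P: "ej_point V E a b x" and fr: "fractional E x"
    and d: "\<exists>e\<in>E. d e \<noteq> 0" "\<forall>v\<in>V. (\<Sum>e\<in>E. of_int (a v e) * d e) = 0"
    and cd: "(\<Sum>e\<in>E. c e * d e) \<le> 0"
  shows "\<exists>x'. ej_point V E a b x' \<and> (\<Sum>e\<in>E. c e * x' e) \<le> (\<Sum>e\<in>E. c e * x e) \<and>
           (\<not> fractional E x' \<or> (\<exists>U F. tight_cut V E a b x' U F))"
proof -
  have fin: "finite V" "finite E" using P by (auto simp: ej_point_def)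
  define dd where "dd = (\<lambda>U F. \<Sum>e\<in>odd_cut a E U. if e \<in> F then - d e else d e)"
  define K where "K = {(U, F). U \<subseteq> V \<and> F \<subseteq> odd_cut a E U \<and> odd (int (card F) + sum b U)}"
  define I where "I = (\<lambda>e. (x e, d e)) ` E \<union> (\<lambda>e. (1 - x e, - d e)) ` E \<union>
      (\<lambda>(U, F). (deviation x (odd_cut a E U) F - 1, dd U F)) ` K"
  have "K \<subseteq> Pow V \<times> Pow E" using odd_cut_subset by (fastforce simp: K_def)
  then have "finite K" using fin by (meson finite_Pow_iff finite_SigmaI finite_subset)
  then have 1: "finite I" using fin by (simp add: I_def)
  have 2: "\<forall>i\<in>I. 0 \<le> fst i"
    using P by (auto simp: I_def K_def ej_point_def cut_constraints_def)
  \<comment> \<open>An edge with \<open>d e \<noteq> 0\<close> approaches one of its two bounds, so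
    the motion must end.\<close>
  have 3: "\<exists>i\<in>I. snd i < 0"
  proof -
    obtain e where e: "e \<in> E" "d e \<noteq> 0" using d(1) by blast
    then have "(x e, d e) \<in> I" "(1 - x e, - d e) \<in> I" by (auto simp: I_def)
    then show ?thesis using e(2) by (cases "d e < 0") force+
  qed
  obtain t where t: "t \<ge> 0" "\<forall>i\<in>I. 0 \<le> fst i + t * snd i" "\<exists>i\<in>I. snd i < 0 \<and> fst i + t * snd i = 0"
    using move_until_tight[OF 1 2 3] by blast
  define x' where "x' = (\<lambda>e. x e + t * d e)"
  have bnd: "0 \<le> x' e" "x' e \<le> 1" if "e \<in> E" for e
  proof -
    have "(x e, d e) \<in> I" "(1 - x e, - d e) \<in> I" using that by (auto simp: I_def)
    then show "0 \<le> x' e" "x' e \<le> 1" using t(2) by (auto simp: x'_def)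
  qed
  have dev: "deviation x' (odd_cut a E U) F = deviation x (odd_cut a E U) F + t * dd U F" for U F
    unfolding deviation_def dd_def sum_distrib_left sum.distrib[symmetric]
    by (rule sum.cong) (auto simp: x'_def algebra_simps)
  have cuts: "1 \<le> deviation x' (odd_cut a E U) F" if "(U, F) \<in> K" for U F
  proof -
    have "(deviation x (odd_cut a E U) F - 1, dd U F) \<in> I" using that by (force simp: I_def)
    then show ?thesis using t(2) dev by fastforce
  qed
  have eqs: "(\<Sum>e\<in>E. of_int (a v e) * x' e) = of_int (b v)" if "v \<in> V" for v
  proof -
    have "(\<Sum>e\<in>E. of_int (a v e) * x' e) = (\<Sum>e\<in>E. of_int (a v e) * x e) + t * (\<Sum>e\<in>E. of_int (a v e) * d e)"
      unfolding sum_distrib_left sum.distrib[symmetric]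
      by (rule sum.cong) (auto simp: x'_def algebra_simps)
    then show ?thesis using P d(2) that by (simp add: ej_point_def)
  qed
  note col = fractional_column_sum[OF P fr]
  have P': "ej_point V E a b x'"
    using P bnd cuts eqs col unfolding ej_point_def cut_constraints_def K_def by auto
  have cost: "(\<Sum>e\<in>E. c e * x' e) \<le> (\<Sum>e\<in>E. c e * x e)"
  proof -
    have "(\<Sum>e\<in>E. c e * x' e) = (\<Sum>e\<in>E. c e * x e) + t * (\<Sum>e\<in>E. c e * d e)"
      unfolding sum_distrib_left sum.distrib[symmetric]
      by (rule sum.cong) (auto simp: x'_def algebra_simps)
    then show ?thesis using cd t(1) by (simp add: mult_nonneg_nonpos)
  qed
  have "\<exists>U F. tight_cut V E a b x' U F" if fr': "fractional E x'"
  proof -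
    obtain i where i: "i \<in> I" "snd i < 0" "fst i + t * snd i = 0" using t(3) by blast
    have "i \<notin> (\<lambda>e. (x e, d e)) ` E" "i \<notin> (\<lambda>e. (1 - x e, - d e)) ` E"
      using i(3) fr' by (auto simp: x'_def fractional_def)
    then obtain U F where UF: "(U, F) \<in> K" "i = (deviation x (odd_cut a E U) F - 1, dd U F)"
      using i(1) by (auto simp: I_def)
    then have tight: "deviation x' (odd_cut a E U) F = 1" and dd: "dd U F \<noteq> 0" using i dev by auto
    have U: "U \<subseteq> V" and F: "F \<subseteq> odd_cut a E U" and odd: "odd (int (card F) + sum b U)"
      using UF(1) by (auto simp: K_def)
    have finU: "finite U" using U fin finite_subset by auto
    note cov = contract_edges_cover[OF P' fr' U]
    have c0: "U \<noteq> {}" using dd by (auto simp: dd_def odd_cut_def)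
    have c1: "card U \<noteq> 1"
    proof
      assume "card U = 1"
      then obtain v where "U = {v}" by (rule card_1_singletonE)
      then show False
        using tight_vertex_cut[OF P' fr', of v F d] U F odd tight d(2) dd by (auto simp: dd_def)
    qed
    have c2: "V - U \<noteq> {}"
    proof
      assume "V - U = {}"
      then have "U = V" using U by auto
      then have "odd_cut a E U = {}" using ej_point_even_total(2)[OF P fr] by (auto simp: odd_cut_def)
      then show False using dd by (simp add: dd_def)
    qed
    have c3: "card (V - U) \<noteq> 1"
    proof
      assume "card (V - U) = 1"
      then obtain w where w: "V - U = {w}" by (rule card_1_singletonE)
      have "odd (int (card F) + b w)"
        using cov(4)[of F] odd ej_point_even_total(1)[OF P fr] unfolding w by auto
      then show False
        using tight_vertex_cut[OF P' fr', of w F d] w F tight d(2) dd cov(3) by (auto simp: dd_def)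
    qed
    have "card U \<noteq> 0" "card (V - U) \<noteq> 0" using c0 c2 finU fin by auto
    then have "2 \<le> card U" "2 \<le> card (V - U)" using c1 c3 by linarith+
    then show ?thesis using U F odd tight unfolding tight_cut_def by blast
  qed
  then show ?thesis using P' cost by blast
qed

text \<open>Two signs agree exactly if their half sum is odd. An even number of the three half sums
  is odd, so the product of all six signs is -1 and the two summands are opposite.\<close>

lemma sign_identity:
  fixes p q r s m n :: int
  assumes "p = -1 \<or> p = 1" "q = -1 \<or> q = 1" "r = -1 \<or> r = 1" "s = -1 \<or> s = 1"
    "m = -1 \<or> m = 1" "n = -1 \<or> n = 1"
    and "2 * b1 = p + q" "2 * b2 = r + s" "2 * b3 = m + n" "even (b1 + b2 + b3)"
  shows "m * (p * q) + n * (r * s) = 0"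
  using assms by (elim disjE) (simp; presburger)+

text \<open>
  Without a kernel direction there are at most as many edges as vertices, so all degrees are 2. Then also
  \<open>1 - 2x\<close> is a kernel direction, so \<open>x\<close> is constantly 1/2, and the two ends of any edge form a
  tight cut or lie on a cycle with two or three vertices, which has a kernel direction by parity.
\<close>

lemma kernel_direction:
  assumes P: "ej_point V E a b x" and fr: "fractional E x" and ne: "E \<noteq> {}"
    and iso: "\<forall>v\<in>V. \<exists>e\<in>E. a v e \<noteq> 0"
    and nt: "\<nexists>U F. tight_cut V E a b x U F"
  shows "\<exists>d :: 'e \<Rightarrow> real. (\<exists>e\<in>E. d e \<noteq> 0) \<and> (\<forall>v\<in>V. (\<Sum>e\<in>E. of_int (a v e) * d e) = 0)"
proof (rule ccontr)
  assume no: "\<not> ?thesis"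
  have fin: "finite V" "finite E" using P by (auto simp: ej_point_def)
  have ac: "a v e = -1 \<or> a v e = 0 \<or> a v e = 1" for v e
  proof -
    have "\<bar>a v e\<bar> \<le> 1" using P by (simp add: ej_point_def)
    then show ?thesis by (simp add: abs_le_1_int)
  qed
  note col = fractional_column_sum[OF P fr]
  have fre: "0 < x e" "x e < 1" if "e \<in> E" for e using fr that by (auto simp: fractional_def)
  have eqs: "(\<Sum>e\<in>E. of_int (a v e) * x e) = of_int (b v)" if "v \<in> V" for v
    using P that by (simp add: ej_point_def)
  have abs01: "\<bar>a v e\<bar> = (if a v e \<noteq> 0 then 1 else 0)" for v e using ac[of v e] by auto
  define inc where "inc = (\<lambda>v. {e \<in> E. a v e \<noteq> 0})"
  define ends where "ends = (\<lambda>e. {v \<in> V. a v e \<noteq> 0})"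
  have fin_inc: "finite (inc v)" for v using fin by (simp add: inc_def)
  have ends2: "card (ends e) = 2" if "e \<in> E" for e
    using col[OF that] fin by (simp add: abs01 ends_def sum.If_cases Int_def flip: of_nat_eq_iff)
  have sum_inc: "(\<Sum>e\<in>E. of_int (a v e) * y e) = (\<Sum>e\<in>inc v. of_int (a v e) * y e)" for v and y :: "'e \<Rightarrow> real"
    by (rule sum.mono_neutral_right) (use fin in \<open>auto simp: inc_def\<close>)
  \<comment> \<open>A single edge at \<open>v\<close> would have the integral value
    \<open>b v\<close> or \<open>- b v\<close>.\<close>
  have deg2: "2 \<le> card (inc v)" if v: "v \<in> V" for v
  proof (rule ccontr)
    assume "\<not> 2 \<le> card (inc v)"
    moreover have "card (inc v) \<noteq> 0" using iso v fin_inc by (auto simp: inc_def)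
    ultimately have "card (inc v) = 1" by linarith
    then obtain e where e: "inc v = {e}" by (rule card_1_singletonE)
    then have "e \<in> E" "a v e \<noteq> 0" by (auto simp: inc_def)
    moreover have "of_int (a v e) * x e = of_int (b v)" using eqs[OF v] sum_inc[of v x] e by simp
    ultimately have "x e = of_int (b v) \<or> x e = of_int (- b v)"
      using ac[of v e] by auto
    then obtain k :: int where "x e = of_int k" by blast
    then show False using fre[OF \<open>e \<in> E\<close>] by auto
  qed
  have "(\<Sum>v\<in>V. card (inc v)) = (\<Sum>e\<in>E. card (ends e))"
    unfolding inc_def ends_def by (rule sum_multicount_gen) (use fin in auto)
  also have "\<dots> = 2 * card E" using ends2 by simp
  finally have tot: "(\<Sum>v\<in>V. card (inc v)) = 2 * card E" .
  have "\<not> card V < card E"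
    using homogeneous_system_solution[OF fin, of "\<lambda>v e. of_int (a v e)"] no by blast
  then have "(\<Sum>v\<in>V. card (inc v)) \<le> (\<Sum>v\<in>V. 2)" using tot by simp
  have inc2: "card (inc v) = 2" if v: "v \<in> V" for v
  proof (rule ccontr)
    assume "card (inc v) \<noteq> 2"
    then have "2 < card (inc v)" using deg2[OF v] by simp
    then have "(\<Sum>v\<in>V. 2) < (\<Sum>v\<in>V. card (inc v))"
      using fin v deg2 by (intro sum_strict_mono_ex1) auto
    then show False using \<open>(\<Sum>v\<in>V. card (inc v)) \<le> (\<Sum>v\<in>V. 2)\<close> by simp
  qed
  have two: "\<exists>f. f \<noteq> e \<and> inc v = {e, f}" if "v \<in> V" "e \<in> inc v" for v e
    using inc2[OF that(1)] that(2) by (auto simp: card_2_iff)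
  have ker: "False" if "\<exists>e\<in>E. d e \<noteq> 0" "\<And>v. v \<in> V \<Longrightarrow> (\<Sum>e\<in>inc v. of_int (a v e) * d e) = 0" for d :: "'e \<Rightarrow> real"
    using no that sum_inc by auto
  \<comment> \<open>Both values at a vertex of degree 2 lie strictly between 0 and 1, so integrality
    leaves only half the sum of the two coefficients as right-hand side.\<close>
  have "(\<Sum>e\<in>inc v. of_int (a v e) * (1 - 2 * x e)) = 0" if v: "v \<in> V" for v
  proof -
    obtain e f where ef: "e \<noteq> f" "inc v = {e, f}" using inc2[OF v] by (auto simp: card_2_iff)
    then have mem: "e \<in> E" "f \<in> E" "a v e \<noteq> 0" "a v f \<noteq> 0" by (auto simp: inc_def)
    have eq: "of_int (a v e) * x e + of_int (a v f) * x f = of_int (b v)"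
      using eqs[OF v] sum_inc[of v x] ef by simp
    have "of_int (a v e) * (1 - 2 * x e) + of_int (a v f) * (1 - 2 * x f) = of_int (a v e + a v f - 2 * b v)"
      using eq by (simp add: algebra_simps)
    also have "a v e + a v f - 2 * b v = 0"
      using ac[of v e] ac[of v f] mem(3,4) eq fre[OF mem(1)] fre[OF mem(2)] by auto
    finally show ?thesis using ef by simp
  qed
  then have half: "x e = 1 / 2" if "e \<in> E" for e
    using ker[of "\<lambda>e. 1 - 2 * x e"] that by force
  have bhalf: "2 * b v = a v e + a v f" if "v \<in> V" "e \<noteq> f" "inc v = {e, f}" for v e f
  proof -
    have "e \<in> E" "f \<in> E" using that(3) by (auto simp: inc_def)
    then have "of_int (a v e) / 2 + of_int (a v f) / 2 = real_of_int (b v)"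
      using eqs[OF that(1)] sum_inc[of v x] that half by simp
    then have "real_of_int (2 * b v) = real_of_int (a v e + a v f)" by simp
    then show ?thesis by linarith
  qed
  have cutc: "1 \<le> deviation x (odd_cut a E U) F" if "U \<subseteq> V" "F \<subseteq> odd_cut a E U" "odd (int (card F) + sum b U)" for U F
    using P that unfolding ej_point_def cut_constraints_def by blast
  obtain e where e: "e \<in> E" using ne by blast
  obtain u v where uv: "u \<noteq> v" "ends e = {u, v}" using ends2[OF e] by (auto simp: card_2_iff)
  then have uvV: "u \<in> V" "v \<in> V" and eu: "e \<in> inc u" and ev: "e \<in> inc v"
    using e by (auto simp: ends_def inc_def)
  obtain f where f: "f \<noteq> e" "inc u = {e, f}" using two[OF uvV(1) eu] by blast
  obtain g where g: "g \<noteq> e" "inc v = {e, g}" using two[OF uvV(2) ev] by blast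
  have fE: "f \<in> E" "g \<in> E" using f g by (auto simp: inc_def)
  have nz: "a u e \<noteq> 0" "a u f \<noteq> 0" "a v e \<noteq> 0" "a v g \<noteq> 0"
    using f g by (auto simp: inc_def)
  have other: "w = u \<or> w = v" if "w \<in> V" "e \<in> inc w" for w
    using that uv by (auto simp: inc_def ends_def)
  have "{u, v} \<subseteq> V" using uvV by simp
  \<comment> \<open>With value 1 on \<open>e\<close>, the value \<open>df\<close> on
    \<open>f\<close> solves the equation of \<open>u\<close>, and \<open>dg\<close> on
    \<open>g\<close> that of \<open>v\<close>. It remains to see that they agree if
    \<open>f = g\<close>, or fit together at the third vertex of a triangle.\<close>
  define df :: real where "df = - of_int (a u e * a u f)"
  define dg :: real where "dg = - of_int (a v e * a v g)"
  note uvars = ac[of u e] ac[of u f] ac[of v e] ac[of v g]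
  have bu: "2 * b u = a u e + a u f" and bv: "2 * b v = a v e + a v g"
    using bhalf[OF uvV(1), of e f] bhalf[OF uvV(2), of e g] f g by auto
  have sb: "sum b {u, v} = b u + b v" using uv by simp
  show False
  proof (cases "f = g")
    case True
    have "odd_cut a E {u, v} = {}"
    proof -
      have "even (a u h + a v h)" if "h \<in> E" for h
      proof (cases "h = e \<or> h = f")
        case True then show ?thesis using nz uvars \<open>f = g\<close> by auto
      next
        case False
        then have "h \<notin> inc u" "h \<notin> inc v" using f g \<open>f = g\<close> by auto
        then show ?thesis using that by (simp add: inc_def)
      qed
      then show ?thesis using uv by (auto simp: odd_cut_def)
    qed
    \<comment> \<open>The constraint of an empty cut is a parity condition. As \<open>b u\<close> is
      odd exactly if the coefficients at \<open>u\<close> agree, and likewise at \<open>v\<close>,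
      it equates the two products of coefficients.\<close>
    then have "even (b u + b v)"
      using cutc[OF \<open>{u, v} \<subseteq> V\<close>, of "{}"] sb by (auto simp: deviation_def)
    then have eqp: "a u e * a u f = a v e * a v g"
      using bu bv nz uvars by (elim disjE) auto
    have "(\<Sum>h\<in>inc w. of_int (a w h) * (if h = e then 1 else if h = f then df else 0)) = 0" if w: "w \<in> V" for w
    proof (cases "w = u \<or> w = v")
      case True
      then show ?thesis using f g \<open>f = g\<close> nz uvars eqp by (elim disjE) (auto simp: df_def)
    next
      case False
      have "f \<notin> inc w"
      proof
        assume "f \<in> inc w"
        then have "{u, v, w} \<subseteq> ends f" using f g \<open>f = g\<close> uvV w by (auto simp: inc_def ends_def)
        then have "card {u, v, w} \<le> card (ends f)" by (rule card_mono[rotated]) (use fin in \<open>simp add: ends_def\<close>)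
        moreover have "card {u, v, w} = 3" using False uv(1) by auto
        ultimately show False using ends2[OF fE(1)] by simp
      qed
      then show ?thesis using other[OF w] False by (intro sum.neutral) auto
    qed
    then show False
      by (intro ker[of "\<lambda>h. if h = e then 1 else if h = f then df else 0"] bexI[OF _ e]) simp_all
  next
    case False
    have fv: "f \<notin> inc v" "g \<notin> inc u" using f g False by auto
    then have z: "a v f = 0" "a u g = 0" using fE by (auto simp: inc_def)
    have cut: "odd_cut a E {u, v} = {f, g}"
    proof -
      have "odd (a u h + a v h) \<longleftrightarrow> h = f \<or> h = g" if "h \<in> E" for h
      proof (cases "h = e \<or> h = f \<or> h = g")
        case True
        moreover have "odd (a u e)" "odd (a u f)" "odd (a v e)" "odd (a v g)"
          using nz uvars by auto
        ultimately show ?thesis using z f g by auto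
      next
        case no: False
        then have "h \<notin> inc u" "h \<notin> inc v" using f g by auto
        then show ?thesis using that no by (simp add: inc_def)
      qed
      then show ?thesis using uv fE by (auto simp: odd_cut_def)
    qed
    \<comment> \<open>With \<open>x\<close> equal to 1/2 on both edges each choice of
      \<open>F\<close> has deviation 1; it is chosen to make the cut odd.\<close>
    define F where "F = (if odd (b u + b v) then {} else {f})"
    have "deviation x (odd_cut a E {u, v}) F = 1"
      unfolding cut deviation_def using False half[OF fE(1)] half[OF fE(2)] by (simp add: F_def)
    then have "\<not> 2 \<le> card (V - {u, v})"
    proof -
      have "odd (int (card F) + sum b {u, v})" unfolding sb by (simp add: F_def)
      moreover have "F \<subseteq> odd_cut a E {u, v}" unfolding cut by (simp add: F_def)
      moreover have "2 \<le> card {u, v}" using uv(1) by simp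
      ultimately show ?thesis
        using nt \<open>{u, v} \<subseteq> V\<close> \<open>deviation x (odd_cut a E {u, v}) F = 1\<close>
        unfolding tight_cut_def by blast
    qed
    moreover obtain w where w: "w \<noteq> u" "w \<in> ends f"
      using ends2[OF fE(1)] by (metis card_2_iff insertCI)
    moreover have wV: "w \<in> V - {u, v}" using w z by (auto simp: ends_def)
    \<comment> \<open>The cut of \<open>{u, v}\<close> is tight, hence trivial: at most one vertex
      is left, and \<open>e\<close>, \<open>f\<close>, \<open>g\<close> form a triangle.\<close>
    ultimately have Vw: "V - {u, v} = {w}"
      by (metis One_nat_def Suc_1 card_1_singletonE card_eq_0_iff empty_iff fin(1) finite_Diff less_2_cases not_le singletonD)
    obtain w' where w': "w' \<noteq> v" "w' \<in> ends g"
      using ends2[OF fE(2)] by (metis card_2_iff insertCI)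
    have "w' \<in> V - {u, v}" using w' z by (auto simp: ends_def)
    then have "w' = w" using Vw by auto
    then have fg: "f \<in> inc w" "g \<in> inc w" using w w' fE by (auto simp: ends_def inc_def)
    then have incw: "inc w = {f, g}" using two[of w f] wV False by auto
    have Veq: "V = {u, v, w}" using Vw uvV by auto
    have bw: "2 * b w = a w f + a w g" using bhalf[of w f g] wV incw False by auto
    have "even (b u + b v + b w)"
    proof -
      have "u \<noteq> v" "u \<noteq> w" "v \<noteq> w" using wV uv(1) by auto
      then have "sum b V = b u + b v + b w" unfolding Veq by simp
      then show ?thesis using ej_point_even_total(1)[OF P fr] by simp
    qed
    then have eqp: "a w f * (a u e * a u f) + a w g * (a v e * a v g) = 0"
      by (intro sign_identity[OF _ _ _ _ _ _ bu bv bw]) (use nz fg uvars ac[of w f] ac[of w g] in \<open>auto simp: inc_def\<close>)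
    have "(\<Sum>h\<in>inc y. of_int (a y h) * (if h = e then 1 else if h = f then df else dg)) = 0" if y: "y \<in> V" for y
    proof -
      consider "y = u" | "y = v" | "y = w" using y Veq by auto
      then show ?thesis
      proof cases
        case 1
        then show ?thesis using f nz uvars by (auto simp: df_def)
      next
        case 2
        then show ?thesis using g nz uvars False by (auto simp: dg_def)
      next
        case 3
        have "real_of_int (a w f * (a u e * a u f) + a w g * (a v e * a v g)) = 0" using eqp by simp
        then show ?thesis using 3 incw f g False by (simp add: df_def dg_def)
      qed
    qed
    then show False
      by (intro ker[of "\<lambda>h. if h = e then 1 else if h = f then df else dg"] bexI[OF _ e]) simp_all
  qed
qed

section \<open>The induction on the size of the system\<close>

lemma contraction_step:
  fixes V :: "'v set" and c :: "'e \<Rightarrow> real"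
  assumes P: "ej_point V E a b x" and fr: "fractional E x"
    and tc: "tight_cut V E a b x U F"
    and IH: "\<And>(V' :: 'v set) E' a' b' (c' :: 'e \<Rightarrow> real). card V' + card E' < card V + card E \<Longrightarrow> ej_point V' E' a' b' x \<Longrightarrow>
       fractional E' x \<Longrightarrow> \<exists>J. solution V' E' a' b' J \<and> sum c' J \<le> (\<Sum>e\<in>E'. c' e * x e)"
  shows "\<exists>J. solution V E a b J \<and> sum c J \<le> (\<Sum>e\<in>E. c e * x e)"
proof -
  have fin: "finite V" "finite E" using P by (auto simp: ej_point_def)
  have U: "U \<subseteq> V" and F: "F \<subseteq> odd_cut a E U" and odd: "odd (int (card F) + sum b U)"
    and tight: "deviation x (odd_cut a E U) F = 1" and card: "2 \<le> card U" "2 \<le> card (V - U)"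
    using tc by (auto simp: tight_cut_def)
  have "U \<noteq> {}" "V - U \<noteq> {}" using card by (metis card.empty not_numeral_le_zero)+
  then obtain u w where u: "u \<in> U" and w: "w \<in> V - U" by blast
  note cov = contract_edges_cover[OF P fr U]
  have finU: "finite U" using U fin finite_subset by blast
  have cV: "card V = card U + card (V - U)" using U fin by (metis card_Diff_subset card_mono finU le_add_diff_inverse)
  have sub: "fractional (contract_edges a E S) x" "card (contract_edges a E S) \<le> card E" for S
    using fr fin by (auto simp: fractional_def contract_edges_def intro: card_mono)
  have odd2: "odd (int (card F) + sum b (V - U))"
    using cov(4)[of F] odd ej_point_even_total(1)[OF P fr] by auto
  have cU: "card (insert u (V - U)) + card (contract_edges a E U) < card V + card E"
  proof -
    have "card (insert u (V - U)) = Suc (card (V - U))" using u fin by simp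
    then show ?thesis using cV card sub(2)[of U] by linarith
  qed
  have dd: "V - (V - U) = U" using U by auto
  have cW: "card (insert w (V - (V - U))) + card (contract_edges a E (V - U)) < card V + card E"
  proof -
    have "card (insert w (V - (V - U))) = Suc (card U)" unfolding dd using w finU by simp
    then show ?thesis using cV card sub(2)[of "V - U"] by linarith
  qed
  have VU: "V - U \<subseteq> V" by auto
  \<comment> \<open>Both contractions keep the values of \<open>x\<close>, so the induction
    hypothesis is applied to the same point.\<close>
  have P1: "contraction_point V E a b U u F x"
    by (rule contract_ej_point[OF P fr U u F odd tight])
  have P2: "contraction_point V E a b (V - U) w F x"
    by (rule contract_ej_point[OF P fr VU w _ odd2]) (use F tight cov(3) in simp_all)
  show ?thesis
    by (rule glue_solutions[OF P fr U u w F IH[OF cU P1 sub(1)] IH[OF cW P2 sub(1)]])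
qed

text \<open>A zero row forces \<open>b v = 0\<close>. Removing it secures the hypothesis of
  \<open>kernel_direction\<close> that every vertex meets an edge.\<close>

lemma delete_isolated_vertex:
  assumes P: "ej_point V E a b x" and v: "v \<in> V" "\<forall>e\<in>E. a v e = 0"
  shows "ej_point (V - {v}) E a b x"
    and "solution (V - {v}) E a b J \<Longrightarrow> solution V E a b J"
proof -
  have fin: "finite V" using P by (simp add: ej_point_def)
  have "(\<Sum>w\<in>V - {v}. \<bar>a w e\<bar>) = (\<Sum>w\<in>V. \<bar>a w e\<bar>)" if "e \<in> E" for e
    using sum.remove[OF fin v(1), of "\<lambda>w. \<bar>a w e\<bar>"] v(2) that by simp
  then show "ej_point (V - {v}) E a b x"
    using P unfolding ej_point_def cut_constraints_def by (auto dest: subset_trans[OF _ Diff_subset])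
  have "of_int (b v) = (\<Sum>e\<in>E. of_int (a v e) * x e)" using P v(1) by (simp add: ej_point_def)
  also have "\<dots> = 0" using v(2) by simp
  finally have "b v = 0" by simp
  moreover have "(\<Sum>e\<in>J. a v e) = 0" if "J \<subseteq> E" using v(2) that by (intro sum.neutral) auto
  ultimately show "solution (V - {v}) E a b J \<Longrightarrow> solution V E a b J"
    unfolding solution_def by (metis Diff_iff singletonD)
qed

text \<open>Besides the cost, the rounding respects the integral values of \<open>x\<close>; in the
  application this keeps the prefix sums at the ends of full lines equal to 1.\<close>

lemma round_restricted:
  fixes c :: "'e \<Rightarrow> real"
  assumes P: "ej_point V E a b x"
    and "\<exists>J. solution V {e \<in> E. 0 < x e \<and> x e < 1} a (\<lambda>v. b v - (\<Sum>e\<in>{e \<in> E. x e = 1}. a v e)) J \<and>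
      sum c J \<le> (\<Sum>e\<in>{e \<in> E. 0 < x e \<and> x e < 1}. c e * x e)"
  shows "\<exists>J. solution V E a b J \<and> {e \<in> E. x e = 1} \<subseteq> J \<and> J \<subseteq> {e \<in> E. x e \<noteq> 0} \<and>
           sum c J \<le> (\<Sum>e\<in>E. c e * x e)"
proof -
  have fin: "finite V" "finite E" using P by (auto simp: ej_point_def)
  define E0 where "E0 = {e \<in> E. 0 < x e \<and> x e < 1}"
  define O1 where "O1 = {e \<in> E. x e = 1}"
  obtain J where J: "solution V E0 a (\<lambda>v. b v - (\<Sum>e\<in>O1. a v e)) J"
    "sum c J \<le> (\<Sum>e\<in>E0. c e * x e)"
    using assms(2) unfolding E0_def O1_def by blast
  have "solution V E a b (J \<union> O1)"
    unfolding O1_def by (rule solution_extend[OF fin(2)]) (use J(1) in \<open>simp add: E0_def O1_def\<close>)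
  moreover have JE: "J \<subseteq> E0" using J(1) by (simp add: solution_def)
  moreover have "sum c (J \<union> O1) \<le> (\<Sum>e\<in>E. c e * x e)"
  proof -
    have fin': "finite E0" "finite O1" "finite J" "E0 \<inter> O1 = {}"
      using fin JE by (auto simp: E0_def O1_def intro: finite_subset)
    have "sum c (J \<union> O1) = sum c J + sum c O1" using fin' JE by (intro sum.union_disjoint) auto
    also have "sum c O1 = (\<Sum>e\<in>O1. c e * x e)" by (simp add: O1_def)
    also have "sum c J + (\<Sum>e\<in>O1. c e * x e) \<le> (\<Sum>e\<in>E0. c e * x e) + (\<Sum>e\<in>O1. c e * x e)"
      using J(2) by simp
    also have "\<dots> = (\<Sum>e\<in>E0 \<union> O1. c e * x e)" using fin' by (simp add: sum.union_disjoint)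
    also have "\<dots> = (\<Sum>e\<in>E. c e * x e)"
    proof (rule sum.mono_neutral_left[OF fin(2)])
      show "E0 \<union> O1 \<subseteq> E" by (auto simp: E0_def O1_def)
      show "\<forall>e\<in>E - (E0 \<union> O1). c e * x e = 0"
        using P unfolding ej_point_def E0_def O1_def by force
    qed
    finally show ?thesis .
  qed
  ultimately show ?thesis by (intro exI[of _ "J \<union> O1"]) (auto simp: E0_def O1_def)
qed

lemma fractional_rounding:
  fixes V :: "'v set" and c :: "'e \<Rightarrow> real"
  assumes "ej_point V E a b x" "fractional E x"
  shows "\<exists>J. solution V E a b J \<and> sum c J \<le> (\<Sum>e\<in>E. c e * x e)"
  using assms
\<comment> \<open>The measure drops in every branch: a contraction merges at least two vertices, an
  isolated vertex disappears, or an edge reaches an integral value.\<close>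
proof (induction "card V + card E" arbitrary: V E a b x c rule: less_induct)
  case less
  note P = less.prems(1) and fr = less.prems(2)
  have IH: "\<exists>J. solution V' E' a' b' J \<and> sum c' J \<le> (\<Sum>e\<in>E'. c' e * x' e)"
    if "card V' + card E' < card V + card E" "ej_point V' E' a' b' x'" "fractional E' x'"
    for V' :: "'v set" and E' a' b' x' and c' :: "'e \<Rightarrow> real"
    using less.hyps[OF that] .
  have fin: "finite V" "finite E" using P by (auto simp: ej_point_def)
  show ?case
  proof (cases "E = {}")
    case True
    then have "solution V E a b {}"
      using P by (auto simp: solution_def ej_point_def)
    then show ?thesis using True by (intro exI[of _ "{}"]) simp
  next
    case ne: False
    show ?thesis
    proof (cases "\<exists>U F. tight_cut V E a b x U F")
      case True
      then show ?thesis using contraction_step[OF P fr _ IH] by blast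
    next
      case nt: False
      show ?thesis
      proof (cases "\<exists>v\<in>V. \<forall>e\<in>E. a v e = 0")
        case True
        then obtain v where v: "v \<in> V" "\<forall>e\<in>E. a v e = 0" by blast
        have "card (V - {v}) + card E < card V + card E" using card_Diff1_less[OF fin(1) v(1)] by linarith
        from IH[OF this delete_isolated_vertex(1)[OF P v] fr, of c]
        show ?thesis using delete_isolated_vertex(2)[OF P v] by blast
      next
        case iso: False
        obtain d0 :: "'e \<Rightarrow> real" where d0: "\<exists>e\<in>E. d0 e \<noteq> 0" "\<forall>v\<in>V. (\<Sum>e\<in>E. of_int (a v e) * d0 e) = 0"
          using kernel_direction[OF P fr ne] iso nt by blast
        \<comment> \<open>The kernel is closed under negation, so the sign is chosen such that the
          cost does not increase.\<close>
        define d where "d = (if (\<Sum>e\<in>E. c e * d0 e) \<le> 0 then d0 else (\<lambda>e. - d0 e))"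
        have d: "\<exists>e\<in>E. d e \<noteq> 0" "\<forall>v\<in>V. (\<Sum>e\<in>E. of_int (a v e) * d e) = 0" "(\<Sum>e\<in>E. c e * d e) \<le> 0"
          using d0 by (auto simp: d_def sum_negf)
        obtain x' where x': "ej_point V E a b x'" "(\<Sum>e\<in>E. c e * x' e) \<le> (\<Sum>e\<in>E. c e * x e)"
          "\<not> fractional E x' \<or> (\<exists>U F. tight_cut V E a b x' U F)"
          using move_to_tight_cut[OF P fr d] by blast
        have "\<exists>J. solution V E a b J \<and> sum c J \<le> (\<Sum>e\<in>E. c e * x' e)"
        proof (cases "fractional E x'")
          case True
          then show ?thesis using contraction_step[OF x'(1) True _ IH] x'(3) by blast
        next
          case False
          define E0 where "E0 = {e \<in> E. 0 < x' e \<and> x' e < 1}"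
          have "E0 \<subset> E" using False by (auto simp: E0_def fractional_def)
          then have "card E0 < card E" using fin by (simp add: psubset_card_mono)
          then have "card V + card E0 < card V + card E" by simp
          moreover have "fractional E0 x'" by (auto simp: E0_def fractional_def)
          ultimately show ?thesis
            using round_restricted[OF x'(1), of c] IH[of V E0 a _ x' c] ej_point_restrict_fractional[OF x'(1)]
            unfolding E0_def by blast
        qed
        then show ?thesis using x'(2) by (meson order_trans)
      qed
    qed
  qed
qed

lemma ej_rounding:
  fixes c :: "'e \<Rightarrow> real"
  assumes P: "ej_point V E a b x"
  shows "\<exists>J. solution V E a b J \<and> {e \<in> E. x e = 1} \<subseteq> J \<and> J \<subseteq> {e \<in> E. x e \<noteq> 0} \<and>
           sum c J \<le> (\<Sum>e\<in>E. c e * x e)"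
proof -
  have "fractional {e \<in> E. 0 < x e \<and> x e < 1} x" by (auto simp: fractional_def)
  from round_restricted[OF P fractional_rounding[OF ej_point_restrict_fractional[OF P] this]]
  show ?thesis .
qed

section \<open>Loops and the subdivision of edges\<close>

lemma sum_prod_bool:
  fixes f :: "'e \<times> bool \<Rightarrow> 'b :: comm_monoid_add"
  shows "(\<Sum>h\<in>E \<times> UNIV. f h) = (\<Sum>e\<in>E. f (e, False) + f (e, True))"
proof -
  have "(\<Sum>h\<in>E \<times> UNIV. f h) = (\<Sum>e\<in>E. \<Sum>s\<in>UNIV. f (e, s))" by (simp add: sum.cartesian_product)
  then show ?thesis by (simp add: UNIV_bool add.commute)
qed

text \<open>
  The coefficients are split into two ends of each edge, so that loops (both ends at one vertex)
  are allowed; a loop occurs at the cell \<open>(k, k)\<close> for even \<open>n\<close>. Subdividing all edges removes loops.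
\<close>

theorem edmonds_johnson:
  fixes out inn :: "'v \<Rightarrow> 'e \<Rightarrow> int" and c :: "'e \<Rightarrow> real"
  defines "a \<equiv> \<lambda>v e. out v e + inn v e"
  assumes fin: "finite V" "finite E"
    and le1: "\<And>v e. \<bar>out v e\<bar> \<le> 1" "\<And>v e. \<bar>inn v e\<bar> \<le> 1"
    and bnd: "\<And>e. e \<in> E \<Longrightarrow> 0 \<le> x e \<and> x e \<le> 1"
    and col: "\<And>e. e \<in> E \<Longrightarrow> x e \<noteq> 0 \<Longrightarrow> x e \<noteq> 1 \<Longrightarrow>
        (\<Sum>v\<in>V. \<bar>out v e\<bar>) = 1 \<and> (\<Sum>v\<in>V. \<bar>inn v e\<bar>) = 1"
    and eqs: "\<And>v. v \<in> V \<Longrightarrow> (\<Sum>e\<in>E. of_int (a v e) * x e) = of_int (b v)"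
    and cuts: "cut_constraints V E a b x"
  shows "\<exists>J. solution V E a b J \<and> {e \<in> E. x e = 1} \<subseteq> J \<and> J \<subseteq> {e \<in> E. x e \<noteq> 0} \<and>
           sum c J \<le> (\<Sum>e\<in>E. c e * x e)"
proof -
  define V' where "V' = V <+> E"
  define E' where "E' = E \<times> (UNIV :: bool set)"
  \<comment> \<open>The halves \<open>(e, False)\<close> and \<open>(e, True)\<close> carry one old
    end each and meet in the new vertex \<open>Inr e\<close>, whose equation makes their values
    equal. The whole cost sits on the first half.\<close>
  define a' where "a' = (\<lambda>w (e, s). case w of Inl v \<Rightarrow> (if s then inn v e else out v e)
     | Inr e1 \<Rightarrow> (if e = e1 then (if s then -1 else 1) else 0))"
  define b' where "b' = (\<lambda>w :: 'v + 'e. case w of Inl v \<Rightarrow> b v | Inr e \<Rightarrow> 0)"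
  define x' where "x' = (\<lambda>(e, s :: bool). x e)"
  define c' where "c' = (\<lambda>(e, s). if s then 0 else c e)"
  have fin': "finite V'" "finite E'" using fin by (auto simp: V'_def E'_def)
  have a'_simps: "a' (Inl v) (e, False) = out v e" "a' (Inl v) (e, True) = inn v e"
    "a' (Inr e1) (e, False) = (if e = e1 then 1 else 0)" "a' (Inr e1) (e, True) = (if e = e1 then -1 else 0)"
    for v e e1 by (auto simp: a'_def)
  have sumE: "(\<Sum>h\<in>E'. f h) = (\<Sum>e\<in>E. f (e, False) + f (e, True))" for f :: "'e \<times> bool \<Rightarrow> real"
    unfolding E'_def by (rule sum_prod_bool)
  have "\<bar>a' w h\<bar> \<le> 1" for w h
    using le1 by (cases w; cases h) (auto simp: a'_def)
  moreover have "0 \<le> x' h \<and> x' h \<le> 1" if "h \<in> E'" for h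
    using that bnd by (auto simp: E'_def x'_def)
  moreover have "(\<Sum>w\<in>V'. \<bar>a' w h\<bar>) = 2" if hE: "h \<in> E'" and x01: "x' h \<noteq> 0" "x' h \<noteq> 1" for h
  proof -
    obtain e s where h: "h = (e, s)" "e \<in> E" using hE by (cases h) (auto simp: E'_def)
    then have "x e \<noteq> 0" "x e \<noteq> 1" using x01 by (auto simp: x'_def)
    note c = col[OF h(2) this]
    have "(\<Sum>w\<in>V'. \<bar>a' w h\<bar>) = (\<Sum>v\<in>V. \<bar>a' (Inl v) h\<bar>) + (\<Sum>e1\<in>E. \<bar>a' (Inr e1) h\<bar>)"
      unfolding V'_def using fin by (simp add: sum.Plus)
    also have "(\<Sum>v\<in>V. \<bar>a' (Inl v) h\<bar>) = 1" using c h(1) by (cases s) (simp_all add: a'_simps)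
    also have "(\<Sum>e1\<in>E. \<bar>a' (Inr e1) h\<bar>) = (\<Sum>e1\<in>E. if e = e1 then 1 else 0)"
      by (rule sum.cong) (auto simp: a'_def h(1))
    also have "\<dots> = 1" using fin h(2) by simp
    finally show ?thesis by simp
  qed
  moreover have "(\<Sum>h\<in>E'. of_int (a' w h) * x' h) = of_int (b' w)" if "w \<in> V'" for w
  proof (cases w)
    case (Inl v)
    then have "v \<in> V" using that by (auto simp: V'_def)
    then show ?thesis using eqs[of v] Inl
      by (simp add: sumE a'_simps x'_def b'_def a_def algebra_simps)
  next
    case (Inr e1)
    then show ?thesis by (auto simp: sumE a'_simps x'_def b'_def intro!: sum.neutral)
  qed
  moreover have "1 \<le> deviation x' (odd_cut a' E' W) F'"
    if W: "W \<subseteq> V'" and F': "F' \<subseteq> odd_cut a' E' W" and odd: "odd (int (card F') + sum b' W)" for W F'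
  proof -
    define U where "U = {v. Inl v \<in> W}"
    define M where "M = {e. Inr e \<in> W}"
    define D' where "D' = odd_cut a' E' W"
    define D where "D = odd_cut a E U"
    have UM: "U \<subseteq> V" "M \<subseteq> E" using W by (auto simp: U_def M_def V'_def)
    have finUM: "finite U" "finite M" using UM fin finite_subset by blast+
    have W_eq: "W = U <+> M"
      by (auto simp: U_def M_def Plus_def image_iff) (metis sum.exhaust)
    have sumW: "(\<Sum>w\<in>W. f w) = (\<Sum>v\<in>U. f (Inl v)) + (\<Sum>e\<in>M. f (Inr e))" for f :: "'v + 'e \<Rightarrow> int"
      unfolding W_eq using finUM by (simp add: sum.Plus)
    have bW: "sum b' W = sum b U" by (simp add: sumW b'_def)
    have sM: "(\<Sum>e1\<in>M. a' (Inr e1) (e, s)) = (if e \<in> M then (if s then -1 else 1) else 0)" for e s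
      using finUM by (cases s) (simp_all add: a'_simps)
    have D'1: "(e, False) \<in> D' \<longleftrightarrow> e \<in> E \<and> (odd (\<Sum>v\<in>U. out v e) \<longleftrightarrow> e \<notin> M)" for e
      by (auto simp: D'_def odd_cut_def E'_def sumW a'_simps(1) sM)
    have D'2: "(e, True) \<in> D' \<longleftrightarrow> e \<in> E \<and> (odd (\<Sum>v\<in>U. inn v e) \<longleftrightarrow> e \<notin> M)" for e
      by (auto simp: D'_def odd_cut_def E'_def sumW a'_simps(2) sM)
    have D: "e \<in> D \<longleftrightarrow> e \<in> E \<and> ((e, False) \<in> D' \<longleftrightarrow> (e, True) \<notin> D')" for e
      unfolding D'1 D'2 by (auto simp: D_def odd_cut_def a_def sum.distrib)
    have FD: "F' \<subseteq> D'" using F' by (simp add: D'_def)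
    have DE: "D' \<subseteq> E'" by (auto simp: D'_def odd_cut_def)
    define t where "t = (\<lambda>h. if h \<in> D' then if h \<in> F' then 1 - x' h else x' h else 0)"
    have t0: "0 \<le> t (e, s)" if "e \<in> E" for e s using bnd[OF that] by (auto simp: t_def x'_def)
    have "deviation x' D' F' = (\<Sum>h\<in>D'. t h)"
      unfolding deviation_def by (rule sum.cong) (auto simp: t_def)
    also have "\<dots> = (\<Sum>h\<in>E'. t h)"
      by (rule sum.mono_neutral_left) (use fin' DE in \<open>auto simp: t_def\<close>)
    finally have dev: "deviation x' D' F' = (\<Sum>e\<in>E. t (e, False) + t (e, True))" by (simp add: sumE)
    show ?thesis
    \<comment> \<open>If both halves of an edge lie in the cut but only one in \<open>F'\<close>,
      their terms \<open>x e\<close> and \<open>1 - x e\<close> already sum to 1. Otherwise such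
      edges contribute an even number to \<open>card F'\<close> and can be discarded, which leaves
      an odd cut of the original system.\<close>
    proof (cases "\<exists>e\<in>E. (e, False) \<in> D' \<and> (e, True) \<in> D' \<and> ((e, False) \<in> F') \<noteq> ((e, True) \<in> F')")
      case True
      then obtain e where e: "e \<in> E" "(e, False) \<in> D'" "(e, True) \<in> D'" "((e, False) \<in> F') \<noteq> ((e, True) \<in> F')"
        by blast
      then have "1 = t (e, False) + t (e, True)" by (auto simp: t_def x'_def)
      also have "\<dots> \<le> (\<Sum>e\<in>E. t (e, False) + t (e, True))"
        using e(1) fin t0 by (intro member_le_sum) auto
      finally show ?thesis using dev by (simp add: D'_def)
    next
      case False
      define F where "F = {e \<in> D. (e, False) \<in> F' \<or> (e, True) \<in> F'}"
      define k where "k = (\<lambda>e. (if (e, False) \<in> F' then 1 else 0) + (if (e, True) \<in> F' then 1 else 0) :: int)"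
      have "int (card F') = (\<Sum>h\<in>E'. if h \<in> F' then 1 else 0)"
        using fin' FD DE by (simp add: sum.If_cases Int_absorb1)
      also have "\<dots> = (\<Sum>e\<in>E. k e)" unfolding E'_def by (simp add: sum_prod_bool k_def)
      finally have "int (card F') = (\<Sum>e\<in>E. k e)" .
      moreover have "{e \<in> E. odd (k e)} = F"
        using False FD D by (auto simp: k_def F_def)
      ultimately have "even (int (card F') - int (card F))"
        using card_filter_parity[OF fin(2), of k] by simp
      then have "odd (int (card F) + sum b U)" using odd bW by auto
      moreover have "F \<subseteq> odd_cut a E U" by (auto simp: F_def D_def)
      ultimately have "1 \<le> deviation x D F"
        using cuts UM(1) unfolding cut_constraints_def D_def by blast
      also have "\<dots> \<le> (\<Sum>e\<in>D. t (e, False) + t (e, True))"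
        unfolding deviation_def
      proof (rule sum_mono)
        fix e assume "e \<in> D"
        then show "(if e \<in> F then 1 - x e else x e) \<le> t (e, False) + t (e, True)"
          using FD D[of e] by (auto simp: t_def F_def x'_def)
      qed
      also have "\<dots> \<le> (\<Sum>e\<in>E. t (e, False) + t (e, True))"
        using fin t0 D by (intro sum_mono2) auto
      finally show ?thesis using dev by (simp add: D'_def)
    qed
  qed
  ultimately have "ej_point V' E' a' b' x'"
    using fin' unfolding ej_point_def cut_constraints_def by blast
  from ej_rounding[OF this, of c'] obtain J' where J': "solution V' E' a' b' J'"
    "{h \<in> E'. x' h = 1} \<subseteq> J'" "J' \<subseteq> {h \<in> E'. x' h \<noteq> 0}" "sum c' J' \<le> (\<Sum>h\<in>E'. c' h * x' h)"
    by blast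
  have JE': "J' \<subseteq> E'" and sol: "\<And>w. w \<in> V' \<Longrightarrow> (\<Sum>h\<in>J'. a' w h) = b' w"
    using J'(1) by (auto simp: solution_def)
  define J where "J = {e \<in> E. (e, False) \<in> J'}"
  have sumJ: "(\<Sum>h\<in>J'. f h) = (\<Sum>e\<in>E. (if (e, False) \<in> J' then f (e, False) else 0) +
      (if (e, True) \<in> J' then f (e, True) else 0))" for f :: "'e \<times> bool \<Rightarrow> 'n :: comm_monoid_add"
  proof -
    have "(\<Sum>h\<in>J'. f h) = (\<Sum>h\<in>E'. if h \<in> J' then f h else 0)"
      using fin' JE' by (simp add: sum.If_cases Int_absorb1)
    then show ?thesis unfolding E'_def by (simp add: sum_prod_bool)
  qed
  have halves: "(e, True) \<in> J' \<longleftrightarrow> (e, False) \<in> J'" if e: "e \<in> E" for e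
  proof -
    have "0 = (\<Sum>h\<in>J'. a' (Inr e) h)" using sol[of "Inr e"] e by (simp add: V'_def b'_def InrI)
    also have "\<dots> = (\<Sum>e1\<in>E. if e1 = e then (if (e, False) \<in> J' then 1 else 0) - (if (e, True) \<in> J' then 1 else 0) else 0)"
      unfolding sumJ by (rule sum.cong) (auto simp: a'_simps)
    also have "\<dots> = (if (e, False) \<in> J' then 1 else 0) - (if (e, True) \<in> J' then 1 else 0)"
      using fin e by simp
    finally show ?thesis by (auto split: if_splits)
  qed
  have sum2: "(\<Sum>h\<in>J'. f h) = (\<Sum>e\<in>J. f (e, False) + f (e, True))" for f :: "'e \<times> bool \<Rightarrow> 'n :: comm_monoid_add"
  proof -
    have "(\<Sum>h\<in>J'. f h) = (\<Sum>e\<in>E. if (e, False) \<in> J' then f (e, False) + f (e, True) else 0)"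
      unfolding sumJ by (rule sum.cong) (auto simp: halves)
    then show ?thesis using fin by (simp add: J_def sum.If_cases Int_def)
  qed
  have "solution V E a b J"
    unfolding solution_def
  proof (intro conjI ballI)
    show "(\<Sum>e\<in>J. a v e) = b v" if "v \<in> V" for v
      using sol[of "Inl v"] that by (simp add: sum2 a'_simps a_def V'_def b'_def InlI)
  qed (auto simp: J_def)
  moreover have "{e \<in> E. x e = 1} \<subseteq> J" using J'(2) by (auto simp: J_def x'_def E'_def)
  moreover have "J \<subseteq> {e \<in> E. x e \<noteq> 0}" using J'(3) by (auto simp: J_def x'_def E'_def)
  moreover have "sum c J \<le> (\<Sum>e\<in>E. c e * x e)"
    using J'(4) by (simp add: sum2 sumE c'_def x'_def)
  ultimately show ?thesis by blast
qed

section \<open>Prefix sums of quarter-turn symmetric matrices\<close>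

text \<open>Nonzero entries that alternate and start and end with 1 make the prefix sums jump
  between 0 and 1. The ASM conditions thus become bounds and equations for prefix sums.\<close>

lemma asm_line_iff_partial_sums:
  "asm_line n a \<longleftrightarrow> (\<forall>j\<le>n. (\<Sum>m = 1..j. a m) \<in> {0, 1}) \<and> (\<Sum>m = 1..n. a m) = 1"
  (is "_ \<longleftrightarrow> ?R")
proof
  assume A: "asm_line n a"
  \<comment> \<open>\<open>i\<close> is the position of the last nonzero entry up to
    \<open>j\<close>; the invariant says that the prefix sum is 1 exactly if this entry is
    1.\<close>
  define last where "last = (\<lambda>j i. i \<in> {1..j} \<and> a i \<noteq> 0 \<and> (\<forall>m\<in>{i<..j}. a m = 0))"
  have inv: "((\<Sum>m = 1..j. a m) = 0 \<and> ((\<forall>m\<in>{1..j}. a m = 0) \<or> (\<exists>i. last j i \<and> a i = -1))) \<or>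
      ((\<Sum>m = 1..j. a m) = 1 \<and> (\<exists>i. last j i \<and> a i = 1))" if "j \<le> n" for j
    using that
  proof (induction j)
    case (Suc j)
    show ?case
    proof (cases "a (Suc j) = 0")
      case True
      have "last (Suc j) i" if "last j i" for i
        using that True by (auto simp: last_def le_Suc_eq)
      then show ?thesis using Suc True by (auto simp: le_Suc_eq)
    next
      case False
      have lastS: "last (Suc j) (Suc j)" using False by (simp add: last_def)
      have nxt: "a (Suc j) = - a i" if "last j i" for i
      proof -
        have "{i<..<Suc j} = {i<..j}" by auto
        then show ?thesis using that A False Suc.prems unfolding asm_line_def last_def by force
      qed
      have fst1: "a (Suc j) = 1" if "\<forall>m\<in>{1..j}. a m = 0"
      proof -
        have "{1..<Suc j} = {1..j}" by auto
        then show ?thesis using that A False Suc.prems unfolding asm_line_def by force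
      qed
      show ?thesis using Suc fst1 nxt lastS by fastforce
    qed
  qed simp
  obtain i0 where "i0 \<in> {1..n}" "a i0 \<noteq> 0" using A by (auto simp: asm_line_def)
  moreover have "a i = 1" if "last n i" for i
    using that A by (auto simp: asm_line_def last_def)
  ultimately have "(\<Sum>m = 1..n. a m) = 1" using inv[of n] by force
  then show ?R using inv by blast
next
  assume R: ?R
  define S where "S = (\<lambda>j. \<Sum>m = 1..j. a m)"
  have S0: "S 0 = 0" and S_Suc: "S (Suc j) = S j + a (Suc j)" for j by (auto simp: S_def)
  have S01: "S j = 0 \<or> S j = 1" if "j \<le> n" for j using R that by (auto simp: S_def)
  have S01p: "S (j - 1) = 0 \<or> S (j - 1) = 1" if "j \<le> n" for j
    by (rule S01) (use that in linarith)
  have Sn: "S n = 1" using R by (simp add: S_def)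
  have const: "S j = S i" if "i \<le> j" "\<forall>m\<in>{i<..j}. a m = 0" for i j
  proof -
    have "S j = S i + (\<Sum>m\<in>{i<..j}. a m)"
    proof -
      have "{1..j} = {1..i} \<union> {i<..j}" using that(1) by auto
      moreover have "sum a ({1..i} \<union> {i<..j}) = sum a {1..i} + sum a {i<..j}"
        by (rule sum.union_disjoint) auto
      ultimately show ?thesis by (simp add: S_def)
    qed
    then show ?thesis using that(2) by simp
  qed
  have a_eq: "a i = S i - S (i - 1)" if "1 \<le> i" for i using S_Suc[of "i - 1"] that by simp
  show "asm_line n a"
    unfolding asm_line_def
  proof (intro conjI ballI impI)
    show "a i \<in> {0, 1, -1}" if "i \<in> {1..n}" for i
      using a_eq[of i] S01[of i] S01p[of i] that by auto
    show "\<exists>i\<in>{1..n}. a i \<noteq> 0"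
    proof (rule ccontr)
      assume "\<not> ?thesis"
      then have "S n = S 0" by (intro const) auto
      then show False using S0 Sn by simp
    qed
    show "a i = 1" if "i \<in> {1..n}" "a i \<noteq> 0 \<and> (\<forall>m\<in>{1..<i}. a m = 0)" for i
    proof -
      have "S (i - 1) = S 0" using that by (intro const) auto
      then show ?thesis using a_eq[of i] S01[of i] S0 that by auto
    qed
    show "a i = 1" if "i \<in> {1..n}" "a i \<noteq> 0 \<and> (\<forall>m\<in>{i<..n}. a m = 0)" for i
    proof -
      have "S n = S i" using that by (intro const) auto
      then show ?thesis using a_eq[of i] S01p[of i] Sn that by auto
    qed
    show "a j = - a i"
      if "i \<in> {1..n}" "j \<in> {1..n}" "i < j \<and> a i \<noteq> 0 \<and> a j \<noteq> 0 \<and> (\<forall>m\<in>{i<..<j}. a m = 0)" for i j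
    proof -
      have "S (j - 1) = S i" using that by (intro const) auto
      then show ?thesis
        using a_eq[of i] a_eq[of j] S01[of i] S01p[of i] S01[of j] that by auto
    qed
  qed
qed

text \<open>A prefix sum of the reversed line is 1 minus a prefix sum of the line. Half turns
  reverse rows, and quarter turns make reversed rows of columns.\<close>

lemma asm_line_reverse:
  assumes "asm_line n a"
  shows "asm_line n (\<lambda>i. a (n + 1 - i))"
proof -
  have R: "\<forall>j\<le>n. (\<Sum>m = 1..j. a m) \<in> {0, 1}" "(\<Sum>m = 1..n. a m) = 1"
    using assms by (auto simp: asm_line_iff_partial_sums)
  have rev: "(\<Sum>m = 1..j. a (n + 1 - m)) = 1 - (\<Sum>m = 1..n - j. a m)" if "j \<le> n" for j
  proof -
    have "(\<Sum>m = 1..j. a (n + 1 - m)) = (\<Sum>m\<in>{n - j<..n}. a m)"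
      by (rule sum.reindex_bij_witness[of _ "\<lambda>m. n + 1 - m" "\<lambda>m. n + 1 - m"]) (use that in auto)
    moreover have "{1..n} = {1..n - j} \<union> {n - j<..n}" using that by auto
    moreover have "sum a ({1..n - j} \<union> {n - j<..n}) = sum a {1..n - j} + sum a {n - j<..n}"
      by (rule sum.union_disjoint) auto
    ultimately show ?thesis using R(2) by simp
  qed
  show ?thesis
    unfolding asm_line_iff_partial_sums
  proof (intro conjI allI impI)
    fix j assume "j \<le> n"
    then show "(\<Sum>m = 1..j. a (n + 1 - m)) \<in> {0, 1}" using rev[of j] R(1)[rule_format, of "n - j"] by auto
  next
    show "(\<Sum>m = 1..n. a (n + 1 - m)) = 1" using rev[of n] by simp
  qed
qed

lemma asm_line_cong: "(\<And>i. i \<in> {1..n} \<Longrightarrow> a i = b i) \<Longrightarrow> asm_line n a = asm_line n b"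
  unfolding asm_line_iff_partial_sums
proof -
  assume *: "\<And>i. i \<in> {1..n} \<Longrightarrow> a i = b i"
  have "(\<Sum>m = 1..j. a m) = (\<Sum>m = 1..j. b m)" if "j \<le> n" for j
    using * that by (intro sum.cong) auto
  then show "((\<forall>j\<le>n. sum a {1..j} \<in> {0, 1}) \<and> sum a {1..n} = 1) =
    ((\<forall>j\<le>n. sum b {1..j} \<in> {0, 1}) \<and> sum b {1..n} = 1)" by auto
qed

section \<open>Positions on lines and the cells they visit\<close>

text \<open>
  The cell of the core whose entry is the increment of the prefix sum at position \<open>j\<close> of line \<open>i\<close>.
\<close>

definition line_cell :: "nat \<Rightarrow> nat \<times> nat \<Rightarrow> nat \<times> nat" where
  "line_cell n = (\<lambda>(i, j). if j \<le> n div 2 then (i, j) else (n + 1 - j, i))"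

lemma z_0: "z n y (i, 0) = 0"
  by (simp add: z_def)

lemma z_Suc: "z n y (i, Suc j) = z n y (i, j) + y (line_cell n (i, Suc j))"
proof (cases "Suc j \<le> n div 2")
  case True
  then show ?thesis by (simp add: z_def line_cell_def min_def)
next
  case False
  then have "min (Suc j) (n div 2) = n div 2" "min j (n div 2) = n div 2" by auto
  moreover have "{n div 2 + 1..Suc j} = insert (Suc j) {n div 2 + 1..j}" using False by auto
  ultimately show ?thesis using False by (simp add: z_def line_cell_def)
qed

lemma mem_Ctilde:
  "(i, j) \<in> Ctilde n \<longleftrightarrow> 1 \<le> i \<and> 1 \<le> j \<and> (i \<le> n div 2 \<and> j \<le> n \<or> odd n \<and> i = n div 2 + 1 \<and> j \<le> n div 2)"
  by (auto simp: Ctilde_def)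

lemma mem_core_idx:
  "(i, j) \<in> core_idx n \<longleftrightarrow> 1 \<le> i \<and> 1 \<le> j \<and> i \<le> (n + 1) div 2 \<and> j \<le> n div 2"
  by (auto simp: core_idx_def)

lemma finite_Ctilde: "finite (Ctilde n)"
  by (simp add: Ctilde_def)

lemma finite_core_idx: "finite (core_idx n)"
  by (simp add: core_idx_def)

lemma line_cell_core: "p \<in> Ctilde n \<Longrightarrow> line_cell n p \<in> core_idx n"
  by (cases p) (auto simp: line_cell_def mem_Ctilde mem_core_idx)

lemma line_cell_eq_iff:
  assumes "p \<in> Ctilde n" "(i, j) \<in> core_idx n"
  shows "line_cell n p = (i, j) \<longleftrightarrow> p = (i, j) \<or> p = (j, n + 1 - i)"
  using assms by (cases p) (auto simp: line_cell_def mem_Ctilde mem_core_idx)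

lemma core_positions:
  assumes "(i, j) \<in> core_idx n"
  shows "(i, j) \<in> Ctilde n" "(j, n + 1 - i) \<in> Ctilde n" "(i, j) \<noteq> (j, n + 1 - i)"
    "line_cell n (i, j) = (i, j)" "line_cell n (j, n + 1 - i) = (i, j)"
    "j \<le> n div 2" "\<not> n + 1 - i \<le> n div 2"
  using assms by (auto simp: line_cell_def mem_Ctilde mem_core_idx)

text \<open>By the quarter turn, \<open>X (n + 1 - j, i) = X (i, j)\<close>: column \<open>i\<close>
  of the core, read upwards, is the continuation of row \<open>i\<close> beyond column
  \<open>n div 2\<close>.\<close>

lemma QTSASM_partial_sums:
  assumes X: "is_QTSASM n X" and p: "(i, j) \<in> Ctilde n"
  shows "z n (\<lambda>p. real_of_int (X p)) (i, j) = real_of_int (\<Sum>j' = 1..j. X (i, j'))"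
proof -
  have sym: "X (a, b) = X (b, n + 1 - a)" if "a \<in> {1..n}" "b \<in> {1..n}" for a b
    using X that by (auto simp: is_QTSASM_def)
  have "j' \<le> j \<Longrightarrow> z n (\<lambda>p. real_of_int (X p)) (i, j') = real_of_int (\<Sum>m = 1..j'. X (i, m))" for j'
  proof (induction j')
    case 0
    then show ?case by (simp add: z_0)
  next
    case (Suc j')
    have "X (line_cell n (i, Suc j')) = X (i, Suc j')"
      using Suc.prems p sym[of "n + 1 - Suc j'" i] by (auto simp: line_cell_def mem_Ctilde)
    then show ?case using Suc by (simp add: z_Suc)
  qed
  then show ?thesis by simp
qed

text \<open>The prefix sums determine the core, the quarter turn determines the rest except for the
  centre. Rows up to \<open>k\<close> are valid by assumption, lower rows are their half turns and
  columns their quarter turns; only the middle row needs its own argument.\<close>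

lemma QTSASM_from_prefix_sums:
  fixes Z :: "nat \<times> nat \<Rightarrow> int"
  assumes Z01: "\<And>p. Z p \<in> {0, 1}" and Z0: "\<And>i. Z (i, 0) = 0"
    and Zn: "\<And>i. 1 \<le> i \<Longrightarrow> i \<le> n div 2 \<Longrightarrow> Z (i, n) = 1"
    and Zeq: "\<And>i j. (i, j) \<in> core_idx n \<Longrightarrow> Z (i, j) - Z (i, j - 1) = Z (j, n + 1 - i) - Z (j, n - i)"
  shows "\<exists>X. is_QTSASM n X \<and> (\<forall>(i, j) \<in> core_idx n. X (i, j) = Z (i, j) - Z (i, j - 1))"
proof -
  define k where "k = n div 2"
  define l where "l = (n + 1) div 2"
  have kl: "n = k + l" "l = k \<or> l = k + 1" by (auto simp: k_def l_def)
  define Y where "Y = (\<lambda>(i, j). Z (i, j) - Z (i, j - 1))"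
  \<comment> \<open>For odd \<open>n\<close> the middle row is invariant under the half turn, so
    each half sums to \<open>Z (k + 1, k)\<close> and the centre must be 1 minus twice that
    value.\<close>
  define X where "X = (\<lambda>(i, j). if i \<le> l \<and> j \<le> k then Y (i, j) else if i \<le> k then Y (n + 1 - j, i)
     else if l < j then Y (n + 1 - i, n + 1 - j) else if l < i then Y (j, n + 1 - i) else 1 - 2 * Z (k + 1, k))"
  have sym: "X (i, j) = X (j, n + 1 - i)" if ij: "i \<in> {1..n}" "j \<in> {1..n}" for i j
  proof -
    consider "i \<le> l" "j \<le> k" | "i \<le> k" "k < j" | "k < i" "l < j" | "l < i" "j \<le> l" | "i = k + 1" "j = k + 1" "l = k + 1"
      using kl by linarith
    then show ?thesis by cases (use kl ij in \<open>auto simp: X_def\<close>)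
  qed
  have row: "X (i, j) = Z (i, j) - Z (i, j - 1)" if "1 \<le> i" "i \<le> k" "1 \<le> j" "j \<le> n" for i j
  proof (cases "j \<le> k")
    case True
    then show ?thesis using that kl by (auto simp: X_def Y_def)
  next
    case False
    then have "(n + 1 - j, i) \<in> core_idx n" using that kl by (auto simp: mem_core_idx k_def[symmetric] l_def[symmetric])
    then have "Y (n + 1 - j, i) = Z (i, n + 1 - (n + 1 - j)) - Z (i, n - (n + 1 - j))"
      using Zeq by (simp add: Y_def)
    moreover have "n + 1 - (n + 1 - j) = j" "n - (n + 1 - j) = j - 1" using that by auto
    ultimately show ?thesis using that False by (auto simp: X_def)
  qed
  have upper: "asm_line n (\<lambda>j. X (i, j))" if i: "1 \<le> i" "i \<le> k" for i
  proof -
    have "(\<Sum>m = 1..j. X (i, m)) = Z (i, j)" if "j \<le> n" for j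
      using that by (induction j) (auto simp: Z0 row[OF i])
    then show ?thesis unfolding asm_line_iff_partial_sums using Z01 Zn[of i] i by (auto simp: k_def)
  qed
  have half: "X (i, j) = X (n + 1 - i, n + 1 - j)" if "i \<in> {1..n}" "j \<in> {1..n}" for i j
  proof -
    have "n + 1 - i \<in> {1..n}" using that by auto
    then show ?thesis using sym[OF that] sym[of j "n + 1 - i"] that by simp
  qed
  have middle: "asm_line n (\<lambda>j. X (i, j))" if i: "l = k + 1" "i = k + 1" for i
  proof -
    define S where "S = (\<lambda>j. \<Sum>m = 1..j. X (i, m))"
    have n: "n = 2 * k + 1" using i kl by simp
    have S1: "S j = Z (i, j)" if "j \<le> k" for j
      using that by (induction j) (auto simp: S_def Z0 X_def Y_def i)
    have c: "X (i, k + 1) = 1 - 2 * Z (k + 1, k)" using i by (simp add: X_def)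
    \<comment> \<open>Beyond the centre the prefix sums are the complements of those before it, in
      mirrored order, so they stay in \<open>{0, 1}\<close>.\<close>
    have S2: "S (k + 1 + t) = 1 - Z (i, k - t)" if "t \<le> k" for t
      using that
    proof (induction t)
      case 0
      have "S (k + 1) = S k + X (i, k + 1)" by (simp add: S_def)
      then show ?case using S1[of k] c i by simp
    next
      case (Suc t)
      have "S (k + 1 + Suc t) = S (k + 1 + t) + X (i, k + 1 + Suc t)" by (simp add: S_def)
      moreover have "X (i, k + 1 + Suc t) = X (i, k - t)"
        using half[of i "k + 1 + Suc t"] Suc.prems i n by simp
      moreover have "X (i, k - t) = Z (i, k - t) - Z (i, k - t - 1)"
        using i by (simp add: X_def Y_def)
      ultimately show ?case using Suc by simp
    qed
    have "S j \<in> {0, 1}" if "j \<le> n" for j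
    proof (cases "j \<le> k")
      case True
      then show ?thesis using S1 Z01 by simp
    next
      case False
      then have "S j = 1 - Z (i, k - (j - (k + 1)))" using S2[of "j - (k + 1)"] that n by simp
      then show ?thesis using Z01[of "(i, k - (j - (k + 1)))"] by auto
    qed
    moreover have "S n = 1" using S2[of k] n Z0 by (simp add: mult_2)
    ultimately show ?thesis unfolding asm_line_iff_partial_sums S_def by blast
  qed
  have rows: "asm_line n (\<lambda>j. X (i, j))" if i: "i \<in> {1..n}" for i
  proof -
    consider "i \<le> k" | "i = k + 1" "l = k + 1" | "l < i" using kl i by fastforce
    then show ?thesis
    proof cases
      case 1
      then show ?thesis using upper i by simp
    next
      case 2
      then show ?thesis using middle by simp
    next
      case 3
      then have "asm_line n (\<lambda>j. X (n + 1 - i, n + 1 - j))"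
        using i kl by (intro asm_line_reverse upper) auto
      moreover have "X (i, j) = X (n + 1 - i, n + 1 - j)" if "j \<in> {1..n}" for j
        using half i that by blast
      ultimately show ?thesis by (subst asm_line_cong) auto
    qed
  qed
  have cols: "asm_line n (\<lambda>i. X (i, j))" if j: "j \<in> {1..n}" for j
  proof -
    have "asm_line n (\<lambda>i. X (j, n + 1 - i))" using asm_line_reverse[OF rows[OF j]] by simp
    moreover have "X (i, j) = X (j, n + 1 - i)" if "i \<in> {1..n}" for i using sym that j by blast
    ultimately show ?thesis by (subst asm_line_cong) auto
  qed
  have "is_QTSASM n X"
    unfolding is_QTSASM_def is_ASM_def using rows cols sym by blast
  moreover have "\<forall>(i, j) \<in> core_idx n. X (i, j) = Z (i, j) - Z (i, j - 1)"
    by (auto simp: mem_core_idx X_def Y_def k_def l_def)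
  ultimately show ?thesis by blast
qed

section \<open>The cell equations as a system of edges with two ends\<close>

definition out_coeff :: "nat \<Rightarrow> nat \<times> nat \<Rightarrow> nat \<times> nat \<Rightarrow> int" where
  "out_coeff n v p =
     (if p \<in> Ctilde n \<and> line_cell n p = v then if snd p \<le> n div 2 then 1 else -1 else 0)"

text \<open>The equation of a cell equates the increments on the two lines through it, with sign 1
  on the row and -1 on the column. A position is an edge from its own cell, where its prefix sum
  ends the increment, to the cell of its successor, where it is subtracted. The last position of a
  line has no successor, hence only one end.\<close>

definition in_coeff :: "nat \<Rightarrow> nat \<times> nat \<Rightarrow> nat \<times> nat \<Rightarrow> int" where
  "in_coeff n v p = - out_coeff n v (fst p, Suc (snd p))"

definition cell_coeff :: "nat \<Rightarrow> nat \<times> nat \<Rightarrow> nat \<times> nat \<Rightarrow> int" where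
  "cell_coeff n = (\<lambda>v p. out_coeff n v p + in_coeff n v p)"

lemma sum_out_coeff:
  fixes h :: "nat \<times> nat \<Rightarrow> 'a :: comm_ring_1"
  assumes v: "(i, j) \<in> core_idx n"
  shows "(\<Sum>p\<in>Ctilde n. of_int (out_coeff n (i, j) p) * h p) = h (i, j) - h (j, n + 1 - i)"
proof -
  note c = core_positions[OF v]
  have "(\<Sum>p\<in>Ctilde n. of_int (out_coeff n (i, j) p) * h p) =
      (\<Sum>p\<in>{(i, j), (j, n + 1 - i)}. of_int (out_coeff n (i, j) p) * h p)"
  proof (rule sum.mono_neutral_right)
    show "\<forall>p\<in>Ctilde n - {(i, j), (j, n + 1 - i)}. of_int (out_coeff n (i, j) p) * h p = 0"
      using line_cell_eq_iff[OF _ v] by (auto simp: out_coeff_def)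
  qed (use c finite_Ctilde in auto)
  also have "\<dots> = of_int (out_coeff n (i, j) (i, j)) * h (i, j) +
      of_int (out_coeff n (i, j) (j, n + 1 - i)) * h (j, n + 1 - i)"
    using c(3) by simp
  also have "out_coeff n (i, j) (i, j) = 1" using c by (simp add: out_coeff_def)
  also have "out_coeff n (i, j) (j, n + 1 - i) = -1" using c by (simp add: out_coeff_def)
  finally show ?thesis by simp
qed

text \<open>A shift along the lines turns \<open>in_coeff\<close> into \<open>out_coeff\<close>; the
  boundary terms vanish since \<open>g (i, 0) = 0\<close> and \<open>out_coeff\<close> is 0 outside
  \<open>Ctilde n\<close>.\<close>

lemma sum_cell_coeff:
  fixes g :: "nat \<times> nat \<Rightarrow> 'a :: comm_ring_1"
  assumes v: "(i, j) \<in> core_idx n" and g0: "\<And>i. g (i, 0) = 0"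
  shows "(\<Sum>p\<in>Ctilde n. of_int (cell_coeff n (i, j) p) * g p) =
    (g (i, j) - g (i, j - 1)) - (g (j, n + 1 - i) - g (j, n - i))"
proof -
  let ?v = "(i, j)"
  have "(\<Sum>p\<in>Ctilde n. of_int (in_coeff n ?v p) * g p) =
      (\<Sum>p\<in>Ctilde n. of_int (- out_coeff n ?v p) * g (fst p, snd p - 1))"
  proof (rule sum.reindex_bij_witness_not_neutral
      [where S' = "{p \<in> Ctilde n. (fst p, Suc (snd p)) \<notin> Ctilde n}" and T' = "{p \<in> Ctilde n. snd p = 1}"
        and j = "\<lambda>p. (fst p, Suc (snd p))" and i = "\<lambda>p. (fst p, snd p - 1)"])
    show "(fst a, snd a - 1) \<in> Ctilde n - {p \<in> Ctilde n. (fst p, Suc (snd p)) \<notin> Ctilde n}"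
      if "a \<in> Ctilde n - {p \<in> Ctilde n. snd p = 1}" for a
      using that by (cases a) (auto simp: mem_Ctilde)
  qed (use finite_Ctilde g0 in \<open>auto simp: in_coeff_def out_coeff_def mem_Ctilde\<close>)
  also have "\<dots> = - (\<Sum>p\<in>Ctilde n. of_int (out_coeff n ?v p) * g (fst p, snd p - 1))"
    by (simp add: sum_negf)
  also have "(\<Sum>p\<in>Ctilde n. of_int (out_coeff n ?v p) * g (fst p, snd p - 1)) =
      g (i, j - 1) - g (j, n - i)"
    using sum_out_coeff[OF v, of "\<lambda>p. g (fst p, snd p - 1)"] by simp
  finally have "(\<Sum>p\<in>Ctilde n. of_int (in_coeff n ?v p) * g p) = - (g (i, j - 1) - g (j, n - i))" .
  then show ?thesis
    using sum_out_coeff[OF v, of g] by (simp add: cell_coeff_def distrib_right sum.distrib)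
qed

lemma z_core:
  assumes "(i, j) \<in> core_idx n"
  shows "z n y (i, j) - z n y (i, j - 1) = y (i, j)"
    and "z n y (j, n + 1 - i) - z n y (j, n - i) = y (i, j)"
proof -
  note c = core_positions[OF assms]
  have "Suc (j - 1) = j" "Suc (n - i) = n + 1 - i" using assms by (auto simp: mem_core_idx)
  then show "z n y (i, j) - z n y (i, j - 1) = y (i, j)"
    "z n y (j, n + 1 - i) - z n y (j, n - i) = y (i, j)"
    using z_Suc[of n y i "j - 1"] z_Suc[of n y j "n - i"] c by auto
qed

lemma z_equation:
  assumes "v \<in> core_idx n"
  shows "(\<Sum>p\<in>Ctilde n. real_of_int (cell_coeff n v p) * z n y p) = 0"
proof -
  obtain i j where v: "v = (i, j)" by (cases v)
  show ?thesis
    using sum_cell_coeff[of i j n "z n y"] z_core[of i j n y] assms unfolding v by (simp add: z_0)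
qed

abbreviation cell_cut :: "nat \<Rightarrow> (nat \<times> nat) set \<Rightarrow> (nat \<times> nat) set" where
  "cell_cut n \<equiv> odd_cut (cell_coeff n) (Ctilde n)"

text \<open>Places beyond the end of a line count as outside \<open>U\<close>, so the last position
  is in the cut exactly if its cell is in \<open>U\<close>. This matches the suffix sums in
  \<open>parity_signs\<close>.\<close>

definition in_side :: "nat \<Rightarrow> (nat \<times> nat) set \<Rightarrow> nat \<times> nat \<Rightarrow> bool" where
  "in_side n U p \<longleftrightarrow> p \<in> Ctilde n \<and> line_cell n p \<in> U"

lemma mem_odd_cut_cells:
  assumes "U \<subseteq> core_idx n"
  shows "(i, j) \<in> cell_cut n U \<longleftrightarrow>
     (i, j) \<in> Ctilde n \<and> in_side n U (i, j) \<noteq> in_side n U (i, Suc j)"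
proof -
  have fin: "finite U" using assms finite_core_idx finite_subset by blast
  have "odd (\<Sum>v\<in>U. out_coeff n v p) \<longleftrightarrow> in_side n U p" for p
  proof -
    have "(\<Sum>v\<in>U. out_coeff n v p) =
        (\<Sum>v\<in>U. if line_cell n p = v then (if p \<in> Ctilde n then if snd p \<le> n div 2 then 1 else -1 else 0) else 0)"
      by (rule sum.cong) (auto simp: out_coeff_def)
    then show ?thesis using fin by (simp add: in_side_def)
  qed
  moreover have "(\<Sum>v\<in>U. cell_coeff n v (i, j)) = (\<Sum>v\<in>U. out_coeff n v (i, j)) - (\<Sum>v\<in>U. out_coeff n v (i, Suc j))"
    by (simp add: cell_coeff_def in_coeff_def sum_subtractf)
  ultimately show ?thesis by (auto simp: odd_cut_def)
qed

lemma mem_Ctilde_row: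
  assumes "(i, j0) \<in> Ctilde n"
  shows "(i, j) \<in> Ctilde n \<longleftrightarrow> 1 \<le> j \<and> j \<le> row_len n i"
proof (cases "i \<le> n div 2")
  case True
  then show ?thesis using assms by (auto simp: mem_Ctilde row_len_def)
next
  case False
  then show ?thesis using assms by (simp add: mem_Ctilde row_len_def)
qed

text \<open>Read from its end, the line starts outside \<open>U\<close> and changes sides exactly
  where \<open>s\<close> is odd.\<close>

lemma odd_suffix_sum:
  assumes cut: "\<And>j. (i, j) \<in> Ctilde n \<Longrightarrow> odd (s (i, j) :: int) \<longleftrightarrow> in_side n U (i, j) \<noteq> in_side n U (i, Suc j)"
    and p: "(i, j) \<in> Ctilde n"
  shows "odd (\<Sum>j' = j..row_len n i. s (i, j')) \<longleftrightarrow> in_side n U (i, j)"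
proof -
  note row = mem_Ctilde_row[OF p]
  have "j \<le> Suc (row_len n i)" "1 \<le> j" using row[of j] p by auto
  then show ?thesis
  proof (induction j rule: inc_induct)
    case base
    then show ?case using row by (simp add: in_side_def)
  next
    case (step m)
    have "(\<Sum>j' = m..row_len n i. s (i, j')) = s (i, m) + (\<Sum>j' = Suc m..row_len n i. s (i, j'))"
      using step by (simp add: sum.atLeast_Suc_atMost)
    then show ?case using step cut[of m] row[of m] by auto
  qed
qed

text \<open>The parities of the suffix sums select a set of positions. The condition defining
  \<open>parity_signs\<close> says that the two positions of each cell agree, so this is a set of
  cells.\<close>

lemma parity_sign_support:
  assumes s: "s \<in> parity_signs n"
  obtains U where "U \<subseteq> core_idx n" "{p \<in> Ctilde n. s p \<noteq> 0} = cell_cut n U"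
proof -
  have s01: "s p = 0 \<or> s p = 1 \<or> s p = -1" if "p \<in> Ctilde n" for p
    using s that by (auto simp: parity_signs_def PiE_iff)
  have par: "even ((\<Sum>j' = j..row_len n i. s (i, j')) + (\<Sum>i' = n + 1 - i..n. s (j, i')))"
    if "(i, j) \<in> core_idx n" for i j
    using s that unfolding parity_signs_def by blast
  define U where "U = {(i, j) \<in> core_idx n. odd (\<Sum>j' = j..row_len n i. s (i, j'))}"
  have side: "in_side n U (i, j) \<longleftrightarrow> odd (\<Sum>j' = j..row_len n i. s (i, j'))" if p: "(i, j) \<in> Ctilde n" for i j
  proof (cases "j \<le> n div 2")
    case True
    then have "line_cell n (i, j) = (i, j)" by (simp add: line_cell_def)
    then show ?thesis using line_cell_core[OF p] p by (simp add: in_side_def U_def)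
  next
    case False
    then have lc: "line_cell n (i, j) = (n + 1 - j, i)" by (simp add: line_cell_def)
    have "i \<le> n div 2" "j \<le> n" using p False by (auto simp: mem_Ctilde)
    then have "row_len n i = n" "n + 1 - (n + 1 - j) = j" by (auto simp: row_len_def)
    moreover have "(n + 1 - j, i) \<in> core_idx n" using line_cell_core[OF p] lc by simp
    ultimately show ?thesis using par[of "n + 1 - j" i] p lc by (auto simp: in_side_def U_def)
  qed
  have U: "U \<subseteq> core_idx n" by (auto simp: U_def)
  have "s (i, j) \<noteq> 0 \<longleftrightarrow> in_side n U (i, j) \<noteq> in_side n U (i, Suc j)" if p: "(i, j) \<in> Ctilde n" for i j
  proof -
    have j: "j \<le> row_len n i" using mem_Ctilde_row[OF p, of j] p by simp
    have "(\<Sum>j' = j..row_len n i. s (i, j')) = s (i, j) + (\<Sum>j' = Suc j..row_len n i. s (i, j'))"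
      using j by (simp add: sum.atLeast_Suc_atMost)
    moreover have "in_side n U (i, Suc j) \<longleftrightarrow> odd (\<Sum>j' = Suc j..row_len n i. s (i, j'))"
    proof (cases "(i, Suc j) \<in> Ctilde n")
      case True
      then show ?thesis using side by blast
    next
      case False
      then have "row_len n i < Suc j" using mem_Ctilde_row[OF p, of "Suc j"] by simp
      then show ?thesis using False by (simp add: in_side_def)
    qed
    ultimately show ?thesis using side[OF p] s01[OF p] by auto
  qed
  then have "{p \<in> Ctilde n. s p \<noteq> 0} = cell_cut n U"
    using mem_odd_cut_cells[OF U] by auto
  then show ?thesis using that U by blast
qed

text \<open>The parity condition depends on the support only, so the signs on a cut can be chosen
  freely.\<close>

lemma parity_signs_of_cut:
  assumes U: "U \<subseteq> core_idx n" and F: "F \<subseteq> cell_cut n U"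
  shows "(\<lambda>p\<in>Ctilde n. if p \<in> F then 1 else if p \<in> cell_cut n U then -1 else 0)
           \<in> parity_signs n"
proof -
  define s :: "nat \<times> nat \<Rightarrow> int" where
    "s = (\<lambda>p\<in>Ctilde n. if p \<in> F then 1 else if p \<in> cell_cut n U then -1 else 0)"
  have odd: "odd (s (i, j)) \<longleftrightarrow> in_side n U (i, j) \<noteq> in_side n U (i, Suc j)" if "(i, j) \<in> Ctilde n" for i j
    using that F mem_odd_cut_cells[OF U, of i j] by (auto simp: s_def)
  have "even ((\<Sum>j' = j..row_len n i. s (i, j')) + (\<Sum>i' = n + 1 - i..n. s (j, i')))"
    if v: "(i, j) \<in> core_idx n" for i j
  proof -
    note c = core_positions[OF v]
    have "row_len n j = n" using c by (simp add: row_len_def)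
    moreover have "in_side n U (i, j) \<longleftrightarrow> in_side n U (j, n + 1 - i)" using c by (simp add: in_side_def)
    ultimately show ?thesis
      using odd_suffix_sum[of i n s U j, OF odd c(1)] odd_suffix_sum[of j n s U "n + 1 - i", OF odd c(2)]
      unfolding even_add by metis
  qed
  then show ?thesis unfolding s_def[symmetric] by (auto simp: parity_signs_def s_def)
qed

section \<open>The description, the odd cut constraints and QTSASMs\<close>

lemma description_cut_constraints:
  assumes y: "satisfies_description n y"
  shows "cut_constraints (core_idx n) (Ctilde n) (cell_coeff n) (\<lambda>_. 0) (z n y)"
  unfolding cut_constraints_def
proof (intro allI impI)
  fix U F
  assume U: "U \<subseteq> core_idx n" and F: "F \<subseteq> cell_cut n U"
    and odd: "odd (int (card F) + (\<Sum>v\<in>U. 0))"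
  define D where "D = cell_cut n U"
  define s :: "nat \<times> nat \<Rightarrow> int" where "s = (\<lambda>p\<in>Ctilde n. if p \<in> F then 1 else if p \<in> D then -1 else 0)"
  have s: "s \<in> parity_signs n" unfolding s_def D_def by (rule parity_signs_of_cut[OF U F])
  have DC: "D \<subseteq> Ctilde n" "F \<subseteq> D" using F by (auto simp: D_def odd_cut_def)
  have fin: "finite D" by (rule finite_subset[OF DC(1) finite_Ctilde])
  define q where "q = card {i \<in> {1..n div 2}. s (i, n) = -1}"
  have "(\<Sum>p \<in> Ctilde n. real_of_int (s p) * z n y p) / 2
        \<le> real_of_int \<lfloor>(real (card {p \<in> Ctilde n. s p = 1}) - real q) / 2\<rfloor>"
    using y s unfolding satisfies_description_def q_def by blast
  moreover have "{p \<in> Ctilde n. s p = 1} = F" using DC by (auto simp: s_def)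
  ultimately have le: "(\<Sum>p \<in> Ctilde n. real_of_int (s p) * z n y p) / 2
        \<le> real_of_int \<lfloor>(real (card F) - real q) / 2\<rfloor>" by simp
  have "\<lfloor>(real (card F) - real q) / 2\<rfloor> = (int (card F) - int q) div 2"
    by (metis floor_divide_of_int_eq of_int_diff of_int_numeral of_int_of_nat_eq)
  \<comment> \<open>Either \<open>q = 0\<close> and the odd \<open>card F\<close> loses 1 in the
    rounding, or \<open>q\<close> itself supplies the loss.\<close>
  moreover have "2 * ((int (card F) - int q) div 2) \<le> int (card F) - 1"
    using odd by (simp; presburger)
  ultimately have "2 * \<lfloor>(real (card F) - real q) / 2\<rfloor> \<le> int (card F) - 1" by simp
  then have "2 * real_of_int \<lfloor>(real (card F) - real q) / 2\<rfloor> \<le> real (card F) - 1" by linarith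
  then have "(\<Sum>p \<in> Ctilde n. real_of_int (s p) * z n y p) \<le> real (card F) - 1" using le by linarith
  moreover have "(\<Sum>p \<in> Ctilde n. real_of_int (s p) * z n y p) = (\<Sum>p\<in>D. real_of_int (s p) * z n y p)"
    by (rule sum.mono_neutral_right) (use finite_Ctilde DC in \<open>auto simp: s_def\<close>)
  moreover have "deviation (z n y) D F = (\<Sum>p\<in>D. (if p \<in> F then 1 else 0) - real_of_int (s p) * z n y p)"
    unfolding deviation_def by (rule sum.cong) (use DC in \<open>auto simp: s_def\<close>)
  moreover have "(\<Sum>p\<in>D. if p \<in> F then 1 else 0) = real (card F)"
    using fin DC by (simp add: sum.If_cases Int_absorb1)
  ultimately show "1 \<le> deviation (z n y) (cell_cut n U) F"
    by (simp add: sum_subtractf D_def)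
qed

text \<open>A Chvatal-Gomory argument: for integral prefix sums the left side before halving is at
  most the numerator on the right, and it is even, since modulo 2 it is a sum of cell equations. So
  its half is an integer and stays below the floor.\<close>

lemma QTSASM_satisfies_description:
  assumes X: "is_QTSASM n X"
  shows "satisfies_description n (\<lambda>p. real_of_int (X p))"
proof -
  let ?y = "\<lambda>p. real_of_int (X p)"
  define Z where "Z = (\<lambda>p. \<Sum>j' = 1..snd p. X (fst p, j'))"
  have z: "z n ?y p = real_of_int (Z p)" if "p \<in> Ctilde n" for p
    using QTSASM_partial_sums[OF X, of "fst p" "snd p"] that by (simp add: Z_def)
  have line: "asm_line n (\<lambda>j. X (i, j))" if "i \<in> {1..n}" for i
    using X that by (auto simp: is_QTSASM_def is_ASM_def)
  have Z01: "Z p = 0 \<or> Z p = 1" if "p \<in> Ctilde n" for p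
  proof -
    have "fst p \<in> {1..n}" "snd p \<le> n" using that by (cases p; auto simp: mem_Ctilde elim!: oddE)+
    then show ?thesis using line[of "fst p"] unfolding asm_line_iff_partial_sums Z_def by auto
  qed
  have Zn: "Z (i, n) = 1" if "i \<in> {1..n div 2}" for i
    using line[of i] that unfolding asm_line_iff_partial_sums Z_def by auto
  have inn: "(i, n) \<in> Ctilde n" if "i \<in> {1..n div 2}" for i using that by (auto simp: mem_Ctilde)
  have "0 \<le> z n ?y p \<and> z n ?y p \<le> 1" if "p \<in> bounded_idx n" for p
    using that z[of p] Z01[of p] by (auto simp: bounded_idx_def)
  moreover have "z n ?y (i, n) = 1" if "i \<in> {1..n div 2}" for i
    using z[OF inn[OF that]] Zn[OF that] by simp
  moreover have "(\<Sum>p \<in> Ctilde n. real_of_int (s p) * z n ?y p) / 2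
        \<le> real_of_int \<lfloor>(real (card {p \<in> Ctilde n. s p = 1})
                          - real (card {i \<in> {1..n div 2}. s (i, n) = -1})) / 2\<rfloor>"
    if s: "s \<in> parity_signs n" for s
  proof -
    have s01: "s p = 0 \<or> s p = 1 \<or> s p = -1" if "p \<in> Ctilde n" for p
      using s that by (auto simp: parity_signs_def PiE_iff)
    define T where "T = (\<Sum>p\<in>Ctilde n. s p * Z p)"
    define B where "B = {i \<in> {1..n div 2}. s (i, n) = -1}"
    have "(\<Sum>p \<in> Ctilde n. real_of_int (s p) * z n ?y p) = real_of_int T"
      unfolding T_def of_int_sum by (rule sum.cong) (simp_all add: z)
    moreover have "T \<le> int (card {p \<in> Ctilde n. s p = 1}) - int (card B)"
    proof -
      \<comment> \<open>A coefficient -1 at the end \<open>(i, n)\<close> of a full line meets the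
        prefix sum 1, which accounts for the second indicator.\<close>
      have "T \<le> (\<Sum>p\<in>Ctilde n. (if s p = 1 then 1 else 0) - (if p \<in> (\<lambda>i. (i, n)) ` B then 1 else 0))"
        unfolding T_def
      proof (rule sum_mono)
        fix p assume p: "p \<in> Ctilde n"
        show "s p * Z p \<le> (if s p = 1 then 1 else 0) - (if p \<in> (\<lambda>i. (i, n)) ` B then 1 else 0)"
          using s01[OF p] Z01[OF p] Zn by (auto simp: B_def)
      qed
      also have "\<dots> = int (card {p \<in> Ctilde n. s p = 1}) - int (card ((\<lambda>i. (i, n)) ` B))"
      proof -
        have "(\<lambda>i. (i, n)) ` B \<subseteq> Ctilde n" using inn by (auto simp: B_def)
        moreover have "{p \<in> Ctilde n. s p = 1} = Ctilde n \<inter> {p. s p = 1}" by auto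
        ultimately show ?thesis using finite_Ctilde
          by (simp add: sum_subtractf sum.If_cases Int_absorb1)
      qed
      also have "card ((\<lambda>i. (i, n)) ` B) = card B" by (rule card_image) (simp add: inj_on_def)
      finally show ?thesis .
    qed
    moreover have "even T"
    proof -
      obtain U where U: "U \<subseteq> core_idx n" "{p \<in> Ctilde n. s p \<noteq> 0} = cell_cut n U"
        using parity_sign_support[OF s] by blast
      have "(\<Sum>p\<in>Ctilde n. (\<Sum>v\<in>U. cell_coeff n v p) * Z p) = (\<Sum>v\<in>U. \<Sum>p\<in>Ctilde n. cell_coeff n v p * Z p)"
        unfolding sum_distrib_right by (rule sum.swap)
      also have "\<dots> = 0"
      proof (rule sum.neutral, rule ballI)
        fix v assume "v \<in> U"
        then have "(\<Sum>p\<in>Ctilde n. real_of_int (cell_coeff n v p) * z n ?y p) = 0"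
          using U z_equation by blast
        then have "real_of_int (\<Sum>p\<in>Ctilde n. cell_coeff n v p * Z p) = 0"
          by (simp add: z)
        then show "(\<Sum>p\<in>Ctilde n. cell_coeff n v p * Z p) = 0" by linarith
      qed
      finally have "T = (\<Sum>p\<in>Ctilde n. (s p - (\<Sum>v\<in>U. cell_coeff n v p)) * Z p)"
        by (simp add: T_def left_diff_distrib sum_subtractf)
      also have "even \<dots>"
      proof (rule dvd_sum)
        fix p assume p: "p \<in> Ctilde n"
        then have "s p \<noteq> 0 \<longleftrightarrow> odd (\<Sum>v\<in>U. cell_coeff n v p)"
          using U(2) unfolding odd_cut_def by blast
        then have "even (s p - (\<Sum>v\<in>U. cell_coeff n v p))" using s01[OF p] by auto
        then show "even ((s p - (\<Sum>v\<in>U. cell_coeff n v p)) * Z p)" by simp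
      qed
      finally show ?thesis .
    qed
    then obtain t where "T = 2 * t" by (rule evenE)
    ultimately show ?thesis unfolding B_def[symmetric] by (simp add: le_floor_iff)
  qed
  ultimately show ?thesis unfolding satisfies_description_def by blast
qed

text \<open>
  The cut of all cells consists of the ends of the lines, where the prefix sums are 1 except for
  the half line \<open>k + 1\<close>.
\<close>

lemma last_position_integral:
  assumes y: "satisfies_description n y" and n: "odd n" "1 \<le> n div 2"
  shows "z n y (n div 2 + 1, n div 2) \<in> {0, 1}"
proof -
  define k where "k = n div 2"
  define D where "D = cell_cut n (core_idx n)"
  define L where "L = (\<lambda>i. (i, n)) ` {1..k}"
  let ?q = "(k + 1, k)"
  have q: "?q \<in> Ctilde n" using n by (simp add: mem_Ctilde k_def)
  have kn: "k < n" using n by (auto simp: k_def)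
  have "in_side n (core_idx n) p \<longleftrightarrow> p \<in> Ctilde n" for p
    using line_cell_core[of p n] by (auto simp: in_side_def)
  then have D1: "(i, j) \<in> D \<longleftrightarrow> (i, j) \<in> Ctilde n \<and> (i, Suc j) \<notin> Ctilde n" for i j
    using mem_odd_cut_cells[of "core_idx n" n i j] by (auto simp: D_def)
  have D: "D = insert ?q L"
  proof (intro set_eqI)
    fix p show "p \<in> D \<longleftrightarrow> p \<in> insert ?q L"
      using n kn by (cases p) (auto simp: D1 mem_Ctilde L_def k_def[symmetric])
  qed
  have qL: "?q \<notin> L" by (auto simp: L_def)
  have finL: "finite L" by (simp add: L_def)
  have cardL: "card L = k" unfolding L_def by (subst card_image) (auto simp: inj_on_def)
  have zL: "z n y p = 1" if "p \<in> L" for p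
    using y that by (auto simp: satisfies_description_def L_def k_def)
  have "?q \<in> bounded_idx n" using q by (auto simp: bounded_idx_def k_def)
  then have bnd: "0 \<le> z n y ?q" "z n y ?q \<le> 1" using y by (auto simp: satisfies_description_def)
  \<comment> \<open>\<open>F\<close> has odd size and contains \<open>L\<close>, so the deviation
    reduces to the term of \<open>?q\<close>, which is forced to be 1.\<close>
  define F where "F = (if odd k then L else insert ?q L)"
  have "odd (card F)" using cardL finL qL by (simp add: F_def)
  moreover have FD: "F \<subseteq> D" using D by (auto simp: F_def)
  ultimately have "1 \<le> deviation (z n y) D F"
    using description_cut_constraints[OF y] unfolding cut_constraints_def D_def by auto
  also have "deviation (z n y) D F = (if ?q \<in> F then 1 - z n y ?q else z n y ?q) + (\<Sum>p\<in>L. 0)"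
    unfolding deviation_def D using qL finL zL by (simp add: F_def)
  finally show ?thesis using bnd by (auto simp: k_def split: if_splits)
qed

lemma description_rounding:
  fixes c :: "nat \<times> nat \<Rightarrow> real"
  assumes y: "satisfies_description n y"
  shows "\<exists>X. is_QTSASM n X \<and>
    (\<Sum>v\<in>core_idx n. c v * real_of_int (X v)) \<le> (\<Sum>v\<in>core_idx n. c v * y v)"
proof -
  define x where "x = z n y"
  define C where "C = core_idx n"
  define E where "E = Ctilde n"
  define prev where "prev = (\<lambda>v :: nat \<times> nat. (fst v, snd v - 1))"
  \<comment> \<open>Summation by parts: an entry is the increment \<open>z v - z (prev v)\<close>,
    so costs of cells become costs of positions. In the first column \<open>prev v\<close> lies
    outside \<open>E\<close> and has prefix sum 0.\<close>
  define c' where "c' = (\<lambda>p. \<Sum>v\<in>C. c v * ((if p = v then 1 else 0) - (if p = prev v then 1 else 0)))"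
  have fin: "finite C" "finite E" by (auto simp: C_def E_def finite_core_idx finite_Ctilde)
  have c': "(\<Sum>p\<in>E. c' p * g p) = (\<Sum>v\<in>C. c v * (g v - g (prev v)))" if g0: "\<And>i. g (i, 0) = 0"
    for g :: "nat \<times> nat \<Rightarrow> real"
  proof -
    have "(\<Sum>p\<in>E. c' p * g p) =
        (\<Sum>v\<in>C. \<Sum>p\<in>E. c v * ((if p = v then g p else 0) - (if p = prev v then g p else 0)))"
      unfolding c'_def sum_distrib_right by (subst sum.swap) (intro sum.cong refl; auto)
    also have "\<dots> = (\<Sum>v\<in>C. c v * (g v - g (prev v)))"
    proof (rule sum.cong)
      fix v assume v: "v \<in> C"
      then have vE: "v \<in> E" using core_positions(1) by (cases v) (auto simp: C_def E_def)
      have pv: "prev v \<notin> E \<Longrightarrow> g (prev v) = 0"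
        using v g0 by (cases v) (auto simp: C_def E_def prev_def mem_Ctilde mem_core_idx)
      have "(\<Sum>p\<in>E. c v * ((if p = v then g p else 0) - (if p = prev v then g p else 0))) =
          c v * ((\<Sum>p\<in>E. if p = v then g p else 0) - (\<Sum>p\<in>E. if p = prev v then g p else 0))"
        by (simp add: sum_distrib_left[symmetric] sum_subtractf)
      then show "(\<Sum>p\<in>E. c v * ((if p = v then g p else 0) - (if p = prev v then g p else 0))) =
          c v * (g v - g (prev v))"
        using fin vE pv by auto
    qed simp
    finally show ?thesis .
  qed
  have bnd: "0 \<le> x p \<and> x p \<le> 1" if "p \<in> E" for p
  proof (cases "p \<in> bounded_idx n")
    case True
    then show ?thesis using y by (auto simp: satisfies_description_def x_def)
  next
    case False
    then have "z n y p = 1" using y that by (auto simp: satisfies_description_def bounded_idx_def E_def)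
    then show ?thesis by (simp add: x_def)
  qed
  have out: "(\<Sum>v\<in>C. \<bar>out_coeff n v p\<bar>) = (if p \<in> E then 1 else 0)" for p
  proof -
    have "(\<Sum>v\<in>C. \<bar>out_coeff n v p\<bar>) = (\<Sum>v\<in>C. if line_cell n p = v then (if p \<in> E then 1 else 0) else 0)"
      by (rule sum.cong) (auto simp: out_coeff_def E_def)
    then show ?thesis using fin line_cell_core[of p n] by (auto simp: C_def E_def)
  qed
  have inn: "(\<Sum>v\<in>C. \<bar>in_coeff n v p\<bar>) = (if (fst p, Suc (snd p)) \<in> E then 1 else 0)" for p
    using out by (simp add: in_coeff_def)
  have "\<exists>J. solution C E (\<lambda>v p. out_coeff n v p + in_coeff n v p) (\<lambda>_. 0) J \<and>
      {p \<in> E. x p = 1} \<subseteq> J \<and> J \<subseteq> {p \<in> E. x p \<noteq> 0} \<and> sum c' J \<le> (\<Sum>p\<in>E. c' p * x p)"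
  proof (rule edmonds_johnson[OF fin])
    show "\<bar>out_coeff n v p\<bar> \<le> 1" "\<bar>in_coeff n v p\<bar> \<le> 1" for v p
      by (auto simp: out_coeff_def in_coeff_def)
    show "0 \<le> x p \<and> x p \<le> 1" if "p \<in> E" for p by (rule bnd[OF that])
    show "(\<Sum>v\<in>C. \<bar>out_coeff n v p\<bar>) = 1 \<and> (\<Sum>v\<in>C. \<bar>in_coeff n v p\<bar>) = 1"
      if p: "p \<in> E" "x p \<noteq> 0" "x p \<noteq> 1" for p
    proof -
      obtain i j where ij: "p = (i, j)" by (cases p)
      \<comment> \<open>A position without successor has an integral value, by the equations for
        full lines and by \<open>last_position_integral\<close> for the half line; a fractional one
        therefore has both ends.\<close>
      have "(i, Suc j) \<in> E"
      proof (rule ccontr)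
        assume "(i, Suc j) \<notin> E"
        then consider "i \<in> {1..n div 2}" "j = n" | "odd n" "1 \<le> n div 2" "i = n div 2 + 1" "j = n div 2"
          using p(1) ij by (fastforce simp: E_def mem_Ctilde)
        then show False
        proof cases
          case 1
          then show False using y p(3) ij by (auto simp: satisfies_description_def x_def)
        next
          case 2
          then show False using last_position_integral[OF y] p ij by (auto simp: x_def)
        qed
      qed
      then show ?thesis using out inn p(1) ij by simp
    qed
    show "(\<Sum>p\<in>E. of_int (out_coeff n v p + in_coeff n v p) * x p) = of_int 0" if "v \<in> C" for v
      using z_equation[of v n y] that by (simp add: cell_coeff_def E_def C_def x_def)
    show "cut_constraints C E (\<lambda>v p. out_coeff n v p + in_coeff n v p) (\<lambda>_. 0) x"
      using description_cut_constraints[OF y] by (simp add: cell_coeff_def C_def E_def x_def)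
  qed
  then obtain J where J: "solution C E (cell_coeff n) (\<lambda>_. 0) J"
    "{p \<in> E. x p = 1} \<subseteq> J" "sum c' J \<le> (\<Sum>p\<in>E. c' p * x p)"
    unfolding cell_coeff_def by blast
  have JE: "J \<subseteq> E" using J(1) by (simp add: solution_def)
  define Z :: "nat \<times> nat \<Rightarrow> int" where "Z = (\<lambda>p. if p \<in> J then 1 else 0)"
  have Z0: "Z (i, 0) = 0" for i using JE by (auto simp: Z_def E_def mem_Ctilde)
  have Zn: "Z (i, n) = 1" if "1 \<le> i" "i \<le> n div 2" for i
  proof -
    have "z n y (i, n) = 1" using y that by (auto simp: satisfies_description_def)
    moreover have "(i, n) \<in> E" using that by (auto simp: E_def mem_Ctilde)
    ultimately show ?thesis using J(2) by (auto simp: Z_def x_def)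
  qed
  have Zsum: "(\<Sum>p\<in>E. f p * of_int (Z p)) = sum f J" for f :: "nat \<times> nat \<Rightarrow> 'r :: comm_ring_1"
  proof -
    have "(\<Sum>p\<in>E. f p * of_int (Z p)) = (\<Sum>p\<in>E. if p \<in> J then f p else 0)"
      by (rule sum.cong) (auto simp: Z_def)
    then show ?thesis using fin JE by (simp add: sum.If_cases Int_absorb1)
  qed
  have Zeq: "Z (i, j) - Z (i, j - 1) = Z (j, n + 1 - i) - Z (j, n - i)" if v: "(i, j) \<in> core_idx n" for i j
  proof -
    have "(\<Sum>p\<in>E. cell_coeff n (i, j) p * Z p) = 0"
      using J(1) v Zsum[of "cell_coeff n (i, j)"] by (simp add: solution_def C_def)
    then show ?thesis using sum_cell_coeff[OF v, of Z] Z0 by (simp add: E_def)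
  qed
  have "\<exists>X. is_QTSASM n X \<and> (\<forall>(i, j) \<in> core_idx n. X (i, j) = Z (i, j) - Z (i, j - 1))"
    by (rule QTSASM_from_prefix_sums) (use Z0 Zn Zeq in \<open>auto simp: Z_def\<close>)
  then obtain X where X: "is_QTSASM n X" "\<And>i j. (i, j) \<in> core_idx n \<Longrightarrow> X (i, j) = Z (i, j) - Z (i, j - 1)"
    by blast
  have "(\<Sum>v\<in>C. c v * real_of_int (X v)) = (\<Sum>v\<in>C. c v * (real_of_int (Z v) - real_of_int (Z (prev v))))"
    by (rule sum.cong) (auto simp: C_def prev_def X(2))
  also have "\<dots> = sum c' J" using c'[of "\<lambda>p. real_of_int (Z p)"] Z0 Zsum[of c'] by simp
  also have "\<dots> \<le> (\<Sum>p\<in>E. c' p * x p)" by (rule J(3))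
  also have "\<dots> = (\<Sum>v\<in>C. c v * (x v - x (prev v)))" by (rule c') (simp add: x_def z_0)
  also have "\<dots> = (\<Sum>v\<in>C. c v * y v)"
    by (rule sum.cong) (auto simp: C_def prev_def x_def z_core(1) simp del: One_nat_def)
  finally show ?thesis using X(1) unfolding C_def by blast
qed

section \<open>The two polytopes and their facets\<close>

lemma linear_functional_inner:
  fixes f :: "'a :: euclidean_space \<Rightarrow> real"
  assumes "linear f"
  shows "\<exists>a. \<forall>x. f x = a \<bullet> x"
  by (rule exI[of _ "adjoint f 1"]) (use adjoint_works[OF assms] in \<open>simp add: inner_commute\<close>)

text \<open>\<open>facet_of_polyhedron_explicit\<close> wants an irredundant representation relative
  to the affine hull. So \<open>A\<close> is replaced by the hull of \<open>S\<close> and the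
  inequalities by a minimal subfamily, each member of which gives one facet.\<close>

lemma facets_of_inequalities:
  fixes S :: "'a :: euclidean_space set" and f :: "'i \<Rightarrow> 'a \<Rightarrow> real"
  assumes I: "finite I" and A: "affine A" and lin: "\<And>i. i \<in> I \<Longrightarrow> linear (f i)"
    and S: "S = A \<inter> {x. \<forall>i\<in>I. f i x \<le> b i}"
  shows "finite {F. F facet_of S}" "card {F. F facet_of S} \<le> card I"
proof -
  have "finite {F. F facet_of S} \<and> card {F. F facet_of S} \<le> card I"
  proof (cases "S = {}")
    case True
    then have "{F. F facet_of S} = {}" using facet_of_imp_subset unfolding facet_of_def by auto
    then show ?thesis by (metis card.empty finite.emptyI le0)
  next
    case False
    have "\<exists>a. \<forall>x. f i x = a \<bullet> x" if "i \<in> I" for i using linear_functional_inner lin[OF that] by blast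
    then obtain a where a: "\<And>i x. i \<in> I \<Longrightarrow> f i x = a i \<bullet> x" by metis
    define H where "H = (\<lambda>i. {x. a i \<bullet> x \<le> b i})"
    define F0 where "F0 = H ` {i \<in> I. a i \<noteq> 0}"
    have hull: "affine hull S \<subseteq> A" using S A by (intro hull_minimal) auto
    \<comment> \<open>An inequality with zero normal holds everywhere because it holds at some point
      of \<open>S\<close>; the facet theorem requires nonzero normals.\<close>
    have zero: "H i = UNIV" if "i \<in> I" "a i = 0" for i
    proof -
      have "0 \<le> b i" using False S a that by force
      then show ?thesis using that by (simp add: H_def)
    qed
    have mem_S: "x \<in> S \<longleftrightarrow> x \<in> A \<and> (\<forall>i\<in>I. x \<in> H i)" for x using S a by (auto simp: H_def)
    have S0: "S = affine hull S \<inter> \<Inter>F0"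
    proof (intro subset_antisym subsetI)
      fix x assume x: "x \<in> S"
      then have "x \<in> affine hull S" by (rule hull_inc)
      then show "x \<in> affine hull S \<inter> \<Inter>F0" using x mem_S by (auto simp: F0_def)
    next
      fix x assume x: "x \<in> affine hull S \<inter> \<Inter>F0"
      have "x \<in> H i" if "i \<in> I" for i using x zero[OF that] that by (cases "a i = 0") (auto simp: F0_def)
      then show "x \<in> S" using mem_S x hull by blast
    qed
    have fin0: "finite F0" using I by (simp add: F0_def)
    define \<F> where "\<F> = {F. F \<subseteq> F0 \<and> S = affine hull S \<inter> \<Inter>F}"
    have "finite \<F>" "\<F> \<noteq> {}" using fin0 S0 by (auto simp: \<F>_def)
    then obtain F where F: "F \<in> \<F>" "\<And>F'. F' \<in> \<F> \<Longrightarrow> F' \<subseteq> F \<Longrightarrow> F = F'"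
      using finite_has_minimal[of \<F>] by metis
    have F0: "F \<subseteq> F0" "S = affine hull S \<inter> \<Inter>F" using F(1) by (auto simp: \<F>_def)
    have finF: "finite F" using F0 fin0 finite_subset by blast
    have "\<exists>c d. c \<noteq> 0 \<and> h = {x. c \<bullet> x \<le> d}" if "h \<in> F" for h
    proof -
      obtain i where "a i \<noteq> 0" "h = H i" using F0(1) \<open>h \<in> F\<close> by (auto simp: F0_def)
      then show ?thesis unfolding H_def by blast
    qed
    then obtain c d where cd: "\<And>h. h \<in> F \<Longrightarrow> c h \<noteq> 0 \<and> h = {x. c h \<bullet> x \<le> d h}" by metis
    have "S \<subset> affine hull S \<inter> \<Inter>F'" if "F' \<subset> F" for F'
    proof -
      have "S \<subseteq> affine hull S \<inter> \<Inter>F'" using F0(2) that by blast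
      moreover have "F' \<notin> \<F>" using F(2)[of F'] that by blast
      then have "S \<noteq> affine hull S \<inter> \<Inter>F'" using that F0(1) by (auto simp: \<F>_def)
      ultimately show ?thesis by blast
    qed
    from facet_of_polyhedron_explicit[OF finF F0(2) cd this]
    have facets: "{G. G facet_of S} = (\<lambda>h. S \<inter> {x. c h \<bullet> x = d h}) ` F" by auto
    have "card F \<le> card I"
    proof -
      have "card F \<le> card F0" using F0(1) fin0 by (rule card_mono[rotated])
      also have "\<dots> \<le> card {i \<in> I. a i \<noteq> 0}" unfolding F0_def using I by (intro card_image_le) simp
      also have "\<dots> \<le> card I" using I by (intro card_mono) auto
      finally show ?thesis .
    qed
    moreover have "card {G. G facet_of S} \<le> card F" unfolding facets by (rule card_image_le[OF finF])
    ultimately show ?thesis using finF by (simp add: facets)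
  qed
  then show "finite {F. F facet_of S}" "card {F. F facet_of S} \<le> card I" by blast+
qed

text \<open>Injective linear maps and translations preserve faces and affine dimension. This
  direction bounds the number of facets of the image from above.\<close>

lemma facet_of_affine_image:
  fixes L :: "'a :: euclidean_space \<Rightarrow> 'a"
  assumes L: "linear L" "inj L" and G: "G facet_of (\<lambda>x. t + L x) ` S"
  shows "\<exists>F. F facet_of S \<and> G = (\<lambda>x. t + L x) ` F"
proof -
  have T: "(\<lambda>x. t + L x) ` S = (+) t ` L ` S" for S by (simp add: image_image)
  have "G \<subseteq> (\<lambda>x. t + L x) ` S" using G facet_of_imp_subset by blast
  then obtain F where F: "G = (\<lambda>x. t + L x) ` F" by (meson subset_image_iff)
  have face: "L ` F face_of L ` S"
    using G unfolding F T facet_of_def by (simp add: face_of_translation_eq)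
  then have "F face_of S" using face_of_linear_image[OF L] by blast
  moreover have "F \<noteq> {}" using G F by (auto simp: facet_of_def)
  moreover have "aff_dim F = aff_dim S - 1"
    using G unfolding F T facet_of_def
    by (simp add: aff_dim_translation_eq aff_dim_injective_linear_image[OF L])
  ultimately show ?thesis using F by (auto simp: facet_of_def)
qed

lemma card_facets_affine_image_le:
  fixes L :: "'a :: euclidean_space \<Rightarrow> 'a"
  assumes L: "linear L" "inj L" and fin: "finite {F. F facet_of S}"
  shows "finite {F. F facet_of (\<lambda>x. t + L x) ` S}"
    "card {F. F facet_of (\<lambda>x. t + L x) ` S} \<le> card {F. F facet_of S}"
proof -
  have sub: "{F. F facet_of (\<lambda>x. t + L x) ` S} \<subseteq> (\<lambda>F. (\<lambda>x. t + L x) ` F) ` {F. F facet_of S}"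
    using facet_of_affine_image[OF L] by blast
  then show "finite {F. F facet_of (\<lambda>x. t + L x) ` S}" using fin finite_subset by blast
  show "card {F. F facet_of (\<lambda>x. t + L x) ` S} \<le> card {F. F facet_of S}"
    by (rule order_trans[OF card_mono[OF _ sub] card_image_le[OF fin]]) (use fin in simp)
qed

section \<open>The core polytope in Euclidean space\<close>

lemma z_add: "z n (\<lambda>p. x p + y p) q = z n x q + z n y q"
  by (cases q) (simp add: z_def sum.distrib)

lemma z_scale: "z n (\<lambda>p. r * y p) q = r * z n y q"
  by (cases q) (simp add: z_def sum_distrib_left distrib_left)

lemma z_cong:
  assumes "\<And>v. v \<in> core_idx n \<Longrightarrow> y v = y' v" and "p \<in> Ctilde n"
  shows "z n y p = z n y' p"
proof -
  obtain i j where p: "p = (i, j)" by (cases p)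
  have "j' \<le> j \<Longrightarrow> z n y (i, j') = z n y' (i, j')" for j'
  proof (induction j')
    case 0
    then show ?case by (simp add: z_0)
  next
    case (Suc j')
    have "(i, Suc j') \<in> Ctilde n" using Suc.prems assms(2) by (auto simp: p mem_Ctilde)
    then have "y (line_cell n (i, Suc j')) = y' (line_cell n (i, Suc j'))"
      using assms(1) line_cell_core by blast
    then show ?case using Suc by (simp add: z_Suc)
  qed
  then show ?thesis by (simp add: p)
qed

text \<open>\<open>entry\<close> recovers \<open>y\<close> from \<open>embed_core y\<close> on the
  core only, so membership in the polytope is expressed by matrices with the help of this
  invariance.\<close>

lemma satisfies_description_cong:
  assumes "\<And>v. v \<in> core_idx n \<Longrightarrow> y v = y' v"
  shows "satisfies_description n y \<longleftrightarrow> satisfies_description n y'"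
proof -
  have z: "z n y p = z n y' p" if "p \<in> Ctilde n" for p using z_cong[OF assms that] by simp
  have b: "bounded_idx n \<subseteq> Ctilde n" by (auto simp: bounded_idx_def)
  have e: "(i, n) \<in> Ctilde n" if "i \<in> {1..n div 2}" for i using that by (auto simp: mem_Ctilde)
  have "(\<Sum>p \<in> Ctilde n. real_of_int (s p) * z n y p) = (\<Sum>p \<in> Ctilde n. real_of_int (s p) * z n y' p)" for s
    using z by (intro sum.cong) auto
  moreover have "z n y p = z n y' p" if "p \<in> bounded_idx n" for p using z b that by blast
  moreover have "z n y (i, n) = z n y' (i, n)" if "i \<in> {1..n div 2}" for i using z e[OF that] by blast
  ultimately show ?thesis
    unfolding satisfies_description_def by (intro conj_cong ball_cong refl) simp_all
qed

lemma bij_pos: "bij_betw (pos :: 'n::{finite,linorder} \<Rightarrow> nat) UNIV {1..CARD('n)}"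
proof -
  have mono: "pos a < pos b" if "a < b" for a b :: 'n
    unfolding pos_def using that by (intro psubset_card_mono) auto
  then have inj: "inj (pos :: 'n \<Rightarrow> nat)" by (metis injI linorder_neq_iff)
  have "pos a \<in> {1..CARD('n)}" for a :: 'n
    unfolding pos_def by (auto intro!: card_mono simp: Suc_le_eq card_gt_0_iff)
  then have "range (pos :: 'n \<Rightarrow> nat) \<subseteq> {1..CARD('n)}" by blast
  moreover have "card (range (pos :: 'n \<Rightarrow> nat)) = card {1..CARD('n)}" using inj by (simp add: card_image)
  ultimately have "range (pos :: 'n \<Rightarrow> nat) = {1..CARD('n)}" by (intro card_subset_eq) auto
  then show ?thesis using inj by (simp add: bij_betw_def)
qed

text \<open>Inverse to \<open>embed\<close> on indices from 1 to \<open>CARD('n)\<close>; elsewhere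
  the value is unspecified.\<close>

definition entry :: "real^'n::{finite,linorder}^'n::{finite,linorder} \<Rightarrow> nat \<times> nat \<Rightarrow> real" where
  "entry M = (\<lambda>(i, j). M $ inv_into UNIV pos i $ inv_into UNIV pos j)"

lemma pos_inv: "i \<in> {1..CARD('n)} \<Longrightarrow> pos (inv_into UNIV pos i :: 'n::{finite,linorder}) = i"
  using bij_pos[where 'n = 'n] by (simp add: bij_betw_inv_into_right)

lemma inv_pos: "inv_into UNIV pos (pos a) = (a :: 'n::{finite,linorder})"
  using bij_pos[where 'n = 'n] by (simp add: bij_betw_inv_into_left)

lemma pos_mem: "pos (a :: 'n::{finite,linorder}) \<in> {1..CARD('n)}"
  using bij_pos[where 'n = 'n] by (auto simp: bij_betw_def)

lemma entry_pos: "entry M (pos a, pos b) = M $ a $ b"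
  by (simp add: entry_def inv_pos)

lemma entry_embed:
  "i \<in> {1..CARD('n)} \<Longrightarrow> j \<in> {1..CARD('n)} \<Longrightarrow>
     entry (embed x :: real^'n::{finite,linorder}^'n::{finite,linorder}) (i, j) = x (i, j)"
  by (simp add: entry_def embed_def pos_inv)

lemma core_idx_subset: "core_idx n \<subseteq> {1..n} \<times> {1..n}"
  by (auto simp: core_idx_def)

lemma entry_embed_core:
  "v \<in> core_idx CARD('n) \<Longrightarrow>
     entry (embed_core y :: real^'n::{finite,linorder}^'n::{finite,linorder}) v = y v"
  using core_idx_subset[of "CARD('n)"] unfolding embed_core_def
  by (cases v) (auto simp: entry_embed)

lemma embed_core_entry:
  fixes M :: "real^'n::{finite,linorder}^'n::{finite,linorder}"
  assumes "\<And>a b. (pos a, pos b) \<notin> core_idx CARD('n) \<Longrightarrow> M $ a $ b = 0"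
  shows "embed_core (entry M) = M"
  using assms by (simp add: embed_core_def embed_def vec_eq_iff entry_pos)

lemma entry_linear: "entry (M + N) = (\<lambda>p. entry M p + entry N p)" "entry (r *\<^sub>R M) = (\<lambda>p. r * entry M p)"
  by (auto simp: entry_def)

lemma linear_z_entry: "linear (\<lambda>M. z n (entry M) p)"
  by (rule linearI) (simp_all add: entry_linear z_add z_scale)

text \<open>Converts the normal of a separating hyperplane into a cost function on cells.\<close>

lemma inner_embed_core:
  fixes A :: "real^'n::{finite,linorder}^'n::{finite,linorder}"
  shows "A \<bullet> embed_core y = (\<Sum>v\<in>core_idx CARD('n). entry A v * y v)"
proof -
  let ?g = "\<lambda>p. entry A p * (if p \<in> core_idx CARD('n) then y p else 0)"
  have bij: "bij_betw (\<lambda>(a :: 'n, b :: 'n). (pos a, pos b)) (UNIV \<times> UNIV) ({1..CARD('n)} \<times> {1..CARD('n)})"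
    using bij_betw_map_prod[OF bij_pos bij_pos] by (simp add: map_prod_def)
  have "A \<bullet> embed_core y = (\<Sum>a\<in>(UNIV :: 'n set). \<Sum>b\<in>(UNIV :: 'n set). ?g (pos a, pos b))"
    by (simp add: inner_vec_def embed_core_def embed_def entry_pos)
  also have "\<dots> = (\<Sum>(a, b)\<in>(UNIV :: 'n set) \<times> (UNIV :: 'n set). ?g (pos a, pos b))"
    by (simp add: sum.cartesian_product)
  also have "\<dots> = (\<Sum>p\<in>{1..CARD('n)} \<times> {1..CARD('n)}. ?g p)"
  proof -
    have "(\<Sum>(a, b)\<in>(UNIV :: 'n set) \<times> (UNIV :: 'n set). ?g (pos a, pos b)) =
        (\<Sum>c\<in>UNIV \<times> UNIV. ?g ((\<lambda>(a :: 'n, b :: 'n). (pos a, pos b)) c))"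
      by (rule sum.cong) auto
    also have "\<dots> = (\<Sum>p\<in>{1..CARD('n)} \<times> {1..CARD('n)}. ?g p)"
      by (rule sum.reindex_bij_betw[OF bij])
    finally show ?thesis .
  qed
  also have "\<dots> = (\<Sum>v\<in>core_idx CARD('n). entry A v * y v)"
    by (rule sum.mono_neutral_cong_right) (use core_idx_subset in auto)
  finally show ?thesis .
qed

text \<open>Infinitely many functions satisfy \<open>is_QTSASM\<close>, as values outside the square
  are free; the embedded core depends only on core entries, each with three possible values.\<close>

lemma finite_QTSASM_cores:
  "finite {embed_core (\<lambda>p. real_of_int (x p)) :: real^'n::{finite,linorder}^'n::{finite,linorder}
     | x. is_QTSASM CARD('n) x}"
proof (rule finite_subset)
  let ?n = "CARD('n)"
  let ?A = "core_idx ?n \<rightarrow>\<^sub>E {0, 1, -1 :: int}"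
  show "{embed_core (\<lambda>p. real_of_int (x p)) :: ((real, 'n) vec, 'n) vec | x. is_QTSASM ?n x} \<subseteq>
      (\<lambda>x. embed_core (\<lambda>p. real_of_int (x p))) ` ?A"
  proof
    fix M :: "((real, 'n) vec, 'n) vec" assume "M \<in> {embed_core (\<lambda>p. real_of_int (x p)) | x. is_QTSASM ?n x}"
    then obtain x where x: "is_QTSASM ?n x" "M = embed_core (\<lambda>p. real_of_int (x p))" by blast
    have "x (i, j) \<in> {0, 1, -1}" if "(i, j) \<in> core_idx ?n" for i j
    proof -
      have "i \<in> {1..?n}" "j \<in> {1..?n}" using that core_idx_subset[of ?n] by auto
      then show ?thesis using x(1) unfolding is_QTSASM_def is_ASM_def asm_line_def by blast
    qed
    then have "restrict x (core_idx ?n) \<in> ?A" by auto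
    moreover have "M = embed_core (\<lambda>p. real_of_int (restrict x (core_idx ?n) p))"
      unfolding x(2) embed_core_def by (rule arg_cong[of _ _ embed]) auto
    ultimately show "M \<in> (\<lambda>x. embed_core (\<lambda>p. real_of_int (x p))) ` ?A" by blast
  qed
qed (simp add: finite_PiE finite_core_idx)

lemma satisfies_description_convex:
  assumes y: "satisfies_description n y" "satisfies_description n y'" and uv: "0 \<le> u" "0 \<le> v" "u + v = 1"
  shows "satisfies_description n (\<lambda>p. u * y p + v * y' p)"
proof -
  have z: "z n (\<lambda>p. u * y p + v * y' p) q = u * z n y q + v * z n y' q" for q
    by (simp add: z_add z_scale)
  have comb: "u * s + v * t \<le> r" if "s \<le> r" "t \<le> r" for s t r :: real
    using that uv by (metis convex_bound_le)
  have "(\<Sum>p \<in> Ctilde n. real_of_int (s p) * z n (\<lambda>p. u * y p + v * y' p) p) / 2 =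
      u * ((\<Sum>p \<in> Ctilde n. real_of_int (s p) * z n y p) / 2) + v * ((\<Sum>p \<in> Ctilde n. real_of_int (s p) * z n y' p) / 2)" for s
    unfolding z by (simp add: distrib_left sum.distrib sum_distrib_left add_divide_distrib algebra_simps)
  moreover have "0 \<le> u * z n y p + v * z n y' p" if "p \<in> bounded_idx n" for p
    using y uv that by (auto simp: satisfies_description_def)
  ultimately show ?thesis
    using y uv(3) comb unfolding satisfies_description_def z by simp
qed

text \<open>A point of the description outside the closed hull would be strictly separated from it
  by a linear functional. Rounding with this functional as cost yields a core on the wrong
  side.\<close>

theorem P_core_QTSASM_description:
  "(P_core_QTSASM :: (real^'n::{finite,linorder}^'n::{finite,linorder}) set)
     = embed_core ` {y. satisfies_description CARD('n) y}"
proof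
  let ?n = "CARD('n)"
  let ?G = "{embed_core (\<lambda>p. real_of_int (x p)) :: ((real, 'n) vec, 'n) vec | x. is_QTSASM ?n x}"
  let ?D = "embed_core ` {y. satisfies_description ?n y} :: (((real, 'n) vec, 'n) vec) set"
  show "P_core_QTSASM \<subseteq> ?D"
    unfolding P_core_QTSASM_def
  proof (rule hull_minimal)
    show "?G \<subseteq> ?D" using QTSASM_satisfies_description by blast
    show "convex ?D"
    proof (rule convexI)
      fix M N :: "((real, 'n) vec, 'n) vec" and u v :: real
      assume "M \<in> ?D" "N \<in> ?D" and uv: "0 \<le> u" "0 \<le> v" "u + v = 1"
      then obtain y y' where y: "satisfies_description ?n y" "satisfies_description ?n y'"
        "M = embed_core y" "N = embed_core y'" by blast
      have "u *\<^sub>R M + v *\<^sub>R N = embed_core (\<lambda>p. u * y p + v * y' p)"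
        by (simp add: y embed_core_def embed_def vec_eq_iff)
      then show "u *\<^sub>R M + v *\<^sub>R N \<in> ?D" using satisfies_description_convex[OF y(1,2) uv] by blast
    qed
  qed
  show "?D \<subseteq> P_core_QTSASM"
  proof
    fix M assume "M \<in> ?D"
    then obtain y where y: "satisfies_description ?n y" "M = embed_core y" by blast
    show "M \<in> P_core_QTSASM"
    proof (rule ccontr)
      assume "M \<notin> P_core_QTSASM"
      moreover have "convex (P_core_QTSASM :: (((real, 'n) vec, 'n) vec) set)" by (simp add: P_core_QTSASM_def)
      moreover have "closed (P_core_QTSASM :: (((real, 'n) vec, 'n) vec) set)"
        unfolding P_core_QTSASM_def
        by (intro compact_imp_closed finite_imp_compact_convex_hull finite_QTSASM_cores)
      ultimately obtain A b where A: "A \<bullet> M < b" "\<forall>N\<in>P_core_QTSASM. A \<bullet> N > b"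
        using separating_hyperplane_closed_point by blast
      obtain X where X: "is_QTSASM ?n X"
        "(\<Sum>v\<in>core_idx ?n. entry A v * real_of_int (X v)) \<le> (\<Sum>v\<in>core_idx ?n. entry A v * y v)"
        using description_rounding[OF y(1)] by blast
      have "embed_core (\<lambda>p. real_of_int (X p)) \<in> ?G" using X(1) by blast
      then have "embed_core (\<lambda>p. real_of_int (X p)) \<in> (P_core_QTSASM :: (((real, 'n) vec, 'n) vec) set)"
        unfolding P_core_QTSASM_def by (rule hull_inc)
      then show False using A X(2) by (fastforce simp: y(2) inner_embed_core)
    qed
  qed
qed

lemma finite_parity_signs: "finite (parity_signs n)"
proof (rule finite_subset)
  show "parity_signs n \<subseteq> Ctilde n \<rightarrow>\<^sub>E {0, 1, -1}" by (auto simp: parity_signs_def)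
qed (simp add: finite_PiE finite_Ctilde)

lemma P_core_QTSASM_facets:
  defines "S \<equiv> (P_core_QTSASM :: (real^'n::{finite,linorder}^'n::{finite,linorder}) set)"
  shows "finite {F. F facet_of S}"
    and "card {F. F facet_of S} \<le> 2 * card (bounded_idx CARD('n)) + card (parity_signs CARD('n))"
proof -
  define n where "n = CARD('n)"
  \<comment> \<open>All equations go into the affine set: zeros outside the core and the sums of
    full lines. Only the inequalities, with two indices for each bounded prefix sum, are
    counted.\<close>
  define A where "A = {M :: ((real, 'n) vec, 'n) vec. (\<forall>a b. (pos a, pos b) \<notin> core_idx n \<longrightarrow> M $ a $ b = 0) \<and>
    (\<forall>i\<in>{1..n div 2}. z n (entry M) (i, n) = 1)}"
  define I where "I = (bounded_idx n <+> bounded_idx n) <+> parity_signs n"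
  define f :: "((nat \<times> nat) + (nat \<times> nat)) + (nat \<times> nat \<Rightarrow> int) \<Rightarrow> ((real, 'n) vec, 'n) vec \<Rightarrow> real" where
    "f = (\<lambda>i M. case i of Inl (Inl p) \<Rightarrow> z n (entry M) p | Inl (Inr p) \<Rightarrow> - z n (entry M) p
       | Inr s \<Rightarrow> (\<Sum>p \<in> Ctilde n. real_of_int (s p) * z n (entry M) p) / 2)"
  define b where "b = (\<lambda>i :: ((nat \<times> nat) + (nat \<times> nat)) + (nat \<times> nat \<Rightarrow> int). case i of Inl (Inl p) \<Rightarrow> 1 | Inl (Inr p) \<Rightarrow> 0
       | Inr s \<Rightarrow> real_of_int \<lfloor>(real (card {p \<in> Ctilde n. s p = 1})
                          - real (card {i \<in> {1..n div 2}. s (i, n) = -1})) / 2\<rfloor>)"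
  have fin: "finite (bounded_idx n)" "finite (parity_signs n)"
    by (simp_all add: bounded_idx_def finite_Ctilde finite_parity_signs)
  then have I: "finite I" "card I = 2 * card (bounded_idx n) + card (parity_signs n)"
    by (simp_all add: I_def card_Plus)
  note lz = linear_z_entry[of n]
  have comb: "z n (entry (u *\<^sub>R M + v *\<^sub>R N)) p = u * z n (entry M) p + v * z n (entry N) p"
    for u v p and M N :: "((real, 'n) vec, 'n) vec"
    by (simp add: linear_add[OF lz] linear_scale[OF lz])
  have aff: "affine A"
    unfolding affine_def A_def by (auto simp: comb)
  have lin: "linear (f i)" if "i \<in> I" for i
  proof (cases i)
    case (Inl q)
    then show ?thesis
      by (cases q) (simp_all add: f_def linear_iff linear_add[OF lz] linear_scale[OF lz])
  next
    case (Inr s)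
    then show ?thesis
      by (simp add: f_def linear_iff linear_add[OF lz] linear_scale[OF lz] distrib_left sum.distrib
        sum_distrib_left add_divide_distrib mult.left_commute)
  qed
  have S: "S = A \<inter> {M. \<forall>i\<in>I. f i M \<le> b i}"
  proof -
    have S_iff: "M \<in> S \<longleftrightarrow> (\<forall>a b. (pos a, pos b) \<notin> core_idx n \<longrightarrow> M $ a $ b = 0) \<and> satisfies_description n (entry M)" for M
    proof
      assume "M \<in> S"
      then obtain y where y: "satisfies_description n y" "M = embed_core y"
        unfolding S_def P_core_QTSASM_description n_def by blast
      have "entry M v = y v" if "v \<in> core_idx n" for v
        using entry_embed_core that unfolding y(2) n_def by blast
      then have "satisfies_description n (entry M)"
        using y(1) satisfies_description_cong[of n "entry M" y] by blast
      moreover have "(pos a, pos b) \<notin> core_idx n \<longrightarrow> M $ a $ b = 0" for a b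
        by (simp add: y(2) embed_core_def embed_def n_def)
      ultimately show "(\<forall>a b. (pos a, pos b) \<notin> core_idx n \<longrightarrow> M $ a $ b = 0) \<and> satisfies_description n (entry M)"
        by blast
    next
      assume "(\<forall>a b. (pos a, pos b) \<notin> core_idx n \<longrightarrow> M $ a $ b = 0) \<and> satisfies_description n (entry M)"
      then show "M \<in> S"
        unfolding S_def P_core_QTSASM_description n_def
        using embed_core_entry[of M] by (metis (mono_tags, lifting) image_eqI mem_Collect_eq)
    qed
    have ball_Plus: "(\<forall>x\<in>A <+> B. P x) \<longleftrightarrow> (\<forall>x\<in>A. P (Inl x)) \<and> (\<forall>x\<in>B. P (Inr x))"
      for A :: "'x set" and B :: "'y set" and P by auto
    have "(\<forall>i\<in>I. f i M \<le> b i) \<longleftrightarrow>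
        ((\<forall>p\<in>bounded_idx n. z n (entry M) p \<le> 1) \<and> (\<forall>p\<in>bounded_idx n. - z n (entry M) p \<le> 0)) \<and>
        (\<forall>s\<in>parity_signs n. (\<Sum>p \<in> Ctilde n. real_of_int (s p) * z n (entry M) p) / 2
          \<le> real_of_int \<lfloor>(real (card {p \<in> Ctilde n. s p = 1})
                          - real (card {i \<in> {1..n div 2}. s (i, n) = -1})) / 2\<rfloor>)" for M
      unfolding I_def ball_Plus f_def b_def sum.case ..
    then show ?thesis
      by (intro set_eqI)
        (unfold S_iff satisfies_description_def A_def Int_iff mem_Collect_eq neg_le_0_iff_le, blast)
  qed
  show "finite {F. F facet_of S}"
    and "card {F. F facet_of S} \<le> 2 * card (bounded_idx CARD('n)) + card (parity_signs CARD('n))"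
    using facets_of_inequalities[OF I(1) aff lin S] I(2) unfolding n_def by auto
qed

section \<open>From the core to the whole matrix\<close>

text \<open>
  Expresses the entries outside the core through the core by quarter turns. The central entry
  (odd \<open>n\<close>) is 1 minus twice a row sum of the core; its constant part is \<open>centre\<close>.
\<close>

definition orbit_part :: "nat \<Rightarrow> (nat \<times> nat \<Rightarrow> real) \<Rightarrow> nat \<times> nat \<Rightarrow> real" where
  "orbit_part n y = (\<lambda>(i, j). if (i, j) \<in> core_idx n then 0 else if i \<le> n div 2 then y (n + 1 - j, i)
     else if (n + 1) div 2 < j then y (n + 1 - i, n + 1 - j) else if (n + 1) div 2 < i then y (j, n + 1 - i)
     else - 2 * (\<Sum>j' = 1..n div 2. y (i, j')))"

definition centre :: "nat \<Rightarrow> nat \<times> nat \<Rightarrow> real" where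
  "centre n = (\<lambda>(i, j). if i = j \<and> 2 * i = n + 1 then 1 else 0)"

lemma QTSASM_half_turn:
  assumes "is_QTSASM n X" "i \<in> {1..n}" "j \<in> {1..n}"
  shows "X (i, j) = X (n + 1 - i, n + 1 - j)"
proof -
  have "n + 1 - i \<in> {1..n}" using assms by auto
  then show ?thesis using assms by (simp add: is_QTSASM_def)
qed

lemma QTSASM_centre:
  assumes X: "is_QTSASM n X" and n: "n = 2 * k + 1"
  shows "X (k + 1, k + 1) = 1 - 2 * (\<Sum>j = 1..k. X (k + 1, j))"
proof -
  have "asm_line n (\<lambda>j. X (k + 1, j))" using X n by (simp add: is_QTSASM_def is_ASM_def)
  then have "1 = (\<Sum>j = 1..n. X (k + 1, j))" by (simp add: asm_line_iff_partial_sums)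
  also have "{1..n} = insert (k + 1) ({1..k} \<union> {k + 2..n})" using n by auto
  also have "(\<Sum>j\<in>insert (k + 1) ({1..k} \<union> {k + 2..n}). X (k + 1, j)) =
      X (k + 1, k + 1) + ((\<Sum>j = 1..k. X (k + 1, j)) + (\<Sum>j = k + 2..n. X (k + 1, j)))"
    by (subst sum.insert, simp, simp, subst sum.union_disjoint) auto
  also have "(\<Sum>j = k + 2..n. X (k + 1, j)) = (\<Sum>j = 1..k. X (k + 1, j))"
  proof (rule sum.reindex_bij_witness[of _ "\<lambda>j. n + 1 - j" "\<lambda>j. n + 1 - j"])
    fix j assume "j \<in> {k + 2..n}"
    then show "X (k + 1, n + 1 - j) = X (k + 1, j)"
      using QTSASM_half_turn[OF X, of "k + 1" j] n by auto
  qed (use n in auto)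
  finally show ?thesis by simp
qed

lemma QTSASM_entry:
  assumes X: "is_QTSASM n X" and ij: "i \<in> {1..n}" "j \<in> {1..n}"
  shows "real_of_int (X (i, j)) = centre n (i, j) + (if (i, j) \<in> core_idx n then real_of_int (X (i, j)) else 0)
     + orbit_part n (\<lambda>p. real_of_int (X p)) (i, j)"
proof -
  have sym: "X (a, b) = X (b, n + 1 - a)" if "a \<in> {1..n}" "b \<in> {1..n}" for a b
    using X that by (auto simp: is_QTSASM_def)
  have "(i, j) \<in> core_idx n \<or> (i, j) \<notin> core_idx n \<and> i \<le> n div 2 \<or> n div 2 < i \<and> (n + 1) div 2 < j \<or>
      (n + 1) div 2 < i \<and> j \<le> (n + 1) div 2 \<or> odd n \<and> i = n div 2 + 1 \<and> j = n div 2 + 1"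
  proof (cases "(i, j) \<in> core_idx n \<or> i \<le> n div 2 \<or> (n + 1) div 2 < j \<or> (n + 1) div 2 < i")
    case True
    then show ?thesis by (cases "i \<le> n div 2"; cases "(n + 1) div 2 < j") (auto simp: not_less not_le)
  next
    case False
    then have "n div 2 < i" "i \<le> (n + 1) div 2" "n div 2 < j" "j \<le> (n + 1) div 2"
      using ij by (auto simp: mem_core_idx)
    moreover have "(n + 1) div 2 = n div 2 \<or> odd n \<and> (n + 1) div 2 = n div 2 + 1"
      by (cases "even n") (auto elim!: evenE oddE)
    ultimately show ?thesis by (elim disjE conjE) simp_all
  qed
  then consider "(i, j) \<in> core_idx n" | "(i, j) \<notin> core_idx n" "i \<le> n div 2" | "n div 2 < i" "(n + 1) div 2 < j"
    | "(n + 1) div 2 < i" "j \<le> (n + 1) div 2" | "odd n" "i = n div 2 + 1" "j = n div 2 + 1"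
    by blast
  then show ?thesis
  proof cases
    case 1
    then show ?thesis using ij by (auto simp: orbit_part_def centre_def mem_core_idx)
  next
    case 2
    then have "n + 1 - j \<in> {1..n}" "i \<in> {1..n}" using ij by auto
    then have "X (n + 1 - j, i) = X (i, j)" using sym[of "n + 1 - j" i] ij by simp
    moreover have "\<not> 2 * i = n + 1" using 2 by linarith
    ultimately show ?thesis using 2 by (simp add: orbit_part_def centre_def)
  next
    case 3
    then show ?thesis using QTSASM_half_turn[OF X ij] ij
      by (auto simp: orbit_part_def centre_def mem_core_idx)
  next
    case 4
    then show ?thesis using sym[OF ij] ij by (auto simp: orbit_part_def centre_def mem_core_idx)
  next
    case 5
    then have n: "n = 2 * (n div 2) + 1" by simp
    have "real_of_int (X (i, j)) = real_of_int (1 - 2 * (\<Sum>j' = 1..n div 2. X (i, j')))"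
      using QTSASM_centre[OF X n] 5 by simp
    then show ?thesis using 5 by (simp add: orbit_part_def centre_def mem_core_idx)
  qed
qed

lemma orbit_part_cong:
  assumes "\<And>v. v \<in> core_idx n \<Longrightarrow> y v = y' v" "i \<in> {1..n}" "j \<in> {1..n}"
  shows "orbit_part n y (i, j) = orbit_part n y' (i, j)"
proof -
  have 1: "(n + 1 - j, i) \<in> core_idx n" if "(i, j) \<notin> core_idx n" "i \<le> n div 2"
    using that assms by (auto simp: mem_core_idx)
  have 2: "(n + 1 - i, n + 1 - j) \<in> core_idx n" if "\<not> i \<le> n div 2" "(n + 1) div 2 < j"
    using that assms by (auto simp: mem_core_idx)
  have 3: "(j, n + 1 - i) \<in> core_idx n" if "\<not> (n + 1) div 2 < j" "(n + 1) div 2 < i"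
    using that assms by (auto simp: mem_core_idx)
  have 4: "(\<Sum>j' = 1..n div 2. y (i, j')) = (\<Sum>j' = 1..n div 2. y' (i, j'))" if "\<not> (n + 1) div 2 < i"
    by (rule sum.cong) (use that assms in \<open>auto simp: mem_core_idx\<close>)
  show ?thesis
    unfolding orbit_part_def prod.case
    using assms(1)[OF 1] assms(1)[OF 2] assms(1)[OF 3] 4 by (simp del: One_nat_def)
qed

text \<open>All of \<open>M\<close> is kept, not only its core, so that the map is injective on the
  whole space; on matrices supported on the core it fills in the other entries up to the constant
  \<open>centre\<close>.\<close>

definition unfold_core :: "real^'n::{finite,linorder}^'n::{finite,linorder} \<Rightarrow> real^'n::{finite,linorder}^'n::{finite,linorder}" where
  "unfold_core M = M + embed (orbit_part CARD('n) (entry M))"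

lemma linear_unfold_core: "linear unfold_core"
proof (rule linearI)
  have add: "orbit_part n (\<lambda>p. x p + y p) q = orbit_part n x q + orbit_part n y q" for n x y q
    by (cases q) (auto simp: orbit_part_def sum.distrib)
  have scale: "orbit_part n (\<lambda>p. r * y p) q = r * orbit_part n y q" for n r y q
    by (cases q) (auto simp: orbit_part_def sum_distrib_left mult.left_commute)
  show "unfold_core (M + N) = unfold_core M + unfold_core N" for M N :: "((real, 'a) vec, 'a) vec"
    by (simp add: unfold_core_def entry_linear add embed_def vec_eq_iff)
  show "unfold_core (r *\<^sub>R M) = r *\<^sub>R unfold_core M" for r and M :: "((real, 'a) vec, 'a) vec"
    by (simp add: unfold_core_def entry_linear scale embed_def vec_eq_iff distrib_left)
qed

lemma inj_unfold_core: "inj (unfold_core :: real^'n::{finite,linorder}^'n::{finite,linorder} \<Rightarrow> _)"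
  unfolding linear_injective_0[OF linear_unfold_core]
proof (intro allI impI)
  fix M :: "((real, 'n) vec, 'n) vec" assume M: "unfold_core M = 0"
  let ?n = "CARD('n)"
  have e: "M $ a $ b + orbit_part ?n (entry M) (pos a, pos b) = 0" for a b
  proof -
    have "unfold_core M $ a $ b = 0" by (simp add: M)
    then show ?thesis by (simp add: unfold_core_def embed_def)
  qed
  have core0: "entry M v = 0" if v: "v \<in> core_idx ?n" for v
  proof -
    obtain i j where ij: "v = (i, j)" by (cases v)
    have "i \<in> {1..?n}" "j \<in> {1..?n}" using v core_idx_subset[of ?n] ij by auto
    then obtain a b :: 'n where ab: "i = pos a" "j = pos b"
      using pos_inv[where 'n = 'n] by metis
    then show ?thesis using e[of a b] v ij by (simp add: orbit_part_def entry_pos)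
  qed
  have "M $ a $ b = 0" for a b
  proof -
    have "orbit_part ?n (entry M) (pos a, pos b) = orbit_part ?n (\<lambda>_. 0) (pos a, pos b)"
      by (rule orbit_part_cong) (use core0 pos_mem in auto)
    also have "\<dots> = 0" by (simp add: orbit_part_def)
    finally show ?thesis using e[of a b] by simp
  qed
  then show "M = 0" by (simp add: vec_eq_iff)
qed

text \<open>Affine maps commute with convex hulls, so it suffices to treat single QTSASMs.\<close>

lemma P_QTSASM_affine_image:
  "(P_QTSASM :: (real^'n::{finite,linorder}^'n::{finite,linorder}) set) =
     (\<lambda>M. embed (centre CARD('n)) + unfold_core M) ` P_core_QTSASM"
proof -
  let ?n = "CARD('n)"
  have T: "(\<lambda>M :: ((real, 'n) vec, 'n) vec. embed (centre ?n) + unfold_core M) ` A =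
      (+) (embed (centre ?n)) ` unfold_core ` A" for A
    by (simp add: image_image)
  have eq: "embed (\<lambda>p. real_of_int (x p)) =
      embed (centre ?n) + unfold_core (embed_core (\<lambda>p. real_of_int (x p)) :: ((real, 'n) vec, 'n) vec)"
    if x: "is_QTSASM ?n x" for x
  proof -
    let ?M = "embed_core (\<lambda>p. real_of_int (x p)) :: ((real, 'n) vec, 'n) vec"
    have "real_of_int (x (pos a, pos b)) =
        centre ?n (pos a, pos b) + (?M $ a $ b + orbit_part ?n (entry ?M) (pos a, pos b))" for a b :: 'n
    proof -
      have "orbit_part ?n (entry ?M) (pos a, pos b) = orbit_part ?n (\<lambda>p. real_of_int (x p)) (pos a, pos b)"
        by (rule orbit_part_cong) (use entry_embed_core pos_mem in blast)+
      then show ?thesis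
        using QTSASM_entry[OF x pos_mem[of a] pos_mem[of b]] by (simp add: embed_core_def embed_def)
    qed
    then show ?thesis by (simp add: vec_eq_iff unfold_core_def embed_def)
  qed
  have "{embed (\<lambda>p. real_of_int (x p)) :: ((real, 'n) vec, 'n) vec | x. is_QTSASM ?n x} =
      (+) (embed (centre ?n)) ` unfold_core ` {embed_core (\<lambda>p. real_of_int (x p)) | x. is_QTSASM ?n x}"
    using eq by (auto simp: image_iff; metis)
  then have "P_QTSASM = (+) (embed (centre ?n)) ` unfold_core ` (P_core_QTSASM :: (((real, 'n) vec, 'n) vec) set)"
    unfolding P_QTSASM_def P_core_QTSASM_def
    by (simp add: convex_hull_translation convex_hull_linear_image[OF linear_unfold_core])
  then show ?thesis unfolding T .
qed

lemma P_QTSASM_facets: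
  defines "S \<equiv> (P_QTSASM :: (real^'n::{finite,linorder}^'n::{finite,linorder}) set)"
  shows "finite {F. F facet_of S}"
    and "card {F. F facet_of S} \<le> 2 * card (bounded_idx CARD('n)) + card (parity_signs CARD('n))"
proof -
  note c = card_facets_affine_image_le[OF linear_unfold_core inj_unfold_core P_core_QTSASM_facets(1),
      of "embed (centre CARD('n)) :: ((real, 'n) vec, 'n) vec", folded P_QTSASM_affine_image]
  show "finite {F. F facet_of S}" unfolding S_def by (rule c(1))
  show "card {F. F facet_of S} \<le> 2 * card (bounded_idx CARD('n)) + card (parity_signs CARD('n))"
    unfolding S_def by (rule order_trans[OF c(2) P_core_QTSASM_facets(2)])
qed

section \<open>Counting parity sign vectors\<close>

text \<open>A sign vector is determined by its support, the cut of some \<open>U\<close>, and by the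
  subset where it is 1.\<close>

lemma card_parity_signs_le:
  "card (parity_signs n) \<le> (\<Sum>U\<in>Pow (core_idx n). 2 ^ card (cell_cut n U))"
proof -
  let ?cut = "cell_cut n"
  define S where "S = (\<lambda>U. {s \<in> Ctilde n \<rightarrow>\<^sub>E {0, 1, -1 :: int}. {p \<in> Ctilde n. s p \<noteq> 0} = ?cut U})"
  have fin: "finite (S U)" for U
    unfolding S_def by (rule finite_subset[of _ "Ctilde n \<rightarrow>\<^sub>E {0, 1, -1 :: int}"])
      (auto simp: finite_PiE finite_Ctilde)
  have card_S: "card (S U) \<le> 2 ^ card (?cut U)" for U
  proof -
    have fin_cut: "finite (?cut U)" using finite_Ctilde by (simp add: odd_cut_def)
    have "inj_on (\<lambda>s. {p \<in> Ctilde n. s p = 1}) (S U)"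
    proof (rule inj_onI)
      fix s t assume st: "s \<in> S U" "t \<in> S U" and eq: "{p \<in> Ctilde n. s p = 1} = {p \<in> Ctilde n. t p = 1}"
      show "s = t"
      proof
        fix p
        show "s p = t p"
        proof (cases "p \<in> Ctilde n")
          case True
          then have "s p \<in> {0, 1, -1}" "t p \<in> {0, 1, -1}" using st by (auto simp: S_def PiE_iff)
          moreover have "s p \<noteq> 0 \<longleftrightarrow> t p \<noteq> 0"
            using st True unfolding S_def by blast
          moreover have "s p = 1 \<longleftrightarrow> t p = 1" using eq True by blast
          ultimately show ?thesis by auto
        next
          case False
          moreover have "s \<in> Ctilde n \<rightarrow>\<^sub>E {0, 1, -1}" "t \<in> Ctilde n \<rightarrow>\<^sub>E {0, 1, -1}"
            using st by (simp_all add: S_def)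
          ultimately show ?thesis by (metis PiE_arb)
        qed
      qed
    qed
    moreover have "(\<lambda>s. {p \<in> Ctilde n. s p = 1}) ` S U \<subseteq> Pow (?cut U)"
      by (force simp: S_def)
    ultimately have "card (S U) \<le> card (Pow (?cut U))" using fin_cut by (intro card_inj_on_le) auto
    then show ?thesis using fin_cut by (simp add: card_Pow)
  qed
  have "parity_signs n \<subseteq> (\<Union>U\<in>Pow (core_idx n). S U)"
  proof
    fix s assume s: "s \<in> parity_signs n"
    obtain U where "U \<subseteq> core_idx n" "{p \<in> Ctilde n. s p \<noteq> 0} = ?cut U" using parity_sign_support[OF s] .
    then show "s \<in> (\<Union>U\<in>Pow (core_idx n). S U)" using s by (auto simp: S_def parity_signs_def)
  qed
  then have "card (parity_signs n) \<le> card (\<Union>U\<in>Pow (core_idx n). S U)"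
    using fin finite_core_idx by (intro card_mono) auto
  also have "\<dots> \<le> (\<Sum>U\<in>Pow (core_idx n). card (S U))" using finite_core_idx by (intro card_UN_le) auto
  also have "\<dots> \<le> (\<Sum>U\<in>Pow (core_idx n). 2 ^ card (?cut U))" by (intro sum_mono card_S)
  finally show ?thesis .
qed

section \<open>Distributing the cut edges among the cells\<close>

definition edge_weight :: "bool \<Rightarrow> bool \<Rightarrow> real" where
  "edge_weight s t = (if s = t then 1 else 2)"

text \<open>The far end of the edge at position \<open>(a, b)\<close>. After column
  \<open>n div 2\<close> a full line turns into a column and enters the bottom row, hence the cell
  \<open>((n + 1) div 2, a)\<close>. The half line of odd \<open>n\<close> ends instead, which
  counts as outside \<open>U\<close>.\<close>

definition right_value :: "nat \<Rightarrow> (nat \<times> nat) set \<Rightarrow> nat \<times> nat \<Rightarrow> bool" where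
  "right_value n U = (\<lambda>(a, b). if b < n div 2 then (a, Suc b) \<in> U
     else a \<le> n div 2 \<and> ((n + 1) div 2, a) \<in> U)"

text \<open>A cell is charged with its edge to the right, its edge to the cell below, and in the top
  row with the last edge of its column line, whose far end counts as outside
  \<open>U\<close>.\<close>

definition cell_weight :: "nat \<Rightarrow> (nat \<times> nat) set \<Rightarrow> nat \<times> nat \<Rightarrow> real" where
  "cell_weight n U = (\<lambda>(a, b). edge_weight ((a, b) \<in> U) (right_value n U (a, b)) *
     (if a < (n + 1) div 2 then edge_weight ((a, b) \<in> U) ((Suc a, b) \<in> U) else 1) *
     (if a = 1 then edge_weight ((a, b) \<in> U) False else 1))"

lemma two_power_cut:
  assumes U: "U \<subseteq> core_idx n"
  shows "2 ^ card (cell_cut n U) = (\<Prod>v\<in>core_idx n. cell_weight n U v)"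
proof -
  define k where "k = n div 2"
  define l where "l = (n + 1) div 2"
  define C where "C = core_idx n"
  define E where "E = Ctilde n"
  define LC where "LC = line_cell n"
  define S where "S = in_side n U"
  define R where "R = right_value n U"
  define D where "D = cell_cut n U"
  have S: "S p \<longleftrightarrow> p \<in> E \<and> LC p \<in> U" for p by (simp add: S_def in_side_def E_def LC_def)
  have DE: "D \<subseteq> E" unfolding D_def E_def by (rule odd_cut_subset)
  have D: "(i, j) \<in> D \<longleftrightarrow> (i, j) \<in> E \<and> S (i, j) \<noteq> S (i, Suc j)" for i j
    unfolding D_def E_def S_def by (rule mem_odd_cut_cells[OF U])
  have kl: "k + l \<le> n" "n \<le> k + l" "l = k \<or> l = k + 1" "odd n \<longleftrightarrow> l = k + 1" by (auto simp: k_def l_def)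
  define w where "w = (\<lambda>p. edge_weight (S p) (S (fst p, Suc (snd p))))"
  have core: "(a, b) \<in> C \<longleftrightarrow> 1 \<le> a \<and> 1 \<le> b \<and> a \<le> l \<and> b \<le> k" for a b
    by (simp add: C_def mem_core_idx k_def l_def)
  have Ct: "(i, j) \<in> E \<longleftrightarrow> 1 \<le> i \<and> 1 \<le> j \<and> (i \<le> k \<and> j \<le> n \<or> l = k + 1 \<and> i = k + 1 \<and> j \<le> k)" for i j
    using kl(3,4) by (auto simp: E_def mem_Ctilde k_def[symmetric])
  have R: "R (a, b) \<longleftrightarrow> (if b < k then (a, Suc b) \<in> U else a \<le> k \<and> (l, a) \<in> U)" for a b
    by (simp add: R_def right_value_def k_def l_def)
  have lc: "LC (i, j) = (if j \<le> k then (i, j) else (n + 1 - j, i))" for i j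
    by (simp add: LC_def line_cell_def k_def)
  define V where "V = {(a, b) \<in> C. a < l}"
  define T where "T = {(a, b) \<in> C. a = 1}"
  \<comment> \<open>\<open>fV (a, b)\<close> is the position joining the cells
    \<open>(Suc a, b)\<close> and \<open>(a, b)\<close>, and \<open>fT (1, b)\<close> the end of the
    line. Together with the core positions they exhaust \<open>Ctilde n\<close>.\<close>
  define fV where "fV = (\<lambda>(a, b). (b, n - a) :: nat \<times> nat)"
  define fT where "fT = (\<lambda>(a :: nat, b). (b, n) :: nat \<times> nat)"
  have fin: "finite C" "finite V" "finite T"
    unfolding V_def T_def C_def using finite_core_idx[of n] by (auto intro: rev_finite_subset)
  have Ct_eq: "E = C \<union> (fV ` V \<union> fT ` T)"
  proof (intro set_eqI iffI)
    fix p assume p: "p \<in> E"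
    obtain i j where ij: "p = (i, j)" by (cases p)
    have "j \<le> n" using p kl by (auto simp: ij Ct)
    then consider "j \<le> k" | "k < j" "j < n" | "k < j" "j = n" by linarith
    then show "p \<in> C \<union> (fV ` V \<union> fT ` T)"
    proof cases
      case 1
      then show ?thesis using p kl by (auto simp: ij Ct core)
    next
      case 2
      then have "(n - j, i) \<in> V" "fV (n - j, i) = p" using p kl by (auto simp: ij Ct core V_def fV_def)
      then show ?thesis by (metis UnI1 UnI2 imageI)
    next
      case 3
      then have "(1, i) \<in> T" "fT (1, i) = p" using p kl by (auto simp: ij Ct core T_def fT_def)
      then show ?thesis by (metis UnI2 imageI)
    qed
  next
    fix p assume "p \<in> C \<union> (fV ` V \<union> fT ` T)"
    then show "p \<in> E" using kl by (cases p) (auto simp: Ct core V_def T_def fV_def fT_def)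
  qed
  have disj: "C \<inter> (fV ` V \<union> fT ` T) = {}" "fV ` V \<inter> fT ` T = {}"
    using kl by (auto simp: core V_def T_def fV_def fT_def)
  have inj: "inj_on fV V" "inj_on fT T"
    using kl by (auto simp: inj_on_def core V_def T_def fV_def fT_def)
  have "(2 :: real) ^ card (D) = (\<Prod>p\<in>D. 2)"
    by simp
  also have "\<dots> = (\<Prod>p\<in>E. w p)"
  proof (rule prod.mono_neutral_cong_left[OF finite_Ctilde[of n, folded E_def] DE])
    show "\<forall>p\<in>E - D. w p = 1"
      using D by (auto simp: w_def edge_weight_def)
    show "2 = w p" if "p \<in> D" for p
      using that D[of "fst p" "snd p"] by (simp add: w_def edge_weight_def)
  qed
  also have "\<dots> = (\<Prod>p\<in>C. w p) * ((\<Prod>v\<in>V. w (fV v)) * (\<Prod>v\<in>T. w (fT v)))"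
    unfolding Ct_eq using fin disj inj by (simp add: prod.union_disjoint prod.reindex)
  also have "(\<Prod>v\<in>V. w (fV v)) = (\<Prod>v\<in>C. if fst v < l then w (fV v) else 1)"
    by (rule prod.mono_neutral_cong_left) (use fin in \<open>auto simp: V_def\<close>)
  also have "(\<Prod>v\<in>T. w (fT v)) = (\<Prod>v\<in>C. if fst v = 1 then w (fT v) else 1)"
    by (rule prod.mono_neutral_cong_left) (use fin in \<open>auto simp: T_def\<close>)
  also have "(\<Prod>p\<in>C. w p) * ((\<Prod>v\<in>C. if fst v < l then w (fV v) else 1) *
      (\<Prod>v\<in>C. if fst v = 1 then w (fT v) else 1)) = (\<Prod>v\<in>C. cell_weight n U v)"
    unfolding prod.distrib[symmetric]
  proof (rule prod.cong)
    fix v assume v: "v \<in> C"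
    obtain a b where ab: "v = (a, b)" by (cases v)
    have c: "1 \<le> a" "1 \<le> b" "a \<le> l" "b \<le> k" using v by (simp_all add: ab core)
    have r0: "S (a, b) \<longleftrightarrow> (a, b) \<in> U" using c kl by (auto simp: S Ct lc)
    have r1: "S (a, Suc b) \<longleftrightarrow> R (a, b)"
    proof (cases "b < k")
      case True
      then show ?thesis using c kl by (auto simp: S Ct lc R)
    next
      case False
      then have b: "b = k" using c by simp
      show ?thesis
      proof (cases "a \<le> k")
        case True
        then have "(a, Suc k) \<in> E" "LC (a, Suc k) = (l, a)" using c b kl by (auto simp: Ct lc)
        then show ?thesis using True b by (simp add: S R)
      next
        case False
        then show ?thesis using b by (simp add: S R Ct)
      qed
    qed
    have r2: "S (b, n - a) \<longleftrightarrow> (Suc a, b) \<in> U" "S (b, Suc (n - a)) \<longleftrightarrow> (a, b) \<in> U"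
      if "a < l"
    proof -
      have "(b, n - a) \<in> E" "(b, Suc (n - a)) \<in> E" using that c kl by (auto simp: Ct)
      moreover have "LC (b, n - a) = (Suc a, b)" "LC (b, Suc (n - a)) = (a, b)"
        using that c kl by (auto simp: lc)
      ultimately show "S (b, n - a) \<longleftrightarrow> (Suc a, b) \<in> U" "S (b, Suc (n - a)) \<longleftrightarrow> (a, b) \<in> U"
        by (simp_all add: S)
    qed
    have r3: "S (b, n) \<longleftrightarrow> (a, b) \<in> U" "\<not> S (b, Suc n)" if "a = 1"
    proof -
      have "(b, n) \<in> E" "(b, Suc n) \<notin> E" using c kl by (auto simp: Ct)
      moreover have "LC (b, n) = (1, b)" using that c kl by (auto simp: lc)
      ultimately show "S (b, n) \<longleftrightarrow> (a, b) \<in> U" "\<not> S (b, Suc n)"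
        using that by (simp_all add: S)
    qed
    have "w v = edge_weight ((a, b) \<in> U) (R (a, b))" by (simp add: w_def ab r0 r1)
    moreover have "w (fV v) = edge_weight ((a, b) \<in> U) ((Suc a, b) \<in> U)" if "a < l"
      by (simp add: w_def fV_def ab r2[OF that] edge_weight_def)
    moreover have "w (fT v) = edge_weight ((a, b) \<in> U) False" if "a = 1"
      by (simp add: w_def fT_def ab r3[OF that])
    moreover have "cell_weight n U v = edge_weight ((a, b) \<in> U) (R (a, b)) *
        (if a < l then edge_weight ((a, b) \<in> U) ((Suc a, b) \<in> U) else 1) *
        (if a = 1 then edge_weight ((a, b) \<in> U) False else 1)"
      unfolding cell_weight_def ab R_def l_def prod.case ..
    ultimately show "w v * ((if fst v < l then w (fV v) else 1) * (if fst v = 1 then w (fT v) else 1)) = cell_weight n U v"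
      unfolding ab fst_conv mult.assoc by (cases "a < l"; cases "a = 1") simp_all
  qed simp
  finally show ?thesis unfolding C_def D_def .
qed

section \<open>Deciding the cells one by one\<close>

definition weighted_sum ::
  "('v set \<Rightarrow> 'v \<Rightarrow> real) \<Rightarrow> ('v set \<Rightarrow> real) \<Rightarrow> 'v set \<Rightarrow> real" where
  "weighted_sum g \<phi> A = (\<Sum>U\<in>Pow A. (\<Prod>v\<in>A. g U v) * \<phi> U)"

text \<open>The sum splits by membership of \<open>v\<close>, which leaves the earlier weights
  unchanged. The potentials let a bad local factor be paid for by the state that it leaves
  behind.\<close>

lemma weighted_sum_insert_le:
  assumes A: "finite A" "v \<notin> A"
    and pos: "\<And>U w. 0 \<le> g U w"
    and indep: "\<And>U w. U \<subseteq> A \<Longrightarrow> w \<in> A \<Longrightarrow> g (insert v U) w = g U w"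
    and step: "\<And>U. U \<subseteq> A \<Longrightarrow> g U v * \<psi> U + g (insert v U) v * \<psi> (insert v U) \<le> m * \<phi> U"
  shows "weighted_sum g \<psi> (insert v A) \<le> m * weighted_sum g \<phi> A"
proof -
  have "weighted_sum g \<psi> (insert v A) =
      (\<Sum>U\<in>Pow A. (\<Prod>w\<in>insert v A. g U w) * \<psi> U) +
      (\<Sum>U\<in>insert v ` Pow A. (\<Prod>w\<in>insert v A. g U w) * \<psi> U)"
    unfolding weighted_sum_def Pow_insert using A by (intro sum.union_disjoint) auto
  also have "(\<Sum>U\<in>insert v ` Pow A. (\<Prod>w\<in>insert v A. g U w) * \<psi> U) =
      (\<Sum>U\<in>Pow A. (\<Prod>w\<in>insert v A. g (insert v U) w) * \<psi> (insert v U))"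
  proof -
    have "inj_on (insert v) (Pow A)" using A(2) by (auto simp: inj_on_def)
    then show ?thesis by (simp add: sum.reindex)
  qed
  also have "(\<Sum>U\<in>Pow A. (\<Prod>w\<in>insert v A. g U w) * \<psi> U) +
      (\<Sum>U\<in>Pow A. (\<Prod>w\<in>insert v A. g (insert v U) w) * \<psi> (insert v U)) =
      (\<Sum>U\<in>Pow A. (\<Prod>w\<in>A. g U w) * (g U v * \<psi> U + g (insert v U) v * \<psi> (insert v U)))"
    unfolding sum.distrib[symmetric]
  proof (rule sum.cong)
    fix U assume "U \<in> Pow A"
    then have "(\<Prod>w\<in>A. g (insert v U) w) = (\<Prod>w\<in>A. g U w)" using indep by (intro prod.cong) auto
    then show "(\<Prod>w\<in>insert v A. g U w) * \<psi> U + (\<Prod>w\<in>insert v A. g (insert v U) w) * \<psi> (insert v U) =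
        (\<Prod>w\<in>A. g U w) * (g U v * \<psi> U + g (insert v U) v * \<psi> (insert v U))"
      using A by (simp add: algebra_simps)
  qed simp
  also have "\<dots> \<le> (\<Sum>U\<in>Pow A. (\<Prod>w\<in>A. g U w) * (m * \<phi> U))"
    using step pos by (intro sum_mono mult_left_mono prod_nonneg) auto
  also have "\<dots> = m * weighted_sum g \<phi> A"
    by (simp add: weighted_sum_def sum_distrib_left mult.left_commute)
  finally show ?thesis .
qed

text \<open>The cell \<open>(a, b)\<close> itself is excluded; column 0 marks a completed
  row.\<close>

definition processed :: "nat \<Rightarrow> nat \<Rightarrow> nat \<Rightarrow> (nat \<times> nat) set" where
  "processed n a b = {(a', b') \<in> core_idx n. a < a' \<or> a' = a \<and> b < b'}"

lemma processed_insert: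
  "(a, Suc b) \<in> core_idx n \<Longrightarrow> processed n a b = insert (a, Suc b) (processed n a (Suc b))"
  by (auto simp: processed_def)

lemma processed_next_row: "processed n a 0 = processed n (a - 1) (n div 2)" if "1 \<le> a"
  using that by (auto simp: processed_def mem_core_idx)

lemma processed_none: "processed n ((n + 1) div 2) (n div 2) = {}"
  by (auto simp: processed_def mem_core_idx)

lemma processed_all: "processed n 1 0 = core_idx n"
  by (auto simp: processed_def mem_core_idx)

lemma finite_processed: "finite (processed n a b)"
  unfolding processed_def by (rule finite_subset[OF _ finite_core_idx[of n]]) auto

lemma not_processed: "(a, b) \<notin> processed n a b"
  by (simp add: processed_def)

lemma cell_weight_nonneg: "0 \<le> cell_weight n U v"
  by (cases v) (simp add: cell_weight_def edge_weight_def)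

text \<open>The weight of a decided cell involves only itself, its right and lower neighbours, or
  the bottom cell where its line turns; none of these is decided later.\<close>

lemma cell_weight_insert:
  assumes v: "(a, b) \<in> core_idx n" and w: "w \<in> processed n a b"
  shows "cell_weight n (insert (a, b) U) w = cell_weight n U w"
proof -
  obtain a' b' where w': "w = (a', b')" by (cases w)
  have c: "a < a' \<or> a' = a \<and> b < b'" "b' \<le> n div 2" "a' \<le> (n + 1) div 2" "b \<le> n div 2"
    using v w by (auto simp: processed_def w' mem_core_idx)
  have e1: "(a', b') \<in> insert (a, b) U \<longleftrightarrow> (a', b') \<in> U" using c(1) by auto
  have e2: "(a', Suc b') \<in> insert (a, b) U \<longleftrightarrow> (a', Suc b') \<in> U" using c(1) by auto
  have e3: "(Suc a', b') \<in> insert (a, b) U \<longleftrightarrow> (Suc a', b') \<in> U" using c(1) by auto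
  have e4: "((n + 1) div 2, a') \<in> insert (a, b) U \<longleftrightarrow> ((n + 1) div 2, a') \<in> U"
    if "\<not> b' < n div 2" "a' \<le> n div 2"
  proof -
    have "((n + 1) div 2, a') \<noteq> (a, b)" using that c by auto
    then show ?thesis by blast
  qed
  have r: "right_value n (insert (a, b) U) (a', b') = right_value n U (a', b')"
    unfolding right_value_def prod.case e2 using e4 by (cases "b' < n div 2"; cases "a' \<le> n div 2") simp_all
  show ?thesis unfolding w' cell_weight_def prod.case r e1 e3 ..
qed

text \<open>The bottom row is excluded: for even \<open>n\<close> its last cell is its own right
  neighbour.\<close>

lemma right_value_insert:
  assumes "(a, b) \<in> core_idx n" "a < (n + 1) div 2"
  shows "right_value n (insert (a, b) U) (a, b) = right_value n U (a, b)"
  using assms by (auto simp: right_value_def)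

lemma elimination_step:
  assumes "(a, Suc b) \<in> core_idx n"
    and "\<And>U. U \<subseteq> processed n a (Suc b) \<Longrightarrow> cell_weight n U (a, Suc b) * \<psi> U +
       cell_weight n (insert (a, Suc b) U) (a, Suc b) * \<psi> (insert (a, Suc b) U) \<le> m * \<phi> U"
  shows "weighted_sum (cell_weight n) \<psi> (processed n a b) \<le> m * weighted_sum (cell_weight n) \<phi> (processed n a (Suc b))"
  unfolding processed_insert[OF assms(1)]
proof (rule weighted_sum_insert_le)
  show "cell_weight n (insert (a, Suc b) U) w = cell_weight n U w" if "w \<in> processed n a (Suc b)" for U w
    by (rule cell_weight_insert[OF assms(1) that])
  show "cell_weight n U (a, Suc b) * \<psi> U +
      cell_weight n (insert (a, Suc b) U) (a, Suc b) * \<psi> (insert (a, Suc b) U) \<le> m * \<phi> U"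
    if "U \<subseteq> processed n a (Suc b)" for U
    by (rule assms(2)[OF that])
qed (rule finite_processed not_processed cell_weight_nonneg)+

lemma row_bound:
  assumes a: "1 \<le> a" "a \<le> (n + 1) div 2" and m: "0 \<le> m"
    and step: "\<And>b U. (a, b) \<in> core_idx n \<Longrightarrow> U \<subseteq> processed n a b \<Longrightarrow>
      cell_weight n U (a, b) + cell_weight n (insert (a, b) U) (a, b) \<le> m"
  shows "weighted_sum (cell_weight n) (\<lambda>_. 1) (processed n a 0) \<le>
    m ^ (n div 2) * weighted_sum (cell_weight n) (\<lambda>_. 1) (processed n a (n div 2))"
proof -
  let ?W = "weighted_sum (cell_weight n) (\<lambda>_. 1)"
  have "?W (processed n a b) \<le> m ^ (n div 2 - b) * ?W (processed n a (n div 2))" if "b \<le> n div 2" for b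
    using that
  proof (induction b rule: inc_induct)
    case base
    then show ?case by simp
  next
    case (step b)
    have v: "(a, Suc b) \<in> core_idx n" using step a by (auto simp: mem_core_idx)
    have "?W (processed n a b) \<le> m * ?W (processed n a (Suc b))"
      by (rule elimination_step[OF v]) (use assms(4)[OF v] in simp)
    also have "\<dots> \<le> m * (m ^ (n div 2 - Suc b) * ?W (processed n a (n div 2)))"
      using step m by (intro mult_left_mono) auto
    also have "\<dots> = m ^ Suc (n div 2 - Suc b) * ?W (processed n a (n div 2))" by simp
    also have "Suc (n div 2 - Suc b) = n div 2 - b" using step by simp
    finally show ?case .
  qed
  from this[of 0] show ?thesis by simp
qed

text \<open>Only the right edge is charged, with factors 1 and 2. At the loop of even
  \<open>n\<close> the sum is smaller, which the monotonicity of \<open>right_value\<close>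
  covers.\<close>

lemma bottom_row_bound:
  assumes "2 \<le> (n + 1) div 2" "((n + 1) div 2, b) \<in> core_idx n" "U \<subseteq> processed n ((n + 1) div 2) b"
  shows "cell_weight n U ((n + 1) div 2, b) + cell_weight n (insert ((n + 1) div 2, b) U) ((n + 1) div 2, b) \<le> 3"
proof -
  have "((n + 1) div 2, b) \<notin> U" using assms(3) not_processed by blast
  moreover have "right_value n U v \<Longrightarrow> right_value n (insert u U) v" for u v
    by (cases v) (auto simp: right_value_def split: if_splits)
  ultimately show ?thesis using assms(1) by (auto simp: cell_weight_def edge_weight_def)
qed

text \<open>The two choices give 1 + 4 if the right and lower neighbours agree, and 2 + 2
  otherwise.\<close>

lemma middle_row_bound:
  assumes "2 \<le> a" "a < (n + 1) div 2" "(a, b) \<in> core_idx n" "U \<subseteq> processed n a b"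
  shows "cell_weight n U (a, b) + cell_weight n (insert (a, b) U) (a, b) \<le> 5"
proof -
  have "(a, b) \<notin> U" using assms(4) not_processed by blast
  then show ?thesis using assms right_value_insert[OF assms(3,2), of U]
    by (auto simp: cell_weight_def edge_weight_def)
qed

text \<open>
  A potential for the top row: 4/5 and 37/5 are chosen such that \<open>top_row_bound\<close> holds for all states
  and \<open>3 * 37/5 < 25\<close>, whereas the naive factor 9 of a top row cell would give \<open>3 * 9 > 25\<close>.
\<close>

definition state_factor :: "bool \<Rightarrow> real" where
  "state_factor s = (if s then 4 / 5 else 1)"

text \<open>The worst case 1 + 8 arises when both decided neighbours are outside \<open>U\<close>.
  Its large term puts the cell into \<open>U\<close>, and the discount 4/5 turns the sum into 37/5.
  The second bound serves the leftmost cell, which has no successor in the row.\<close>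

lemma top_row_bound:
  assumes "1 < (n + 1) div 2" "(1, b) \<in> core_idx n" "U \<subseteq> processed n 1 b"
  shows "cell_weight n U (1, b) * state_factor False + cell_weight n (insert (1, b) U) (1, b) * state_factor True
      \<le> 37 / 5 * state_factor (right_value n U (1, b))"
    and "cell_weight n U (1, b) + cell_weight n (insert (1, b) U) (1, b)
      \<le> 9 * state_factor (right_value n U (1, b))"
proof -
  have notin: "(1, b) \<notin> U" using assms(3) not_processed by blast
  have r: "right_value n (insert (1, b) U) (1, b) = right_value n U (1, b)"
    by (rule right_value_insert[OF assms(2,1)])
  have w: "cell_weight n U (1, b) = edge_weight False (right_value n U (1, b)) * edge_weight False ((2, b) \<in> U)"
    "cell_weight n (insert (1, b) U) (1, b) = edge_weight True (right_value n U (1, b)) * edge_weight True ((2, b) \<in> U) * 2"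
    using notin assms(1) r by (simp_all add: cell_weight_def edge_weight_def numeral_2_eq_2)
  show "cell_weight n U (1, b) * state_factor False + cell_weight n (insert (1, b) U) (1, b) * state_factor True
      \<le> 37 / 5 * state_factor (right_value n U (1, b))"
    and "cell_weight n U (1, b) + cell_weight n (insert (1, b) U) (1, b)
      \<le> 9 * state_factor (right_value n U (1, b))"
    unfolding w by (auto simp: edge_weight_def state_factor_def)
qed

text \<open>Top and bottom row together get the budget \<open>25 ^ k\<close> and use
  \<open>27 * (111 / 5) ^ (k - 1)\<close>, where 111/5 is 3 times 37/5. For \<open>k = 1\<close>
  this would read 27 \<le> 25, hence the restriction on \<open>n\<close>.\<close>

lemma total_weight_bound:
  assumes n: "4 \<le> n"
  shows "weighted_sum (cell_weight n) (\<lambda>_. 1) (core_idx n) \<le> 5 ^ (n div 2 * ((n + 1) div 2))"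
proof -
  define k where "k = n div 2"
  define l where "l = (n + 1) div 2"
  let ?W = "weighted_sum (cell_weight n)"
  have k2: "2 \<le> k" "2 \<le> l" using n by (auto simp: k_def l_def)
  have core: "(a, b) \<in> core_idx n \<longleftrightarrow> 1 \<le> a \<and> 1 \<le> b \<and> a \<le> l \<and> b \<le> k" for a b
    by (simp add: mem_core_idx k_def l_def)
  have W0: "0 \<le> ?W (\<lambda>_. 1) A" for A
    unfolding weighted_sum_def by (intro sum_nonneg mult_nonneg_nonneg prod_nonneg cell_weight_nonneg) auto
  have "?W (\<lambda>_. 1) (processed n l 0) \<le> 3 ^ k * ?W (\<lambda>_. 1) (processed n l k)"
    unfolding k_def l_def
    by (rule row_bound) (use k2 bottom_row_bound in \<open>auto simp: l_def\<close>)
  also have "?W (\<lambda>_. 1) (processed n l k) = 1"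
    unfolding k_def l_def processed_none by (simp add: weighted_sum_def)
  finally have bottom: "?W (\<lambda>_. 1) (processed n l 0) \<le> 3 ^ k" by simp
  have middle: "?W (\<lambda>_. 1) (processed n a 0) \<le> (5 ^ k) ^ (l - a) * 3 ^ k" if "2 \<le> a" "a \<le> l" for a
    using that(2,1)
  proof (induction a rule: inc_induct)
    case base
    then show ?case using bottom by simp
  next
    case (step a)
    have "?W (\<lambda>_. 1) (processed n a 0) \<le> 5 ^ k * ?W (\<lambda>_. 1) (processed n a k)"
      unfolding k_def by (rule row_bound) (use step middle_row_bound in \<open>auto simp: l_def\<close>)
    also have "processed n a k = processed n (Suc a) 0" using processed_next_row[of "Suc a" n] by (simp add: k_def)
    also have "5 ^ k * ?W (\<lambda>_. 1) (processed n (Suc a) 0) \<le> 5 ^ k * ((5 ^ k) ^ (l - Suc a) * 3 ^ k)"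
      using step by (intro mult_left_mono) auto
    also have "\<dots> = (5 ^ k) ^ Suc (l - Suc a) * 3 ^ k" by simp
    also have "Suc (l - Suc a) = l - a" using step by simp
    finally show ?case .
  qed
  \<comment> \<open>The potential watches the right neighbour of \<open>(1, b)\<close>; at
    \<open>b = k\<close> this is the bottom cell where the first line turns.\<close>
  define \<phi> where "\<phi> = (\<lambda>b U. state_factor (right_value n U (1, b)))"
  have top: "?W (\<phi> b) (processed n 1 b) \<le> (37 / 5) ^ (k - b) * ?W (\<phi> k) (processed n 1 k)" if "1 \<le> b" "b \<le> k" for b
    using that(2,1)
  proof (induction b rule: inc_induct)
    case base
    then show ?case by simp
  next
    case (step b)
    have v: "(1, Suc b) \<in> core_idx n" using step k2 by (simp add: core)
    have "?W (\<phi> b) (processed n 1 b) \<le> 37 / 5 * ?W (\<phi> (Suc b)) (processed n 1 (Suc b))"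
    proof (rule elimination_step[OF v])
      fix U assume U: "U \<subseteq> processed n 1 (Suc b)"
      have "\<phi> b U = state_factor False" "\<phi> b (insert (1, Suc b) U) = state_factor True"
      proof -
        have "b < n div 2" using step by (simp add: k_def)
        moreover have "(1, Suc b) \<notin> U" using U not_processed by blast
        ultimately show "\<phi> b U = state_factor False" "\<phi> b (insert (1, Suc b) U) = state_factor True"
          by (simp_all add: \<phi>_def right_value_def)
      qed
      then show "cell_weight n U (1, Suc b) * \<phi> b U +
          cell_weight n (insert (1, Suc b) U) (1, Suc b) * \<phi> b (insert (1, Suc b) U) \<le> 37 / 5 * \<phi> (Suc b) U"
        using top_row_bound(1)[OF _ v U] k2 by (simp add: \<phi>_def l_def)
    qed
    also have "\<dots> \<le> 37 / 5 * ((37 / 5) ^ (k - Suc b) * ?W (\<phi> k) (processed n 1 k))"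
      using step by (intro mult_left_mono) auto
    also have "\<dots> = (37 / 5) ^ Suc (k - Suc b) * ?W (\<phi> k) (processed n 1 k)" by simp
    also have "Suc (k - Suc b) = k - b" using step by simp
    finally show ?case .
  qed
  have v: "(1, Suc 0) \<in> core_idx n" using k2 by (simp add: core)
  have "?W (\<lambda>_. 1) (core_idx n) \<le> 9 * ?W (\<phi> (Suc 0)) (processed n 1 (Suc 0))"
    unfolding processed_all[symmetric]
  proof (rule elimination_step[OF v])
    fix U assume U: "U \<subseteq> processed n 1 (Suc 0)"
    show "cell_weight n U (1, Suc 0) * 1 + cell_weight n (insert (1, Suc 0) U) (1, Suc 0) * 1 \<le> 9 * \<phi> (Suc 0) U"
      using top_row_bound(2)[OF _ v U] k2 by (simp add: \<phi>_def l_def)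
  qed
  also have "\<dots> \<le> 9 * ((37 / 5) ^ (k - 1) * ?W (\<phi> k) (processed n 1 k))"
    using top[of 1] k2 by simp
  also have "?W (\<phi> k) (processed n 1 k) \<le> ?W (\<lambda>_. 1) (processed n 1 k)"
    unfolding weighted_sum_def
    by (intro sum_mono mult_left_mono prod_nonneg) (auto simp: \<phi>_def state_factor_def cell_weight_nonneg)
  also have "processed n 1 k = processed n 2 0" using processed_next_row[of 2 n] by (simp add: k_def)
  also have "?W (\<lambda>_. 1) (processed n 2 0) \<le> (5 ^ k) ^ (l - 2) * 3 ^ k" using middle[of 2] k2 by simp
  finally have "?W (\<lambda>_. 1) (core_idx n) \<le> 9 * ((37 / 5) ^ (k - 1) * ((5 ^ k) ^ (l - 2) * 3 ^ k))" by simp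
  also have "\<dots> = (27 * (111 / 5) ^ (k - 1)) * (5 ^ k) ^ (l - 2)"
  proof -
    have "(3 :: real) ^ k = 3 * 3 ^ (k - 1)" using k2 by (simp add: power_eq_if)
    moreover have "(37 / 5 :: real) ^ (k - 1) * 3 ^ (k - 1) = (111 / 5) ^ (k - 1)"
      by (simp flip: power_mult_distrib)
    ultimately show ?thesis by (simp add: algebra_simps)
  qed
  also have "\<dots> \<le> 25 ^ k * (5 ^ k) ^ (l - 2)"
  proof (rule mult_right_mono)
    \<comment> \<open>The base case is 599.4 \<le> 625.\<close>
    have "(27 :: real) * (111 / 5) ^ (j + 1) \<le> 25 * 25 ^ (j + 1)" for j
    proof (induction j)
      case (Suc j)
      have "(27 :: real) * (111 / 5) ^ (Suc j + 1) = 111 / 5 * (27 * (111 / 5) ^ (j + 1))" by simp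
      also have "\<dots> \<le> 25 * (25 * 25 ^ (j + 1))" by (rule mult_mono[OF _ Suc.IH]) simp_all
      finally show ?case by simp
    qed simp
    moreover obtain j where "k = j + 2" using k2(1) by (metis add.commute le_Suc_ex)
    ultimately show "(27 :: real) * (111 / 5) ^ (k - 1) \<le> 25 ^ k" by simp
  qed simp
  also have "(25 :: real) ^ k = (5 ^ k) ^ 2"
  proof -
    have "((5 :: real) ^ k) ^ 2 = (5 ^ 2) ^ k" by (metis power_mult mult.commute)
    then show ?thesis by simp
  qed
  also have "((5 :: real) ^ k) ^ 2 * (5 ^ k) ^ (l - 2) = (5 ^ k) ^ (2 + (l - 2))" by (simp only: power_add)
  also have "2 + (l - 2) = l" using k2 by simp
  also have "((5 :: real) ^ k) ^ l = 5 ^ (k * l)" by (simp only: power_mult)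
  finally show ?thesis by (simp add: k_def l_def)
qed

text \<open>The sums are 1, 3 and 21, against the bounds 1, 5 and 25.\<close>

lemma parity_signs_small:
  assumes "n \<in> {1, 2, 3}"
  shows "weighted_sum (cell_weight n) (\<lambda>_. 1) (core_idx n) \<le> 5 ^ (n div 2 * ((n + 1) div 2))"
proof -
  have "n = 1 \<or> n = 2 \<or> n = 3" using assms by auto
  then show ?thesis
  proof (elim disjE)
    assume n: "n = 1"
    have "core_idx n = {}" by (auto simp: mem_core_idx n)
    then show ?thesis by (simp add: weighted_sum_def)
  next
    assume n: "n = 2"
    have "core_idx n = {(1, 1)}" by (auto simp: mem_core_idx n)
    then show ?thesis
      by (simp add: weighted_sum_def Pow_insert n cell_weight_def right_value_def edge_weight_def)
  next
    assume n: "n = 3"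
    have "core_idx n = {(1, 1), (2, 1)}" by (auto simp: mem_core_idx n)
    then show ?thesis
      by (simp add: weighted_sum_def Pow_insert n cell_weight_def right_value_def edge_weight_def)
  qed
qed

lemma card_parity_signs:
  assumes "1 \<le> n"
  shows "card (parity_signs n) \<le> 5 ^ (n div 2 * ((n + 1) div 2))"
proof -
  have "real (card (parity_signs n)) \<le> real (\<Sum>U\<in>Pow (core_idx n). 2 ^ card (cell_cut n U))"
    using card_parity_signs_le by (rule of_nat_mono)
  also have "\<dots> = weighted_sum (cell_weight n) (\<lambda>_. 1) (core_idx n)"
    unfolding weighted_sum_def of_nat_sum by (rule sum.cong) (simp_all add: two_power_cut)
  also have "\<dots> \<le> 5 ^ (n div 2 * ((n + 1) div 2))"
  proof (cases "4 \<le> n")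
    case True
    then show ?thesis by (rule total_weight_bound)
  next
    case False
    then have "n \<in> {1, 2, 3}" using assms by auto
    then show ?thesis by (rule parity_signs_small)
  qed
  finally have "real (card (parity_signs n)) \<le> real (5 ^ (n div 2 * ((n + 1) div 2)))" by simp
  then show ?thesis by (simp only: of_nat_le_iff)
qed

section \<open>Numbers of indices and the final bounds\<close>

lemma floor_quarter_square: "nat \<lfloor>(real n)\<^sup>2 / 4\<rfloor> = n div 2 * ((n + 1) div 2)"
proof (cases "even n")
  case True
  then obtain k where "n = 2 * k" by (rule evenE)
  then have e: "(real n)\<^sup>2 / 4 = real (k * k)" and f: "n div 2 * ((n + 1) div 2) = k * k"
    by (simp_all add: power2_eq_square)
  show ?thesis unfolding e f floor_of_nat nat_int ..
next
  case False
  then obtain k where n: "n = 2 * k + 1" by (rule oddE)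
  have "(real n)\<^sup>2 / 4 = real (k * (k + 1)) + 1 / 4" by (simp add: n power2_eq_square field_simps)
  then have e: "\<lfloor>(real n)\<^sup>2 / 4\<rfloor> = int (k * (k + 1))" by (simp add: floor_eq_iff)
  have f: "n div 2 * ((n + 1) div 2) = k * (k + 1)" by (simp add: n)
  show ?thesis unfolding e f nat_int ..
qed

lemma card_bounded_idx: "2 * card (bounded_idx n) = n * (n - 1)"
proof (cases "even n")
  case True
  then obtain k where n: "n = 2 * k" by (rule evenE)
  have "bounded_idx n = {1..k} \<times> {1..<n}" by (auto simp: bounded_idx_def mem_Ctilde n)
  then show ?thesis by (simp add: card_cartesian_product n)
next
  case False
  then obtain k where n: "n = 2 * k + 1" by (rule oddE)
  have "bounded_idx n = {1..k} \<times> {1..<n} \<union> {k + 1} \<times> {1..k}"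
    by (auto simp: bounded_idx_def mem_Ctilde n)
  moreover have "({1..k} \<times> {1..<n}) \<inter> ({k + 1} \<times> {1..k}) = {}" by auto
  ultimately have "card (bounded_idx n) = k * (2 * k) + k"
    by (simp add: card_Un_disjoint card_cartesian_product n)
  then show ?thesis by (simp add: n algebra_simps)
qed

theorem theorem6p6:
  fixes n :: nat
  assumes "n \<ge> 1" and "n = CARD('n::{finite,linorder})"
  shows "(P_core_QTSASM :: (real^'n::{finite,linorder}^'n::{finite,linorder}) set)
           = embed_core ` {y. satisfies_description n y} \<and>
    2 * card (bounded_idx n) + card (parity_signs n)
      \<le> 5 ^ nat \<lfloor>(real n)\<^sup>2 / 4\<rfloor> + n * (n - 1) \<and>
    finite {F. F facet_of (P_core_QTSASM :: (real^'n::{finite,linorder}^'n::{finite,linorder}) set)} \<and>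
    card {F. F facet_of (P_core_QTSASM :: (real^'n::{finite,linorder}^'n::{finite,linorder}) set)}
      \<le> 5 ^ nat \<lfloor>(real n)\<^sup>2 / 4\<rfloor> + n * (n - 1) \<and>
    finite {F. F facet_of (P_QTSASM :: (real^'n::{finite,linorder}^'n::{finite,linorder}) set)} \<and>
    card {F. F facet_of (P_QTSASM :: (real^'n::{finite,linorder}^'n::{finite,linorder}) set)}
      \<le> 5 ^ nat \<lfloor>(real n)\<^sup>2 / 4\<rfloor> + n * (n - 1)"
proof -
  have N: "CARD('n) = n" using assms(2) by simp
  have "2 * card (bounded_idx n) + card (parity_signs n) \<le> 5 ^ nat \<lfloor>(real n)\<^sup>2 / 4\<rfloor> + n * (n - 1)"
    using card_bounded_idx[of n] card_parity_signs[OF assms(1)] by (simp add: floor_quarter_square)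
  then show ?thesis
    using P_core_QTSASM_description[where 'n = 'n] P_core_QTSASM_facets[where 'n = 'n]
      P_QTSASM_facets[where 'n = 'n]
    unfolding N by (meson order_trans)
qed

end
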